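(* Let $0<c_u<1/4$ and $c_l>1/4$. There are constants $C_u,C_l>0$ such that for all $\mathbf x,\mathbf y\in\mathbb R^N$ and $t>0$, $$C_l\, w(B(\mathbf x,\sqrt t))^{-1} e^{-c_l\frac{d(\mathbf x,\mathbf y)^2}{t}}\,\Lambda(\mathbf x,\mathbf y,t)\le h_t(\mathbf x,\mathbf y)$$ and $$h_t(\mathbf x,\mathbf y)\le C_u\, w(B(\mathbf x,\sqrt t))^{-1} e^{-c_u\frac{d(\mathbf x,\mathbf y)^2}{t}}\,\Lambda(\mathbf x,\mathbf y,t).$$
   Context: Setting. $\mathbb R^N$ has the standard inner product $\langle\cdot,\cdot\rangle$ and norm $\|\cdot\|$. $R\subset\mathbb R^N\setminus\{0\}$ is a fixed normalized root system: a finite set with $R\cap\alpha\mathbb R=\{\pm\alpha\}$, $\sigma_\alpha(R)=R$ and $\|\alpha\|=\sqrt2$ for all $\alpha\in R$, where $\sigma_\alpha(\mathbf x)=\mathbf x-2\frac{\langle\mathbf x,\alpha\rangle}{\|\alpha\|^2}\alpha$. $R_+$ is a fixed positive subsystem ($R=R_+\cup(-R_+)$ disjointly, the two parts separated by a hyperplane through $0$). $G$ is the finite group generated by $\sigma_\alpha$, $\alpha\in R$, and $|G|$ is its order. $k:R\to(0,\infty)$ is a fixed $G$-invariant function. Put $w(\mathbf x)=\prod_{\alpha\in R}|\langle\mathbf x,\alpha\rangle|^{k(\alpha)}$, $dw(\mathbf x)=w(\mathbf x)\,d\mathbf x$, $w(A)=\int_A dw$, $\mathbf N=N+\sum_{\alpha\in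 R}k(\alpha)$, $B(\mathbf x,r)=\{\mathbf x':\|\mathbf x-\mathbf x'\|\le r\}$, and $d(\mathbf x,\mathbf y)=\min_{\sigma\in G}\|\mathbf x-\sigma(\mathbf y)\|$. Dunkl heat kernel. For $\xi\in\mathbb R^N$ the Dunkl operator is $T_\xi f(\mathbf x)=\partial_\xi f(\mathbf x)+\sum_{\alpha\in R}\frac{k(\alpha)}2\langle\alpha,\xi\rangle\frac{f(\mathbf x)-f(\sigma_\alpha(\mathbf x))}{\langle\alpha,\mathbf x\rangle}$. For fixed $\mathbf y\in\mathbb R^N$ the Dunkl kernel $E(\cdot,\mathbf y)$ is the unique analytic solution of $T_\xi f=\langle\xi,\mathbf y\rangle f$ (all $\xi$), $f(0)=1$. With $\boldsymbol c_k=\int_{\mathbb R^N}e^{-\|\mathbf x\|^2/2}\,dw(\mathbf x)$, the Dunkl heat kernel is $$h_t(\mathbf x,\mathbf y)=\boldsymbol c_k^{-1}(2t)^{-\mathbf N/2}E\Big(\frac{\mathbf x}{\sqrt{2t}},\frac{\mathbf y}{\sqrt{2t}}\Big)e^{-(\|\mathbf x\|^2+\|\mathbf y\|^2)/(4t)},\qquad \mathbf x,\mathbf y\in\mathbb R^N,\ t>0.$$ It is the (strictly positive, symmetric, smooth) integral kernel with respect to $dw$ of the semigroup generated on $L^2(dw)$ by the Dunkl Laplacian $\Delta_k=\sum_{j=1}^N T_{e_j}^2$. Sequences of roots. For a finite sequence $\boldsymbol\alpha=(\alpha_1,\dots,\alpha_m)$ of elements of $R$ put $\ell(\boldsymbol\alpha)=m$,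 $\sigma_{\boldsymbol\alpha}=\sigma_{\alpha_m}\circ\cdots\circ\sigma_{\alpha_1}$ and $$\rho_{\boldsymbol\alpha}(\mathbf x,\mathbf y,t)=\prod_{j=0}^{m-1}\Big(1+\frac{\|\mathbf x-\sigma_{\alpha_j}\circ\cdots\circ\sigma_{\alpha_1}(\mathbf y)\|}{\sqrt t}\Big)^{-2},$$ where the $j=0$ factor is $(1+\|\mathbf x-\mathbf y\|/\sqrt t)^{-2}$. The empty sequence is allowed: $\ell(\emptyset)=0$, $\sigma_\emptyset=I$, $\rho_\emptyset=1$. $\mathcal A(\mathbf x,\mathbf y)$ (the admissible sequences for $(\mathbf x,\mathbf y)$) is the set of finite (possibly empty) sequences $\boldsymbol\alpha$ of elements of $R_+$ with $\|\mathbf x-\sigma_{\boldsymbol\alpha}(\mathbf y)\|=d(\mathbf x,\mathbf y)$. Finally $$\Lambda(\mathbf x,\mathbf y,t)=\sum_{\boldsymbol\alpha\in\mathcal A(\mathbf x,\mathbf y),\ \ell(\boldsymbol\alpha)\le 2|G|}\rho_{\boldsymbol\alpha}(\mathbf x,\mathbf y,t).$$ *)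

theory Defs
  imports "HOL-Analysis.Analysis" "HOL-Algebra.Bij" "HOL-Algebra.Generated_Groups"
begin

definition root_reflection :: "real ^ 'n \<Rightarrow> real ^ 'n \<Rightarrow> real ^ 'n"
  where "root_reflection \<alpha> x = x - (2 * (x \<bullet> \<alpha>) / (norm \<alpha>)\<^sup>2) *\<^sub>R \<alpha>"

definition normalized_root_system :: "(real ^ 'n) set \<Rightarrow> bool"
  where "normalized_root_system R \<longleftrightarrow>
    finite R \<and> 0 \<notin> R \<and>
    (\<forall>\<alpha>\<in>R. R \<inter> range (\<lambda>s::real. s *\<^sub>R \<alpha>) = {\<alpha>, - \<alpha>} \<and>
            root_reflection \<alpha> ` R = R \<and>
            norm \<alpha> = sqrt 2)"

definition positive_subsystem :: "(real ^ 'n) set \<Rightarrow> (real ^ 'n) set \<Rightarrow> bool"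
  where "positive_subsystem R Rp \<longleftrightarrow>
    R = Rp \<union> uminus ` Rp \<and> Rp \<inter> uminus ` Rp = {} \<and>
    (\<exists>v. v \<noteq> 0 \<and> (\<forall>\<alpha>\<in>Rp. v \<bullet> \<alpha> > 0) \<and> (\<forall>\<alpha>\<in>uminus ` Rp. v \<bullet> \<alpha> < 0))"

definition reflection_group :: "(real ^ 'n) set \<Rightarrow> (real ^ 'n \<Rightarrow> real ^ 'n) set"
  where "reflection_group R = generate (BijGroup UNIV) (root_reflection ` R)"

definition multiplicity_function :: "(real ^ 'n) set \<Rightarrow> (real ^ 'n \<Rightarrow> real) \<Rightarrow> bool"
  where "multiplicity_function R k \<longleftrightarrow>
    (\<forall>\<alpha>\<in>R. k \<alpha> > 0) \<and> (\<forall>g\<in>reflection_group R. \<forall>\<alpha>\<in>R. k (g \<alpha>) = k \<alpha>)"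

definition dunkl_weight :: "(real ^ 'n) set \<Rightarrow> (real ^ 'n \<Rightarrow> real) \<Rightarrow> real ^ 'n \<Rightarrow> real"
  where "dunkl_weight R k x = (\<Prod>\<alpha>\<in>R. \<bar>x \<bullet> \<alpha>\<bar> powr k \<alpha>)"

definition dunkl_measure :: "(real ^ 'n) set \<Rightarrow> (real ^ 'n \<Rightarrow> real) \<Rightarrow> (real ^ 'n) measure"
  where "dunkl_measure R k = density lborel (\<lambda>x. ennreal (dunkl_weight R k x))"

definition homogeneous_dim :: "(real ^ 'n) set \<Rightarrow> (real ^ 'n \<Rightarrow> real) \<Rightarrow> real"
  where "homogeneous_dim R k = real CARD('n) + (\<Sum>\<alpha>\<in>R. k \<alpha>)"

definition orbit_dist :: "(real ^ 'n) set \<Rightarrow> real ^ 'n \<Rightarrow> real ^ 'n \<Rightarrow> real"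
  where "orbit_dist R x y = Min ((\<lambda>g. norm (x - g y)) ` reflection_group R)"

text \<open>Real analyticity on the whole space: near every point the function is the sum of an
  (unconditionally) convergent power series, indexed by multi-indices \<open>m\<close>.\<close>

definition real_analytic :: "(real ^ 'n \<Rightarrow> real) \<Rightarrow> bool"
  where "real_analytic f \<longleftrightarrow>
    (\<forall>a. \<exists>r>0. \<exists>c :: ('n \<Rightarrow> nat) \<Rightarrow> real. \<forall>x\<in>ball a r.
      ((\<lambda>m. c m * (\<Prod>i\<in>UNIV. (x $ i - a $ i) ^ m i)) has_sum f x) UNIV)"

text \<open>On the hyperplane orthogonal to \<open>\<alpha>\<close> the difference quotient is undefined; there, as usual
  for Dunkl operators, it stands for its continuous extension (which exists for \<open>C\<^sup>1\<close> functions).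
  The totalized division by zero would give a wrong operator.\<close>

definition reflection_quotient ::
    "real ^ 'n \<Rightarrow> (real ^ 'n \<Rightarrow> real) \<Rightarrow> real ^ 'n \<Rightarrow> real"
  where "reflection_quotient \<alpha> f x =
    (if \<alpha> \<bullet> x \<noteq> 0 then (f x - f (root_reflection \<alpha> x)) / (\<alpha> \<bullet> x)
     else Lim (at x within {z. \<alpha> \<bullet> z \<noteq> 0})
            (\<lambda>z. (f z - f (root_reflection \<alpha> z)) / (\<alpha> \<bullet> z)))"

definition dunkl_operator ::
    "(real ^ 'n) set \<Rightarrow> (real ^ 'n \<Rightarrow> real) \<Rightarrow> real ^ 'n \<Rightarrow>
      (real ^ 'n \<Rightarrow> real) \<Rightarrow> real ^ 'n \<Rightarrow> real"
  where "dunkl_operator R k \<xi> f x =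
    deriv (\<lambda>s. f (x + s *\<^sub>R \<xi>)) 0 +
    (\<Sum>\<alpha>\<in>R. k \<alpha> / 2 * (\<alpha> \<bullet> \<xi>) * reflection_quotient \<alpha> f x)"

definition dunkl_kernel ::
    "(real ^ 'n) set \<Rightarrow> (real ^ 'n \<Rightarrow> real) \<Rightarrow> real ^ 'n \<Rightarrow> real ^ 'n \<Rightarrow> real"
  where "dunkl_kernel R k x y =
    (THE f. real_analytic f \<and> (\<forall>\<xi> z. dunkl_operator R k \<xi> f z = (\<xi> \<bullet> y) * f z) \<and> f 0 = 1) x"

definition gauss_const :: "(real ^ 'n) set \<Rightarrow> (real ^ 'n \<Rightarrow> real) \<Rightarrow> real"
  where "gauss_const R k = (\<integral>x. exp (- (norm x)\<^sup>2 / 2) \<partial>dunkl_measure R k)"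

definition dunkl_heat_kernel ::
    "(real ^ 'n) set \<Rightarrow> (real ^ 'n \<Rightarrow> real) \<Rightarrow> real \<Rightarrow> real ^ 'n \<Rightarrow> real ^ 'n \<Rightarrow> real"
  where "dunkl_heat_kernel R k t x y =
    inverse (gauss_const R k) * (2 * t) powr (- homogeneous_dim R k / 2) *
    dunkl_kernel R k (x /\<^sub>R sqrt (2 * t)) (y /\<^sub>R sqrt (2 * t)) *
    exp (- ((norm x)\<^sup>2 + (norm y)\<^sup>2) / (4 * t))"

text \<open>A sequence \<open>\<alpha>\<^sub>1, \<dots>, \<alpha>\<^sub>m\<close> is a list; \<open>fold\<close> applies the reflection in
  \<open>\<alpha>\<^sub>1\<close> first and the one in \<open>\<alpha>\<^sub>m\<close> last.\<close>

definition seq_reflection :: "(real ^ 'n) list \<Rightarrow> real ^ 'n \<Rightarrow> real ^ 'n"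
  where "seq_reflection as = fold root_reflection as"

definition seq_weight :: "(real ^ 'n) list \<Rightarrow> real ^ 'n \<Rightarrow> real ^ 'n \<Rightarrow> real \<Rightarrow> real"
  where "seq_weight as x y t =
    (\<Prod>j<length as. inverse ((1 + norm (x - seq_reflection (take j as) y) / sqrt t)\<^sup>2))"

definition admissible_seqs ::
    "(real ^ 'n) set \<Rightarrow> (real ^ 'n) set \<Rightarrow> real ^ 'n \<Rightarrow> real ^ 'n \<Rightarrow> (real ^ 'n) list set"
  where "admissible_seqs R Rp x y =
    {as. set as \<subseteq> Rp \<and> norm (x - seq_reflection as y) = orbit_dist R x y}"

definition Lambda_sum ::
    "(real ^ 'n) set \<Rightarrow> (real ^ 'n) set \<Rightarrow> real ^ 'n \<Rightarrow> real ^ 'n \<Rightarrow> real \<Rightarrow> real"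
  where "Lambda_sum R Rp x y t =
    (\<Sum>as\<in>{as \<in> admissible_seqs R Rp x y. length as \<le> 2 * card (reflection_group R)}.
       seq_weight as x y t)"

end

theory Submission
  imports Defs
begin

text \<open>
  For fixed \<open>x\<close>, \<open>y\<close> put \<open>m = max\<^sub>g \<langle>x, g y\<rangle>\<close> and
  \<open>b h = m - \<langle>x, h y\<rangle> = (\<parallel>x - h y\<parallel>\<^sup>2 - d(x, y)\<^sup>2) / 2\<close>. Restricted to the rays through the orbit of
  \<open>x\<close>, the eigenvalue equations of the Dunkl kernel become a finite system of ordinary differential
  equations for \<open>u\<^sub>h(s) = e\<^bsup>-sm\<^esup> E(s h\<^sup>-\<^sup>1 x, y)\<close>, \<open>h \<in> G\<close>, namely
  \<open>u\<^sub>h' = - b h u\<^sub>h - s\<^sup>-\<^sup>1 \<Sum>\<^sub>\<alpha> \<kappa>\<^sub>\<alpha> (u\<^sub>h - u\<^bsub>\<sigma>\<^sub>\<alpha> h\<^esub>)\<close> with \<open>u\<^sub>h(0) = 1\<close> and \<open>\<kappa> = k / 2\<close>, and after rescaling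
  the heat kernel is \<open>u\<^bsub>id\<^esub>(1)\<close> times explicit factors. The maximum principle for this system yields
  everything. Up to powers of \<open>1 + d(x, y)\<close>, an explicit supersolution bounds all
  \<open>u\<^sub>h(1)\<close> by \<open>\<Prod>\<^sub>\<alpha> (1 + \<bar>\<langle>x, \<alpha>\<rangle>\<bar>)\<^bsup>-k(\<alpha>)\<^esup>\<close>, which is comparable to the reciprocal of the volume of the ball, and
  at the nearest points of the orbit this bound is attained. From there the size of
  \<open>u\<^bsub>id\<^esub>\<close> is propagated along sequences of reflections: each step through \<open>h\<close> costs a factor
  comparable to \<open>1 / (1 + b h)\<close>, so sums over admissible sequences are super- and subsolutions. The
  powers of \<open>1 + d(x, y)\<close> are absorbed by the strict inequalities between \<open>c_u\<close>, \<open>c_l\<close> and \<open>1 / 4\<close>.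

  The Dunkl kernel itself is the sum of homogeneous solutions \<open>f\<^sub>n\<close> obtained by inverting the Euler part
  \<open>\<Sum> x\<^sub>i T\<^sub>i\<close> on the group algebra; that they satisfy all the eigenvalue equations follows
  from the commutativity of the Dunkl operators and, again, the maximum principle.
\<close>

section \<open>Maximum principle\<close>

text \<open>The coupling in the orbit system has a sign: each u_h is pulled towards its reflected
  neighbours with nonnegative rates, so at a maximum over the orbit the reflection terms help. The
  rates blow up like 1 / s, which is why derivatives are only ever taken at s > 0. The upper bound
  comes from an explicit formula, but the lower bound at the nearest points does not: the unknown
  deficit \<open>Phi\<close> of ln u against the explicit profile enters its own estimate. It enters
  only logarithmically, because the scales s at which one root contributes form a window of
  logarithmic length, and so the estimate closes. Chamber geometry supplies one fact, that an orbit
  point which no single reflection brings nearer to x is already a nearest one; hence descending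
  paths end at b = 0. The cutoff 2|G| on the lengths is affordable because loops can be erased from
  longer paths. Constants must not depend on x and y, so every loss is tracked as a fixed power of 1
  + d(x, y).\<close>

lemma max_principle:
  fixes z z' :: "'i \<Rightarrow> real \<Rightarrow> real"
  assumes fin: "finite I"
    and cont: "\<And>i. i \<in> I \<Longrightarrow> continuous_on {a..b} (z i)"
    and init: "\<And>i. i \<in> I \<Longrightarrow> z i a \<le> 0"
    and der: "\<And>i s. i \<in> I \<Longrightarrow> a < s \<Longrightarrow> s \<le> b \<Longrightarrow> (z i has_real_derivative z' i s) (at s)"
    and step: "\<And>i s. i \<in> I \<Longrightarrow> a < s \<Longrightarrow> s \<le> b \<Longrightarrow> z i s > 0 \<Longrightarrow>
      (\<And>j. j \<in> I \<Longrightarrow> z j s \<le> z i s) \<Longrightarrow> z' i s \<le> C * z i s"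
    and i: "i \<in> I" and s: "s \<in> {a..b}"
  shows "z i s \<le> 0"
proof (rule ccontr)
  assume neg: "\<not> z i s \<le> 0"
  \<comment> \<open>The damping turns z' \<le> C z into a strictly negative derivative, so a
    positive maximum of y over all indices and times would be exceeded slightly to its left.\<close>
  define y where "y = (\<lambda>j r. exp (- (C + 1) * r) * z j r)"
  have conty: "continuous_on {a..b} (y j)" if "j \<in> I" for j
    unfolding y_def by (intro continuous_intros cont that)
  have "\<exists>r\<in>{a..b}. \<forall>r'\<in>{a..b}. y j r' \<le> y j r" if "j \<in> I" for j
    by (rule continuous_attains_sup) (use conty[OF that] s in auto)
  then obtain m where m: "\<And>j. j \<in> I \<Longrightarrow> m j \<in> {a..b}"
    "\<And>j r. j \<in> I \<Longrightarrow> r \<in> {a..b} \<Longrightarrow> y j r \<le> y j (m j)"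
    by metis
  define Y where "Y = Max ((\<lambda>j. y j (m j)) ` I)"
  have "Y \<in> (\<lambda>j. y j (m j)) ` I" unfolding Y_def using fin i by (intro Max_in) auto
  then obtain j where j: "j \<in> I" "Y = y j (m j)" by blast
  then have j: "j \<in> I" "\<And>l. l \<in> I \<Longrightarrow> y l (m l) \<le> y j (m j)"
    using fin Max_ge[of "(\<lambda>j. y j (m j)) ` I"] by (auto simp: Y_def)
  define r where "r = m j"
  have r: "r \<in> {a..b}" using m j r_def by auto
  have top: "y l q \<le> y j r" if "l \<in> I" "q \<in> {a..b}" for l q
    unfolding r_def using m(2)[OF that] j(2)[OF that(1)] by (rule order_trans)
  have "0 < y i s" using neg by (simp add: y_def)
  then have pos: "0 < y j r" using top[OF i s] by linarith
  then have zpos: "0 < z j r" by (simp add: y_def zero_less_mult_iff)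
  have ar: "a < r" using init[OF j(1)] r zpos by (cases "r = a") auto
  have zmax: "z l r \<le> z j r" if "l \<in> I" for l
    using top[OF that r] by (simp add: y_def)
  have le: "z' j r \<le> C * z j r" using step[OF j(1) ar _ zpos zmax] r by auto
  define y' where "y' = exp (- (C + 1) * r) * (z' j r - (C + 1) * z j r)"
  have dy: "(y j has_real_derivative y') (at r)"
    unfolding y_def y'_def
    by (rule derivative_eq_intros der[OF j(1) ar] refl | use r in \<open>simp add: algebra_simps\<close>)+
  have "z' j r - (C + 1) * z j r < 0" using le zpos by (simp add: algebra_simps)
  then have "y' < 0" unfolding y'_def by (simp add: mult_less_0_iff)
  then obtain d where d: "d > 0" "\<And>h. h > 0 \<Longrightarrow> h < d \<Longrightarrow> y j r < y j (r - h)"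
    using DERIV_neg_dec_left[OF dy] by auto
  define h where "h = min (d / 2) (r - a)"
  have "h > 0" "h < d" "r - h \<in> {a..b}" using d ar r by (auto simp: h_def min_def)
  then show False using d(2)[of h] top[OF j(1), of "r - h"] by linarith
qed

section \<open>Reflection groups\<close>

lemma inner_root_reflection:
  "root_reflection a x \<bullet> y = x \<bullet> root_reflection a y"
  by (simp add: root_reflection_def inner_diff inner_commute)

locale root_system =
  fixes R :: "(real ^ 'n) set"
  assumes rs: "normalized_root_system R"
begin

lemma finR [simp, intro]: "finite R"
  and norm_root: "a \<in> R \<Longrightarrow> norm a = sqrt 2"
  and refl_image: "a \<in> R \<Longrightarrow> root_reflection a ` R = R"
  and parallel: "a \<in> R \<Longrightarrow> R \<inter> range (\<lambda>s. s *\<^sub>R a) = {a, -a}"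
  using rs by (auto simp: normalized_root_system_def)

lemma root_inner_self: "a \<in> R \<Longrightarrow> a \<bullet> a = 2"
  by (simp add: dot_square_norm norm_root)

lemma root_nonzero: "a \<in> R \<Longrightarrow> a \<noteq> 0"
  using root_inner_self by force

lemma refl_eq: "a \<in> R \<Longrightarrow> root_reflection a x = x - (x \<bullet> a) *\<^sub>R a"
  by (simp add: root_reflection_def norm_root)

lemma refl_self: "a \<in> R \<Longrightarrow> root_reflection a a = - a"
  by (simp add: refl_eq root_inner_self scaleR_2)

lemma refl_refl [simp]: "a \<in> R \<Longrightarrow> root_reflection a (root_reflection a x) = x"
  by (simp add: refl_eq inner_diff root_inner_self scaleR_diff_left)

lemma linear_refl: "linear (root_reflection a)"
  unfolding root_reflection_def
  by (rule linearI) (simp_all add: algebra_simps inner_add_left add_divide_distrib inner_diff_left)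

lemma inner_refl_refl: "a \<in> R \<Longrightarrow> root_reflection a x \<bullet> root_reflection a y = x \<bullet> y"
  by (simp add: inner_root_reflection)

lemma refl_root [intro]: "a \<in> R \<Longrightarrow> b \<in> R \<Longrightarrow> root_reflection a b \<in> R"
  using refl_image by blast

lemma uminus_root [intro]: "a \<in> R \<Longrightarrow> - a \<in> R"
  using refl_root[of a a] by (simp add: refl_self)

lemma refl_uminus: "root_reflection (- a) = root_reflection a"
  by (rule ext) (simp add: root_reflection_def)

lemma root_parallel: "a \<in> R \<Longrightarrow> b \<in> R \<Longrightarrow> b = s *\<^sub>R a \<Longrightarrow> b = a \<or> b = - a"
  using parallel[of a] by blast

lemma bij_refl: "a \<in> R \<Longrightarrow> bij (root_reflection a)"
  by (rule o_bij[of "root_reflection a"]) (auto simp: fun_eq_iff)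

abbreviation G where "G \<equiv> reflection_group R"

lemma seq_reflection_simps [simp]:
  "seq_reflection [] = id"
  "seq_reflection (a # as) = seq_reflection as \<circ> root_reflection a"
  "seq_reflection (as @ bs) = seq_reflection bs \<circ> seq_reflection as"
  by (auto simp: seq_reflection_def)

lemma seq_reflection_rev:
  "set as \<subseteq> R \<Longrightarrow> seq_reflection (rev as) \<circ> seq_reflection as = id"
  "set as \<subseteq> R \<Longrightarrow> seq_reflection as \<circ> seq_reflection (rev as) = id"
  by (induction as) (auto simp: fun_eq_iff)

lemma seq_reflection_bij: "set as \<subseteq> R \<Longrightarrow> bij (seq_reflection as)"
  using seq_reflection_rev o_bij by metis

lemma G_eq: "G = seq_reflection ` {as. set as \<subseteq> R}"
proof (intro equalityI subsetI)
  interpret BG: group "BijGroup (UNIV :: (real^'n) set)" by (rule group_BijGroup)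
  have carr: "root_reflection a \<in> carrier (BijGroup UNIV)" if "a \<in> R" for a
    using bij_refl[OF that] by (simp add: BijGroup_def Bij_def)
  have mult: "g \<otimes>\<^bsub>BijGroup UNIV\<^esub> h = g \<circ> h" if "bij g" "bij h" for g h :: "real^'n \<Rightarrow> real^'n"
    using that by (simp add: BijGroup_def Bij_def compose_def comp_def restrict_def)
  have one: "\<one>\<^bsub>BijGroup UNIV\<^esub> = (id :: real^'n \<Rightarrow> real^'n)"
    by (simp add: BijGroup_def fun_eq_iff)
  fix g assume "g \<in> G"
  then have "g \<in> generate (BijGroup UNIV) (root_reflection ` R)"
    by (simp add: reflection_group_def)
  then show "g \<in> seq_reflection ` {as. set as \<subseteq> R}"
  proof induction
    case one
    then show ?case using \<open>\<one>\<^bsub>BijGroup UNIV\<^esub> = id\<close> by (intro image_eqI[of _ _ "[]"]) auto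
  next
    case (incl h)
    then obtain a where "a \<in> R" "h = root_reflection a" by auto
    then show ?case by (intro image_eqI[of _ _ "[a]"]) auto
  next
    case (inv h)
    then obtain a where a: "a \<in> R" "h = root_reflection a" by auto
    have "h \<otimes>\<^bsub>BijGroup UNIV\<^esub> h = \<one>\<^bsub>BijGroup UNIV\<^esub>"
      unfolding one a(2) mult[OF bij_refl[OF a(1)] bij_refl[OF a(1)]] using a by (auto simp: fun_eq_iff)
    then have "inv\<^bsub>BijGroup UNIV\<^esub> h = h"
      using BG.inv_equality carr a by blast
    then show ?case using a by (intro image_eqI[of _ _ "[a]"]) auto
  next
    case (eng g h)
    then obtain as bs where *: "set as \<subseteq> R" "set bs \<subseteq> R" "g = seq_reflection as" "h = seq_reflection bs"
      by auto
    then have "g \<otimes>\<^bsub>BijGroup UNIV\<^esub> h = seq_reflection (bs @ as)"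
      using mult seq_reflection_bij by simp
    then show ?case using * by (intro image_eqI[of _ _ "bs @ as"]) auto
  qed
next
  fix g assume "g \<in> seq_reflection ` {as. set as \<subseteq> R}"
  then obtain as where "set as \<subseteq> R" "g = seq_reflection as" by auto
  then show "g \<in> G"
  proof (induction as arbitrary: g rule: rev_induct)
    case Nil
    have "\<one>\<^bsub>BijGroup UNIV\<^esub> = (id :: real^'n \<Rightarrow> real^'n)"
      by (simp add: BijGroup_def fun_eq_iff)
    then show ?case using Nil generate.one[of "BijGroup UNIV" "root_reflection ` R"]
      unfolding reflection_group_def seq_reflection_simps by metis
  next
    case (snoc a as)
    have "root_reflection a \<circ> seq_reflection as = root_reflection a \<otimes>\<^bsub>BijGroup UNIV\<^esub> seq_reflection as"
      using snoc bij_refl[of a] seq_reflection_bij[of as]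
      by (simp add: BijGroup_def Bij_def compose_def comp_def restrict_def)
    then show ?case
      using snoc generate.eng[OF generate.incl, of "root_reflection a" "root_reflection ` R" "seq_reflection as" "BijGroup UNIV"]
      by (simp add: reflection_group_def)
  qed
qed

lemma seq_in_G [intro]: "set as \<subseteq> R \<Longrightarrow> seq_reflection as \<in> G"
  by (auto simp: G_eq)

lemma id_in_G [simp, intro]: "id \<in> G"
  using seq_in_G[of "[]"] by simp

lemma refl_in_G [intro]: "a \<in> R \<Longrightarrow> root_reflection a \<in> G"
  using seq_in_G[of "[a]"] by simp

lemma comp_in_G [intro]: "g \<in> G \<Longrightarrow> h \<in> G \<Longrightarrow> g \<circ> h \<in> G"
  unfolding G_eq by clarsimp (metis (mono_tags, lifting) seq_reflection_simps(3) Un_subset_iff imageI mem_Collect_eq set_append)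

lemma G_induct [consumes 1, case_names id refl]:
  assumes "g \<in> G" "P id" "\<And>a g. a \<in> R \<Longrightarrow> g \<in> G \<Longrightarrow> P g \<Longrightarrow> P (root_reflection a \<circ> g)"
  shows "P g"
proof -
  obtain as where "set as \<subseteq> R" "g = seq_reflection as" using assms(1) by (auto simp: G_eq)
  then show ?thesis
    by (induction as arbitrary: g rule: rev_induct) (use assms in auto)
qed

lemma G_inverse:
  assumes "g \<in> G" obtains h where "h \<in> G" "h \<circ> g = id" "g \<circ> h = id"
proof -
  obtain as where "set as \<subseteq> R" "g = seq_reflection as" using assms(1) by (auto simp: G_eq)
  then show ?thesis by (intro that[of "seq_reflection (rev as)"] seq_in_G) (simp_all add: seq_reflection_rev)
qed

lemma G_bij: "g \<in> G \<Longrightarrow> bij g"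
  using G_inverse o_bij by metis

abbreviation ginv :: "(real^'n \<Rightarrow> real^'n) \<Rightarrow> real^'n \<Rightarrow> real^'n"
  where "ginv g \<equiv> inv_into UNIV g"

lemma inv_in_G [intro]: "g \<in> G \<Longrightarrow> ginv g \<in> G"
  by (metis G_inverse inv_unique_comp)

lemma G_linear: "g \<in> G \<Longrightarrow> linear g"
proof (induction rule: G_induct)
  case (refl a g)
  then show ?case by (intro linear_compose linear_refl)
qed (rule linear_id)

lemma G_inner: "g \<in> G \<Longrightarrow> g x \<bullet> g y = x \<bullet> y"
  by (induction rule: G_induct) (auto simp: inner_refl_refl)

lemma G_norm: "g \<in> G \<Longrightarrow> norm (g x) = norm x"
  by (simp add: norm_eq_sqrt_inner G_inner)

lemma G_root [intro]: "g \<in> G \<Longrightarrow> a \<in> R \<Longrightarrow> g a \<in> R"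
  by (induction rule: G_induct) auto

lemma G_inv_simps [simp]:
  assumes "g \<in> G" shows "ginv g (g x) = x" "g (ginv g x) = x"
  using G_bij[OF assms] by (auto simp: bij_is_inj bij_is_surj surj_f_inv_f)

lemma G_inner_inv: "g \<in> G \<Longrightarrow> ginv g x \<bullet> y = x \<bullet> g y"
  by (metis G_inner G_inv_simps(2))

lemma G_conj:
  assumes "g \<in> G" "a \<in> R" shows "g \<circ> root_reflection a = root_reflection (g a) \<circ> g"
  using assms G_root[OF assms] G_linear[OF assms(1)]
  by (auto simp: fun_eq_iff refl_eq linear_diff linear_scale G_inner)

lemma bij_betw_G_roots: "g \<in> G \<Longrightarrow> bij_betw g R R"
  by (rule bij_betwI[of _ _ _ "ginv g"]) auto

lemma bij_betw_G_right: "g \<in> G \<Longrightarrow> bij_betw (\<lambda>h. h \<circ> g) G G"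
  by (rule bij_betwI[of _ _ _ "\<lambda>h. h \<circ> ginv g"]) (auto simp: fun_eq_iff)

text \<open>Every element of G moves points only within span R, while an element fixing all roots
  moves them orthogonally to R; both together leave no motion. Hence G acts faithfully on the finite
  set R, which gives its finiteness.\<close>

lemma G_eqI:
  assumes "g \<in> G" "h \<in> G" "\<And>a. a \<in> R \<Longrightarrow> g a = h a"
  shows "g = h"
proof
  fix x
  have "x - (ginv h \<circ> g) x = 0"
  proof -
    define k where "k = ginv h \<circ> g"
    have k: "k \<in> G" using assms k_def by auto
    have fix_roots: "k a = a" if "a \<in> R" for a using assms that by (simp add: k_def)
    have "k x - x \<in> span R"
      using k
    proof (induction arbitrary: x rule: G_induct)
      case (refl a g)
      have "(root_reflection a \<circ> g) x - x = (g x - x) - (g x \<bullet> a) *\<^sub>R a" using refl by (simp add: refl_eq)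
      also have "\<dots> \<in> span R" by (rule span_diff[OF refl(3) span_scale[OF span_base[OF refl(1)]]])
      finally show ?case .
    qed (auto intro: span_zero)
    moreover have "orthogonal (k x - x) a" if "a \<in> R" for a
      using fix_roots[OF that] G_inner[OF k, of x a] by (simp add: orthogonal_def inner_diff_left)
    ultimately have "orthogonal (k x - x) (k x - x)"
      using orthogonal_to_span by (metis orthogonal_commute)
    then show ?thesis by (simp add: orthogonal_def k_def)
  qed
  then show "g x = h x" using assms by (metis G_inv_simps(2) comp_apply eq_iff_diff_eq_0)
qed

lemma finite_G [simp, intro]: "finite G"
proof (rule finite_imageD)
  show "inj_on (\<lambda>g. restrict g R) G"
    by (rule inj_onI, rule G_eqI, assumption, assumption) (metis restrict_apply')
  have "(\<lambda>g. restrict g R) ` G \<subseteq> R \<rightarrow>\<^sub>E R" by auto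
  then show "finite ((\<lambda>g. restrict g R) ` G)"
    using finite_subset finite_PiE[of R "\<lambda>_. R"] by blast
qed

end

section \<open>Chambers, walls and nearest points of an orbit\<close>

lemma generic_point:
  fixes v :: "real ^ 'n"
  assumes "finite F" "0 \<notin> F" "open S" "v \<in> S"
  obtains w where "w \<in> S" "\<And>f. f \<in> F \<Longrightarrow> w \<bullet> f \<noteq> 0"
proof -
  have "negligible (\<Union>f\<in>F. {x. f \<bullet> x = 0})"
    using assms(1,2) by (intro negligible_Union) (auto intro!: negligible_hyperplane)
  then have "\<not> S \<subseteq> (\<Union>f\<in>F. {x. f \<bullet> x = 0})"
    using assms(3,4) open_not_negligible negligible_subset by (metis empty_iff)
  then show ?thesis using that by (auto simp: inner_commute) (metis inner_commute)
qed

lemma open_positive_side: "finite P \<Longrightarrow> open {v. \<forall>a\<in>P. (v :: real ^ 'n) \<bullet> a > 0}"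
proof -
  assume "finite P"
  then have "open (\<Inter>a\<in>P. {v. v \<bullet> a > 0})"
    by (intro open_INT ballI open_Collect_less continuous_intros) auto
  then show ?thesis by (simp add: INTER_eq)
qed

context root_system
begin

definition regular :: "real ^ 'n \<Rightarrow> bool"
  where "regular v \<longleftrightarrow> (\<forall>a\<in>R. v \<bullet> a \<noteq> 0)"

definition pos :: "real ^ 'n \<Rightarrow> (real ^ 'n) set"
  where "pos v = {a\<in>R. v \<bullet> a > 0}"

text \<open>A geometric form of "simple root": q lies on the facet of the closed chamber that a cuts
  out and on no other root hyperplane. The witness q replaces computations with coefficients in a
  base.\<close>

definition wall :: "real ^ 'n \<Rightarrow> real ^ 'n \<Rightarrow> bool"
  where "wall v a \<longleftrightarrow> a \<in> pos v \<and> (\<exists>q. q \<bullet> a = 0 \<and> (\<forall>c\<in>pos v - {a}. q \<bullet> c > 0))"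

lemma posD: "a \<in> pos v \<Longrightarrow> a \<in> R" "a \<in> pos v \<Longrightarrow> v \<bullet> a > 0"
  by (auto simp: pos_def)

lemma wallD: "wall v a \<Longrightarrow> a \<in> pos v" "wall v a \<Longrightarrow> a \<in> R"
  by (auto simp: wall_def pos_def)

lemma not_pos: "regular v \<Longrightarrow> a \<in> R \<Longrightarrow> a \<notin> pos v \<longleftrightarrow> - a \<in> pos v"
  by (force simp: regular_def pos_def)

text \<open>The witness q is orthogonal to a, so reflecting in a does not change the pairing with q;
  that pairing is positive on all positive roots other than a and thus decides the sign of the
  image.\<close>

lemma wall_permutes:
  assumes v: "regular v" and a: "wall v a" and c: "c \<in> pos v" "c \<noteq> a"
  shows "root_reflection a c \<in> pos v"
proof (rule ccontr)
  assume n: "root_reflection a c \<notin> pos v"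
  obtain q where q: "q \<bullet> a = 0" "\<And>c. c \<in> pos v - {a} \<Longrightarrow> q \<bullet> c > 0" using a by (auto simp: wall_def)
  have aR: "a \<in> R" and cR: "c \<in> R" using a c by (auto simp: wallD posD)
  have m: "- root_reflection a c \<in> pos v" using n not_pos[OF v] aR cR by blast
  have "- root_reflection a c \<noteq> a"
  proof
    assume "- root_reflection a c = a"
    then have "root_reflection a c = - a" by (metis minus_minus)
    then have "c = root_reflection a (- a)" using aR by (metis refl_refl)
    then show False using c aR refl_self[of a] linear_neg[OF linear_refl, of a a] by simp
  qed
  then have "q \<bullet> root_reflection a c < 0" using q(2)[of "- root_reflection a c"] m by simp
  moreover have "q \<bullet> root_reflection a c = q \<bullet> c" using aR q by (simp add: refl_eq inner_diff_right)
  ultimately show False using q(2)[of c] c by simp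
qed

text \<open>On the straight way from a point w of the chamber to p, the first root hyperplane to be
  crossed belongs to a wall, and the crossing point q is its witness.\<close>

lemma wall_exists:
  assumes v: "regular v" and c: "c \<in> pos v" "p \<bullet> c < 0"
  obtains a where "wall v a" "p \<bullet> a < 0"
proof -
  define N where "N = {a\<in>pos v. p \<bullet> a < 0}"
  have fN: "finite N" "c \<in> N" using c by (auto simp: N_def pos_def)
  \<comment> \<open>Orthogonality of w to one of these vectors means that two hyperplanes are
    crossed at the same time; a generic starting point w rules this out.\<close>
  define F where "F = (\<lambda>(a,b). (p \<bullet> b) *\<^sub>R a - (p \<bullet> a) *\<^sub>R b) ` (N \<times> N - Id)"
  have F0: "0 \<notin> F"
  proof
    assume "0 \<in> F"
    then obtain a b where ab: "a \<in> N" "b \<in> N" "a \<noteq> b" "(p \<bullet> b) *\<^sub>R a = (p \<bullet> a) *\<^sub>R b"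
      by (force simp: F_def)
    then have "b = ((p \<bullet> b) / (p \<bullet> a)) *\<^sub>R a"
      by (simp add: N_def divide_inverse_commute flip: scaleR_scaleR) (simp add: ab(4))
    then have "b = - a" using root_parallel ab by (metis (no_types, lifting) N_def mem_Collect_eq posD(1))
    then show False using ab posD(2)[of a v] posD(2)[of b v] by (simp add: N_def)
  qed
  have fF: "finite F" using fN by (simp add: F_def)
  have "finite (pos v)" by (simp add: pos_def)
  obtain w where w: "\<And>a. a \<in> pos v \<Longrightarrow> w \<bullet> a > 0" "\<And>f. f \<in> F \<Longrightarrow> w \<bullet> f \<noteq> 0"
    by (rule generic_point[OF fF F0 open_positive_side[OF \<open>finite (pos v)\<close>], of v]) (auto simp: pos_def)
  define t where "t = (\<lambda>a. (w \<bullet> a) / (w \<bullet> a - p \<bullet> a))"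
  define T where "T = Min (t ` N)"
  have "T \<in> t ` N" unfolding T_def using fN by (intro Min_in) auto
  then obtain a where a: "a \<in> N" "T = t a" by blast
  have Tmin: "T \<le> t b" if "b \<in> N" for b using that fN by (simp add: T_def)
  have den: "w \<bullet> b - p \<bullet> b > 0" "w \<bullet> b > 0" "t b * (w \<bullet> b - p \<bullet> b) = w \<bullet> b" if "b \<in> N" for b
    using w(1)[of b] that by (auto simp: N_def t_def)
  have T01: "0 < T" "T < 1"
    using den[OF a(1)] a by (auto simp: t_def N_def)
  define q where "q = (1 - T) *\<^sub>R w + T *\<^sub>R p"
  have q: "q \<bullet> b = w \<bullet> b - T * (w \<bullet> b - p \<bullet> b)" for b
    by (simp add: q_def inner_add_left algebra_simps)
  have "q \<bullet> a = 0" using den(3)[OF a(1)] a by (simp add: q)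
  moreover have "q \<bullet> b > 0" if b: "b \<in> pos v - {a}" for b
  proof (cases "b \<in> N")
    case True
    have "t b \<noteq> t a"
    proof
      assume "t b = t a"
      then have "(w \<bullet> b) * (w \<bullet> a - p \<bullet> a) = (w \<bullet> a) * (w \<bullet> b - p \<bullet> b)"
        using den[OF True] den[OF a(1)] by (simp add: t_def frac_eq_eq)
      then have "w \<bullet> ((p \<bullet> b) *\<^sub>R a - (p \<bullet> a) *\<^sub>R b) = 0"
        by (simp add: inner_diff_right algebra_simps)
      moreover have "(p \<bullet> b) *\<^sub>R a - (p \<bullet> a) *\<^sub>R b \<in> F"
        using True a b unfolding F_def by (intro image_eqI[of _ _ "(a,b)"]) auto
      ultimately show False using w(2) by blast
    qed
    then have "T < t b" using Tmin[OF True] a by simp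
    then have "T * (w \<bullet> b - p \<bullet> b) < t b * (w \<bullet> b - p \<bullet> b)" using den(1)[OF True] by (rule mult_strict_right_mono)
    then show ?thesis using den[OF True] by (simp add: q)
  next
    case False
    then have "p \<bullet> b \<ge> 0" "w \<bullet> b > 0" using b w by (auto simp: N_def)
    then have "(1 - T) * (w \<bullet> b) + T * (p \<bullet> b) > 0" using T01 by (intro add_pos_nonneg) auto
    then show ?thesis by (simp add: q_def inner_add_left)
  qed
  ultimately have "wall v a" using a by (auto simp: wall_def N_def)
  then show ?thesis using that a by (auto simp: N_def)
qed

lemma sign_change:
  assumes "a \<in> P" "seq_reflection bs a \<notin> P"
  obtains cs b ds where "bs = cs @ b # ds" "seq_reflection cs a \<in> P"
    "root_reflection b (seq_reflection cs a) \<notin> P"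
  using assms
proof (induction bs arbitrary: a thesis)
  case (Cons b bs)
  show ?case
  proof (cases "root_reflection b a \<in> P")
    case True
    then obtain cs d ds where "bs = cs @ d # ds" "seq_reflection cs (root_reflection b a) \<in> P"
      "root_reflection d (seq_reflection cs (root_reflection b a)) \<notin> P"
      using Cons.IH[of "root_reflection b a"] Cons.prems by auto
    then show ?thesis using Cons.prems(1)[of "b # cs" d ds] by simp
  next
    case False
    then show ?thesis using Cons.prems(1)[of "[]" b bs] Cons.prems(2) by simp
  qed
qed simp

text \<open>The deletion argument. The first letter a makes the root a negative and the rest of the
  word must make it positive again, so some later letter b meets the image of a exactly at b.
  Conjugation then lets both letters be removed, and the word shrinks by two.\<close>

lemma wall_word_id:
  assumes v: "regular v"
  shows "\<forall>a\<in>set as. wall v a \<Longrightarrow> \<forall>c\<in>pos v. seq_reflection as c \<in> pos v \<Longrightarrow> seq_reflection as = id"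
proof (induction "length as" arbitrary: as rule: less_induct)
  case less
  show ?case
  proof (cases as)
    case Nil
    then show ?thesis by simp
  next
    case (Cons a bs)
    have a: "wall v a" "a \<in> R" "a \<in> pos v" using less.prems Cons wallD by auto
    have bsR: "set bs \<subseteq> R" using less.prems Cons by (auto simp: wallD)
    have "seq_reflection bs (- a) \<in> pos v"
      using less.prems(2) a Cons refl_self by auto
    then have "- seq_reflection bs a \<in> pos v"
      using linear_neg[OF G_linear[OF seq_in_G[OF bsR]]] by simp
    then have "seq_reflection bs a \<notin> pos v" by (auto simp: pos_def)
    then obtain cs b ds where d: "bs = cs @ b # ds" "seq_reflection cs a \<in> pos v"
      "root_reflection b (seq_reflection cs a) \<notin> pos v"
      using sign_change a by blast
    have b: "wall v b" "b \<in> R" using less.prems Cons d by (auto simp: wallD)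
    have csR: "set cs \<subseteq> R" using bsR d by auto
    have "seq_reflection cs a = b" using wall_permutes[OF v b(1) d(2)] d(3) by blast
    then have "seq_reflection cs \<circ> root_reflection a = root_reflection b \<circ> seq_reflection cs"
      using G_conj[OF seq_in_G[OF csR] a(2)] by simp
    then have "root_reflection b \<circ> (seq_reflection cs \<circ> root_reflection a) = seq_reflection cs"
      using b by (simp add: fun_eq_iff)
    then have eq: "seq_reflection as = seq_reflection (cs @ ds)"
      using Cons d by (simp add: comp_assoc)
    have "seq_reflection (cs @ ds) = id"
    proof (rule less.hyps)
      show "\<forall>c\<in>pos v. seq_reflection (cs @ ds) c \<in> pos v" using less.prems(2) by (simp only: eq)
    qed (use less.prems Cons d in auto)
    then show ?thesis using eq by simp
  qed
qed

text \<open>Choose p on the hyperplane of c and on no other one, and carry it into the closed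
  chamber by wall reflections. There p certifies that the image of c, up to sign, is a wall;
  conjugating back gives the word.\<close>

lemma refl_wall_word:
  assumes v: "regular v" and c: "c \<in> R"
  obtains as where "\<forall>a\<in>set as. wall v a" "root_reflection c = seq_reflection as"
proof -
  define F where "F = (\<lambda>b. b - (b \<bullet> c / 2) *\<^sub>R c) ` (R - {c, - c})"
  have "0 \<notin> F"
  proof
    assume "0 \<in> F"
    then obtain b where "b \<in> R" "b \<noteq> c" "b \<noteq> - c" "b - (b \<bullet> c / 2) *\<^sub>R c = 0" by (force simp: F_def)
    then have "b = (b \<bullet> c / 2) *\<^sub>R c" by (metis eq_iff_diff_eq_0)
    then show False using root_parallel[OF c \<open>b \<in> R\<close>] \<open>b \<noteq> c\<close> \<open>b \<noteq> - c\<close> by blast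
  qed
  then obtain u where u: "\<And>f. f \<in> F \<Longrightarrow> u \<bullet> f \<noteq> 0"
    using generic_point[of F UNIV] by (auto simp: F_def)
  define p where "p = u - (u \<bullet> c / 2) *\<^sub>R c"
  have pc: "p \<bullet> c = 0" using c by (simp add: p_def inner_diff_left root_inner_self)
  have pb: "p \<bullet> b \<noteq> 0" if "b \<in> R - {c, - c}" for b
    using u[of "b - (b \<bullet> c / 2) *\<^sub>R c"] that
    by (auto simp: F_def p_def inner_diff_left inner_diff_right inner_commute mult.commute)
  define W where "W = seq_reflection ` {as. \<forall>a\<in>set as. wall v a}"
  have "W \<subseteq> G" unfolding W_def by (auto simp: wallD intro!: seq_in_G)
  then have fW: "finite W" using finite_G finite_subset by blast
  have idW: "id \<in> W" unfolding W_def by (rule image_eqI[of _ _ "[]"]) auto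
  \<comment> \<open>A maximiser of the pairing with v lies in the closed chamber: a wall on whose
    negative side it lay would allow a further increase.\<close>
  define M where "M = Max ((\<lambda>w. w p \<bullet> v) ` W)"
  have "M \<in> (\<lambda>w. w p \<bullet> v) ` W" unfolding M_def using fW idW by (intro Max_in) auto
  then obtain w where w: "w \<in> W" "M = w p \<bullet> v" by auto
  then obtain as where as: "\<forall>a\<in>set as. wall v a" "w = seq_reflection as" by (auto simp: W_def)
  have wG: "w \<in> G" using w \<open>W \<subseteq> G\<close> by auto
  have wp: "w p \<bullet> a \<ge> 0" if a: "wall v a" for a
  proof -
    have "root_reflection a \<circ> w \<in> W"
      unfolding W_def using as a by (intro image_eqI[of _ _ "as @ [a]"]) auto
    then have "root_reflection a (w p) \<bullet> v \<le> w p \<bullet> v"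
      using fW w unfolding M_def by (metis (mono_tags, lifting) Max_ge comp_apply finite_imageI imageI)
    then have "(w p \<bullet> a) * (a \<bullet> v) \<ge> 0"
      using wallD[OF a] by (simp add: refl_eq inner_diff_left)
    moreover have "a \<bullet> v > 0" using posD(2)[OF wallD(1)[OF a]] by (simp add: inner_commute)
    ultimately show ?thesis by (simp add: zero_le_mult_iff)
  qed
  have wpos: "w p \<bullet> b \<ge> 0" if "b \<in> pos v" for b
    using wall_exists[OF v that, of "w p"] wp by (metis not_le)
  define d where "d = (if w c \<in> pos v then w c else - w c)"
  have wc: "w c \<in> R" using wG c by auto
  have d: "d \<in> pos v" using not_pos[OF v wc] by (simp add: d_def)
  have "wall v d"
    unfolding wall_def
  proof (intro conjI exI[of _ "w p"] ballI d)
    show "w p \<bullet> d = 0" using pc G_inner[OF wG] by (simp add: d_def)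
    fix b assume b: "b \<in> pos v - {d}"
    have bR: "b \<in> R" using b by (simp add: pos_def)
    define b' where "b' = ginv w b"
    have b': "w b' = b" "b' \<in> R" using wG bR by (auto simp: b'_def)
    have "b \<noteq> - d" using b posD(2)[of b v] posD(2)[of d v] d by auto
    then have "b \<noteq> w c" "b \<noteq> - w c" using b by (auto simp: d_def split: if_splits)
    then have "b' \<noteq> c" "b' \<noteq> - c" using b' linear_neg[OF G_linear[OF wG]] by auto
    then have "p \<bullet> b' \<noteq> 0" using pb b' by auto
    then have "w p \<bullet> b \<noteq> 0" using G_inner[OF wG, of p b'] b' by simp
    then show "w p \<bullet> b > 0" using wpos[of b] b by simp
  qed
  have "root_reflection d = root_reflection (w c)" by (simp add: d_def refl_uminus)
  then have "w \<circ> root_reflection c = root_reflection d \<circ> w" using G_conj[OF wG c] by simp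
  then have "seq_reflection (rev as) \<circ> (w \<circ> root_reflection c) = seq_reflection (rev as) \<circ> (root_reflection d \<circ> w)"
    by simp
  moreover have asR: "set as \<subseteq> R" using as by (auto simp: wallD)
  ultimately have "root_reflection c = seq_reflection (as @ d # rev as)"
    using seq_reflection_rev(1)[OF asR] as by (auto simp: fun_eq_iff)
  then show ?thesis using that[of "as @ d # rev as"] as \<open>wall v d\<close> by auto
qed

lemma G_wall_word:
  assumes v: "regular v" and g: "g \<in> G"
  shows "\<exists>as. (\<forall>a\<in>set as. wall v a) \<and> g = seq_reflection as"
  using g
proof (induction rule: G_induct)
  case id
  show ?case by (rule exI[of _ "[]"]) simp
next
  case (refl a g)
  then obtain as where as: "\<forall>a\<in>set as. wall v a" "g = seq_reflection as" by auto
  obtain bs where "\<forall>a\<in>set bs. wall v a" "root_reflection a = seq_reflection bs"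
    using refl_wall_word[OF v refl(1)] by auto
  then show ?case using as by (intro exI[of _ "as @ bs"]) auto
qed

text \<open>Induction on the number of positive roots that g makes negative. If g a is negative for
  a wall a, then g' = g \<sigma>_a inverts fewer roots and g z = g' z - (z \<bullet> a) g' a, where
  g' a is positive and the subtracted term therefore pairs nonnegatively with x.\<close>

lemma dominant_inner:
  assumes v: "regular v" and x: "\<And>a. a \<in> pos v \<Longrightarrow> x \<bullet> a \<ge> 0" and z: "\<And>a. a \<in> pos v \<Longrightarrow> z \<bullet> a \<ge> 0"
  shows "g \<in> G \<Longrightarrow> x \<bullet> g z \<le> x \<bullet> z"
proof (induction "card {a\<in>pos v. g a \<notin> pos v}" arbitrary: g rule: less_induct)
  case less
  define N where "N = (\<lambda>g. {a\<in>pos v. g a \<notin> pos v})"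
  have fN: "finite (N h)" for h by (simp add: N_def pos_def)
  show ?case
  proof (cases "N g = {}")
    case True
    then have "\<forall>c\<in>pos v. g c \<in> pos v" by (auto simp: N_def)
    then have "g = id" using G_wall_word[OF v less.prems] wall_word_id[OF v] by metis
    then show ?thesis by simp
  next
    case False
    then obtain c where c: "c \<in> pos v" "g c \<notin> pos v" by (auto simp: N_def)
    have neg: "ginv g v \<bullet> a < 0 \<longleftrightarrow> g a \<notin> pos v" if "a \<in> R" for a
    proof -
      have "ginv g v \<bullet> a = v \<bullet> g a" using less.prems by (rule G_inner_inv)
      moreover have "v \<bullet> g a \<noteq> 0" using v that less.prems by (auto simp: regular_def)
      ultimately show ?thesis using that less.prems by (auto simp: pos_def)
    qed
    obtain a where a: "wall v a" "g a \<notin> pos v"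
      using wall_exists[OF v c(1), of "ginv g v"] neg c posD wallD by metis
    have aR: "a \<in> R" "a \<in> pos v" using a wallD by auto
    define g' where "g' = g \<circ> root_reflection a"
    have g': "g' \<in> G" using less.prems aR by (auto simp: g'_def)
    have g'a: "g' a = - g a" using aR linear_neg[OF G_linear[OF less.prems]] by (simp add: g'_def refl_self)
    have g'apos: "g' a \<in> pos v" using a(2) not_pos[OF v] aR less.prems by (auto simp: g'a)
    have "N g' \<subseteq> root_reflection a ` (N g - {a})"
    proof
      fix c assume c: "c \<in> N g'"
      have ca: "c \<noteq> a" using c g'apos by (auto simp: N_def)
      have 1: "root_reflection a c \<in> pos v" using wall_permutes[OF v a(1)] c ca by (auto simp: N_def)
      have "root_reflection a c \<noteq> a"
      proof
        assume "root_reflection a c = a"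
        then have "c = - a" using aR refl_refl[of a c] by (simp add: refl_self)
        then show False using c aR by (auto simp: N_def pos_def)
      qed
      then have "root_reflection a c \<in> N g - {a}" using 1 c by (auto simp: N_def g'_def)
      then show "c \<in> root_reflection a ` (N g - {a})" using aR by (intro image_eqI[of _ _ "root_reflection a c"]) auto
    qed
    then have "card (N g') \<le> card (root_reflection a ` (N g - {a}))" using fN by (intro card_mono) auto
    also have "\<dots> \<le> card (N g - {a})" using fN by (intro card_image_le) auto
    also have "\<dots> < card (N g)" using fN a aR by (intro psubset_card_mono) (auto simp: N_def)
    finally have IH: "x \<bullet> g' z \<le> x \<bullet> z" using less.hyps[of g'] g' by (simp add: N_def)
    have "g z = g' (root_reflection a z)" using aR by (simp add: g'_def)
    also have "\<dots> = g' z - (z \<bullet> a) *\<^sub>R g' a"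
      using aR G_linear[OF g'] by (simp add: refl_eq linear_diff linear_scale)
    finally have "x \<bullet> g z = x \<bullet> g' z - (z \<bullet> a) * (x \<bullet> g' a)" by (simp add: inner_diff_right)
    moreover have "(z \<bullet> a) * (x \<bullet> g' a) \<ge> 0" using x[OF g'apos] z[OF aR(2)] by simp
    ultimately show ?thesis using IH by linarith
  qed
qed

text \<open>The hypothesis puts \<open>x\<close> and \<open>z\<close> into a common closed chamber.\<close>

lemma local_max_inner:
  assumes xz: "\<And>a. a \<in> R \<Longrightarrow> (x \<bullet> a) * (z \<bullet> a) \<ge> 0" and g: "g \<in> G"
  shows "x \<bullet> g z \<le> x \<bullet> z"
proof -
  \<comment> \<open>A root orthogonal to x + z is orthogonal to both x and z by the sign hypothesis,
    so a generic v near x + z may take either sign on it.\<close>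
  define P where "P = {a\<in>R. (x + z) \<bullet> a > 0}"
  have "finite P" by (simp add: P_def)
  obtain v where v: "\<And>a. a \<in> P \<Longrightarrow> v \<bullet> a > 0" "\<And>f. f \<in> R \<Longrightarrow> v \<bullet> f \<noteq> 0"
    by (rule generic_point[OF finR _ open_positive_side[OF \<open>finite P\<close>], of "x + z"])
      (use root_nonzero in \<open>auto simp: P_def\<close>)
  have "x \<bullet> a \<ge> 0 \<and> z \<bullet> a \<ge> 0" if a: "a \<in> pos v" for a
  proof -
    have aR: "a \<in> R" "- a \<in> R" "v \<bullet> a > 0" using a by (auto simp: pos_def)
    then have "- a \<notin> P" using v(1)[of "- a"] by auto
    then have "(x + z) \<bullet> a \<ge> 0" using aR by (auto simp: P_def)
    then show ?thesis using xz[OF aR(1)]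
      by (simp add: inner_add_left zero_le_mult_iff) (smt (verit))
  qed
  then show ?thesis using dominant_inner[of v x z] v(2) g by (auto simp: regular_def)
qed

end

section \<open>Multiplicities\<close>

locale dunkl = root_system R for R :: "(real ^ 'n) set" +
  fixes k :: "real ^ 'n \<Rightarrow> real"
  assumes mf: "multiplicity_function R k"
begin

text \<open>Sums run over all of R, where each reflection occurs for \<alpha> and for -\<alpha>;
  this accounts for the half.\<close>

definition kap :: "real ^ 'n \<Rightarrow> real" where "kap a = k a / 2"
definition K :: real where "K = (\<Sum>a\<in>R. kap a)"

lemma kap_pos: "a \<in> R \<Longrightarrow> kap a > 0"
  using mf by (simp add: multiplicity_function_def kap_def)

lemma kap_nonneg: "a \<in> R \<Longrightarrow> kap a \<ge> 0"
  using kap_pos by force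

lemma kap_G: "g \<in> G \<Longrightarrow> a \<in> R \<Longrightarrow> kap (g a) = kap a"
  using mf by (simp add: multiplicity_function_def kap_def)

lemma K_nonneg: "K \<ge> 0"
  unfolding K_def by (intro sum_nonneg kap_nonneg)

lemma sum_kap_reindex:
  "g \<in> G \<Longrightarrow> (\<Sum>a\<in>R. kap a * F (g a)) = (\<Sum>a\<in>R. kap a * F a)"
  using sum.reindex_bij_betw[OF bij_betw_G_roots, of g "\<lambda>a. kap a * F a"]
  by (simp add: kap_G)

lemma sum_kap_const: "(\<Sum>a\<in>R. kap a * c) = K * c"
  by (simp add: K_def sum_distrib_right)

lemma sum_kap_mono: "(\<And>a. a \<in> R \<Longrightarrow> F a \<le> H a) \<Longrightarrow> (\<Sum>a\<in>R. kap a * F a) \<le> (\<Sum>a\<in>R. kap a * H a)"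
  by (intro sum_mono mult_left_mono kap_nonneg)

end

section \<open>The orbit system\<close>

locale orbit_pair = dunkl R k for R :: "(real ^ 'n) set" and k +
  fixes x y :: "real ^ 'n"
begin

definition b :: "(real ^ 'n \<Rightarrow> real ^ 'n) \<Rightarrow> real"
  where "b h = Max ((\<lambda>g. x \<bullet> g y) ` G) - x \<bullet> h y"

definition d :: real where "d = orbit_dist R x y"

lemma b_nonneg: "h \<in> G \<Longrightarrow> b h \<ge> 0"
  by (simp add: b_def)

lemma d_nonneg: "d \<ge> 0"
proof -
  have "Min ((\<lambda>g. norm (x - g y)) ` G) \<in> (\<lambda>g. norm (x - g y)) ` G"
    by (intro Min_in) auto
  then obtain g where "Min ((\<lambda>g. norm (x - g y)) ` G) = norm (x - g y)" by blast
  then show ?thesis by (simp add: d_def orbit_dist_def)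
qed

lemma norm_diff_G: "h \<in> G \<Longrightarrow> (norm (x - h y))\<^sup>2 = (norm x)\<^sup>2 + (norm y)\<^sup>2 - 2 * (x \<bullet> h y)"
  by (simp add: power2_norm_eq_inner inner_diff inner_commute G_inner)

lemma d_square: "d\<^sup>2 = (norm x)\<^sup>2 + (norm y)\<^sup>2 - 2 * Max ((\<lambda>g. x \<bullet> g y) ` G)"
proof -
  have "Max ((\<lambda>g. x \<bullet> g y) ` G) \<in> (\<lambda>g. x \<bullet> g y) ` G" by (intro Max_in) auto
  then obtain g where g: "g \<in> G" "Max ((\<lambda>g. x \<bullet> g y) ` G) = x \<bullet> g y" by auto
  have "norm (x - g y) \<le> norm (x - h y)" if "h \<in> G" for h
  proof -
    have "x \<bullet> h y \<le> x \<bullet> g y" using g that Max_ge[of "(\<lambda>g. x \<bullet> g y) ` G" "x \<bullet> h y"] by simp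
    then have "(norm (x - g y))\<^sup>2 \<le> (norm (x - h y))\<^sup>2" using norm_diff_G g that by simp
    then show ?thesis by (simp add: power2_le_iff_abs_le)
  qed
  then have "d = norm (x - g y)" unfolding d_def orbit_dist_def
    using g by (intro Min_eqI) auto
  then show ?thesis using g norm_diff_G by simp
qed

lemma dist_square: "h \<in> G \<Longrightarrow> (norm (x - h y))\<^sup>2 = d\<^sup>2 + 2 * b h"
  by (simp add: norm_diff_G d_square b_def)

lemma b_eq_0_iff: "h \<in> G \<Longrightarrow> b h = 0 \<longleftrightarrow> norm (x - h y) = d"
  using dist_square[of h] d_nonneg power2_eq_iff_nonneg[of "norm (x - h y)" d] by auto

lemma b_refl: "a \<in> R \<Longrightarrow> h \<in> G \<Longrightarrow> b (root_reflection a \<circ> h) = b h + (x \<bullet> a) * (h y \<bullet> a)"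
  by (simp add: b_def refl_eq inner_diff_right)

lemma abs_inner_root: "a \<in> R \<Longrightarrow> \<bar>v \<bullet> a\<bar> \<le> sqrt 2 * norm v"
  using Cauchy_Schwarz_ineq2[of v a] by (simp add: norm_root mult.commute)

lemma inner_orbit_root:
  assumes "a \<in> R" "h \<in> G"
  shows "\<bar>h y \<bullet> a - x \<bullet> a\<bar> \<le> sqrt 2 * sqrt (d\<^sup>2 + 2 * b h)"
proof -
  have "norm (x - h y) = sqrt (d\<^sup>2 + 2 * b h)"
    using dist_square[OF assms(2)] by (metis norm_ge_zero real_sqrt_unique)
  then show ?thesis using abs_inner_root[OF assms(1), of "h y - x"]
    by (simp add: inner_diff_left norm_minus_commute)
qed

text \<open>Passing to the reflected point changes b by (x \<bullet> a)(h y \<bullet> a). If no such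
  change is negative, x and h y lie in a common closed chamber, where the inner product is maximal
  over the whole orbit.\<close>

lemma b_zeroI:
  assumes h: "h \<in> G" and loc: "\<And>a. a \<in> R \<Longrightarrow> b (root_reflection a \<circ> h) \<ge> b h"
  shows "b h = 0"
proof -
  have "x \<bullet> g y \<le> x \<bullet> h y" if g: "g \<in> G" for g
  proof -
    have "x \<bullet> (g \<circ> ginv h) (h y) \<le> x \<bullet> h y"
    proof (rule local_max_inner)
      fix a assume "a \<in> R"
      then show "(x \<bullet> a) * (h y \<bullet> a) \<ge> 0" using loc[of a] b_refl[of a h] h by simp
    next
      show "g \<circ> ginv h \<in> G" using g h by blast
    qed
    then show ?thesis using h by simp
  qed
  then have "Max ((\<lambda>g. x \<bullet> g y) ` G) = x \<bullet> h y" using h by (intro Max_eqI) auto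
  then show ?thesis by (simp add: b_def)
qed

text \<open>The function \<open>V = exp log_profile\<close> is the product of \<open>(2 / (1 + \<surd>(1 + s \<xi>\<^sub>\<alpha>\<^sup>2 / width\<^sup>2)))\<close> to the powers
  \<open>2 \<kappa>\<^sub>\<alpha>\<close>, and \<open>s V' / V = - \<Sum>\<^sub>\<alpha> \<kappa>\<^sub>\<alpha> profile_drop \<alpha> s\<close>. Up to a factor growing polynomially in \<open>d\<close> it is the
  reciprocal of the normalised volume of a ball; \<open>width\<close> is chosen large enough for
  \<open>e\<^bsup>Ks\<^esup> V (1 + s b h / (2 (K + 1)))\<^bsup>-1/2\<^esup>\<close> to be a supersolution.\<close>

definition xi :: "real ^ 'n \<Rightarrow> real" where "xi a = \<bar>x \<bullet> a\<bar>"
definition width :: real where "width = sqrt (24 * (K + 1) + 32 * d\<^sup>2)"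
definition profile_drop :: "real ^ 'n \<Rightarrow> real \<Rightarrow> real"
  where "profile_drop a s = 1 - 1 / sqrt (1 + s * (xi a)\<^sup>2 / width\<^sup>2)"
definition log_profile :: "real \<Rightarrow> real"
  where "log_profile s = - (\<Sum>a\<in>R. kap a * (2 * ln ((1 + sqrt (1 + s * (xi a)\<^sup>2 / width\<^sup>2)) / 2)))"

lemma width_square: "width\<^sup>2 = 24 * (K + 1) + 32 * d\<^sup>2"
  using K_nonneg by (simp add: width_def)

lemma width_ge_1: "width \<ge> 1"
  using K_nonneg by (simp add: width_def)

lemma xi_nonneg: "xi a \<ge> 0" by (simp add: xi_def)

lemma profile_drop_bounds: "s \<ge> 0 \<Longrightarrow> 0 \<le> profile_drop a s" "s \<ge> 0 \<Longrightarrow> profile_drop a s \<le> 1"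
  by (simp_all add: profile_drop_def divide_le_eq_1 add_pos_nonneg)

lemma log_profile_0: "log_profile 0 = 0"
  by (simp add: log_profile_def)

lemma log_profile_eq: "log_profile s = - (2 * (\<Sum>a\<in>R. kap a * ln ((1 + sqrt (1 + s * (xi a)\<^sup>2 / width\<^sup>2)) / 2)))"
  by (simp add: log_profile_def sum_distrib_left mult.left_commute)

lemma log_profile_deriv:
  assumes "s > 0"
  shows "(log_profile has_real_derivative - (\<Sum>a\<in>R. kap a * profile_drop a s) / s) (at s)"
proof -
  have "((\<lambda>s. kap a * (2 * ln ((1 + sqrt (1 + s * (xi a)\<^sup>2 / width\<^sup>2)) / 2))) has_real_derivative kap a * profile_drop a s / s) (at s)"
    (is "(?f has_real_derivative _) _") for a
  proof -
    define c where "c = (xi a)\<^sup>2 / width\<^sup>2"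
    have c: "c \<ge> 0" by (simp add: c_def)
    define w where "w = sqrt (1 + s * c)"
    have w: "w > 0" "w * w = 1 + s * c" using c assms by (simp_all add: w_def add_pos_nonneg)
    have pos: "1 + s * c > 0" "1 + sqrt (1 + s * c) > 0" using c assms by (simp_all add: add_pos_nonneg)
    have 1: "((\<lambda>s. sqrt (1 + s * c)) has_real_derivative inverse w / 2 * c) (at s)"
      unfolding w_def by (rule DERIV_chain'[OF _ DERIV_real_sqrt, of "\<lambda>s. 1 + s * c"])
        (use pos in \<open>auto intro!: derivative_eq_intros\<close>)
    have "((\<lambda>s. ln ((1 + sqrt (1 + s * c)) / 2)) has_real_derivative
        1 / ((1 + w) / 2) * (inverse w / 2 * c / 2)) (at s)"
    proof (rule DERIV_chain2[where f = ln])
      show "((\<lambda>s. (1 + sqrt (1 + s * c)) / 2) has_real_derivative inverse w / 2 * c / 2) (at s)"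
        using DERIV_cdivide[OF DERIV_add[OF DERIV_const 1], of 1 2] by simp
      show "(ln has_real_derivative 1 / ((1 + w) / 2)) (at ((1 + sqrt (1 + s * c)) / 2))"
        using DERIV_ln_divide[of "(1 + sqrt (1 + s * c)) / 2"] pos by (simp add: w_def)
    qed
    then have "((\<lambda>s. kap a * (2 * ln ((1 + sqrt (1 + s * c)) / 2))) has_real_derivative
        kap a * (2 * (1 / ((1 + w) / 2) * (inverse w / 2 * c / 2)))) (at s)"
      by (intro DERIV_cmult)
    also have "2 * (1 / ((1 + w) / 2) * (inverse w / 2 * c / 2)) = c / (w * (1 + w))"
      using w(1) by (simp add: divide_simps)
    also have "\<dots> = (1 - 1 / w) / s"
    proof -
      have "c * s = (w - 1) * (1 + w)" using w by (simp add: algebra_simps)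
      then have "c = (w - 1) * (1 + w) / s" using assms by (simp add: eq_divide_eq)
      then have "c / (w * (1 + w)) = (w - 1) * ((1 + w) / (1 + w)) / (s * w)" by (simp add: mult_ac)
      also have "\<dots> = (w - 1) / (s * w)" using w(1) by simp
      also have "\<dots> = (1 - 1 / w) / s" using w(1) assms by (simp add: divide_simps)
      finally show ?thesis .
    qed
    finally show ?thesis by (simp add: profile_drop_def w_def c_def)
  qed
  then have "((\<lambda>s. \<Sum>a\<in>R. kap a * (2 * ln ((1 + sqrt (1 + s * (xi a)\<^sup>2 / width\<^sup>2)) / 2))) has_real_derivative
      (\<Sum>a\<in>R. kap a * profile_drop a s / s)) (at s)"
    by (intro DERIV_sum)
  then have "(log_profile has_real_derivative - (\<Sum>a\<in>R. kap a * profile_drop a s / s)) (at s)"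
    unfolding log_profile_def by (rule DERIV_minus)
  then show ?thesis by (simp add: sum_divide_distrib)
qed

lemma log_profile_cont: "continuous_on {0..1} log_profile"
proof -
  have "1 + sqrt (1 + s * (xi a)\<^sup>2 / width\<^sup>2) \<noteq> 0" if "s \<in> {0..1}" for s a
  proof -
    have "sqrt (1 + s * (xi a)\<^sup>2 / width\<^sup>2) \<ge> 0" using that by simp
    then show ?thesis by linarith
  qed
  then show ?thesis unfolding log_profile_def by (intro continuous_intros) (use width_ge_1 in auto)
qed

text \<open>Factor by factor 1 + sqrt (1 + z^2) dominates 1 + z with z = sqrt s * \<xi> / width, and
  returning from z to \<xi> costs at most 2 width / sqrt s. The exponents of these costs add up to 2
  K.\<close>

lemma log_profile_upper:
  assumes "0 < s" "s \<le> 1"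
  shows "log_profile s \<le> 2 * K * ln (2 * width / sqrt s) - (\<Sum>a\<in>R. k a * ln (1 + xi a))"
proof -
  have "ln (1 + xi a) - ln (2 * width / sqrt s) \<le> ln ((1 + sqrt (1 + s * (xi a)\<^sup>2 / width\<^sup>2)) / 2)" for a
  proof -
    have a: "width > 0" "width \<ge> 1" using width_ge_1 by auto
    define z where "z = sqrt s * xi a / width"
    have z: "z \<ge> 0" "s * (xi a)\<^sup>2 / width\<^sup>2 = z\<^sup>2"
      using assms a by (simp_all add: z_def xi_nonneg power_mult_distrib power_divide)
    have "sqrt s \<le> 1" using assms by simp
    then have "sqrt s \<le> width" using a(2) by linarith
    then have "sqrt s / width \<le> 1" using a by (simp add: divide_le_eq)
    then have "sqrt s / width * (1 + xi a) \<le> 1 + z" by (simp add: z_def algebra_simps add_divide_distrib)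
    also have "z \<le> sqrt (1 + z\<^sup>2)" by (rule real_le_rsqrt) simp
    finally have "sqrt s / (2 * width) * (1 + xi a) \<le> (1 + sqrt (1 + z\<^sup>2)) / 2" by simp
    moreover have "sqrt s / (2 * width) * (1 + xi a) > 0" using a assms xi_nonneg[of a] by simp
    ultimately have "ln (sqrt s / (2 * width) * (1 + xi a)) \<le> ln ((1 + sqrt (1 + z\<^sup>2)) / 2)" by simp
    moreover have "ln (sqrt s / (2 * width) * (1 + xi a)) = ln (1 + xi a) - ln (2 * width / sqrt s)"
      using a assms xi_nonneg[of a] by (simp add: ln_mult ln_div add_pos_nonneg)
    ultimately show ?thesis using z by simp
  qed
  then have "(\<Sum>a\<in>R. kap a * (ln (1 + xi a) - ln (2 * width / sqrt s))) \<le>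
      (\<Sum>a\<in>R. kap a * ln ((1 + sqrt (1 + s * (xi a)\<^sup>2 / width\<^sup>2)) / 2))"
    by (intro sum_kap_mono)
  also have "\<dots> = - log_profile s / 2" by (simp add: log_profile_eq)
  also have "(\<Sum>a\<in>R. kap a * (ln (1 + xi a) - ln (2 * width / sqrt s))) =
     (\<Sum>a\<in>R. k a * ln (1 + xi a)) / 2 - K * ln (2 * width / sqrt s)"
    unfolding sum_kap_const[symmetric]
    by (simp add: right_diff_distrib sum_subtractf kap_def sum_divide_distrib)
  finally show ?thesis by linarith
qed

lemma log_profile_lower:
  assumes "0 \<le> s" "s \<le> 1"
  shows "log_profile s \<ge> - (\<Sum>a\<in>R. k a * ln (1 + xi a))"
proof -
  have "ln ((1 + sqrt (1 + s * (xi a)\<^sup>2 / width\<^sup>2)) / 2) \<le> ln (1 + xi a)" for a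
  proof -
    have "s * (xi a)\<^sup>2 / width\<^sup>2 \<le> 1 * (xi a)\<^sup>2 / 1"
      using assms width_ge_1 by (intro frac_le mult_right_mono) (auto simp: one_le_power)
    then have "sqrt (1 + s * (xi a)\<^sup>2 / width\<^sup>2) \<le> sqrt ((1 + xi a)\<^sup>2)"
      using xi_nonneg[of a] by (intro real_sqrt_le_mono) (simp add: power2_sum)
    then have le: "sqrt (1 + s * (xi a)\<^sup>2 / width\<^sup>2) \<le> 1 + xi a" using xi_nonneg[of a] by simp
    have "1 + sqrt (1 + s * (xi a)\<^sup>2 / width\<^sup>2) > 0" using assms by (intro add_pos_nonneg) auto
    then show ?thesis using le xi_nonneg[of a] by (intro ln_mono) auto
  qed
  then have "(\<Sum>a\<in>R. kap a * ln ((1 + sqrt (1 + s * (xi a)\<^sup>2 / width\<^sup>2)) / 2)) \<le> (\<Sum>a\<in>R. kap a * ln (1 + xi a))"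
    by (intro sum_kap_mono)
  moreover have "(\<Sum>a\<in>R. kap a * ln ((1 + sqrt (1 + s * (xi a)\<^sup>2 / width\<^sup>2)) / 2)) = - log_profile s / 2"
    by (simp add: log_profile_eq)
  moreover have "(\<Sum>a\<in>R. kap a * ln (1 + xi a)) = (\<Sum>a\<in>R. k a * ln (1 + xi a)) / 2"
    by (simp add: kap_def sum_divide_distrib)
  ultimately show ?thesis by linarith
qed

text \<open>The supersolution inequality, root by root. On the left is the ratio of the factors (1 +
  s b / A)^(-1/2) at the reflected point and at h, with A = 2 (K + 1). It has to stay below 1 minus
  the drop of the profile; the error s b h / A will be paid by the decay, the error s by exp (K s).
  A large \<xi> raises b by the order of \<xi>^2 unless b h or d is already comparable, and this
  makes the ratio small enough.\<close>

lemma profile_inequality: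
  assumes b: "b h \<ge> 0" and h: "h \<in> G" and a: "a \<in> R" and s: "0 \<le> s" "s \<le> 1" and q: "s * b h \<le> 2 * K"
  shows "sqrt ((2 * (K + 1) + s * b h) / (2 * (K + 1) + s * b (root_reflection a \<circ> h)))
    \<le> 1 - profile_drop a s + s * b h / (2 * (K + 1)) + s"
proof -
  define A where "A = 2 * (K + 1)"
  define bb where "bb = b h"
  define b' where "b' = b (root_reflection a \<circ> h)"
  define z where "z = xi a"
  define w where "w = 1 / sqrt (1 + s * z\<^sup>2 / width\<^sup>2)"
  have A: "A \<ge> 2" using K_nonneg by (simp add: A_def)
  have bb: "bb \<ge> 0" "b' \<ge> 0" using b_nonneg h a by (auto simp: bb_def b'_def intro!: b_nonneg)
  have z: "z \<ge> 0" by (simp add: z_def xi_nonneg)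
  have width: "width > 0" using width_ge_1 by simp
  have profile_drop: "profile_drop a s = 1 - w" by (simp add: profile_drop_def w_def z_def)
  define e where "e = s * bb / (2 * A)"
  have e: "e \<ge> 0" "s * bb / A = 2 * e" using A bb s by (auto simp: e_def)
  have r1: "sqrt ((A + s * bb) / (A + s * b')) \<le> 1 + e"
  proof -
    have "(A + s * bb) / (A + s * b') \<le> (A + s * bb) / A"
      using A bb s by (intro divide_left_mono mult_pos_pos add_pos_nonneg) auto
    also have "\<dots> \<le> (1 + s * bb / (2 * A))\<^sup>2"
      using A zero_le_power2[of "s * bb / (2 * A)"] by (simp add: power2_sum add_divide_distrib)
    finally have "sqrt ((A + s * bb) / (A + s * b')) \<le> sqrt ((1 + s * bb / (2 * A))\<^sup>2)"
      by (rule real_sqrt_le_mono)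
    also have "\<dots> = 1 + e" using A bb s by (simp add: e_def)
    finally show ?thesis .
  qed
  define t where "t = s * z\<^sup>2 / width\<^sup>2"
  have w1: "w \<ge> 1 - t / 2"
  proof -
    have t: "t \<ge> 0" using s by (simp add: t_def)
    have "1 + t \<le> (1 + t / 2)\<^sup>2" by (simp add: power2_eq_square field_simps)
    then have "sqrt (1 + t) \<le> sqrt ((1 + t / 2)\<^sup>2)" by (rule real_sqrt_le_mono)
    then have "sqrt (1 + t) \<le> 1 + t / 2" using t by simp
    then have "1 / (1 + t / 2) \<le> 1 / sqrt (1 + t)" using t by (intro divide_left_mono) auto
    moreover have "1 - t / 2 \<le> 1 / (1 + t / 2)" using t by (simp add: field_simps)
    ultimately show ?thesis by (simp add: w_def t_def)
  qed
  have "sqrt ((A + s * bb) / (A + s * b')) \<le> w + 2 * e + s"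
  proof (cases "z\<^sup>2 \<le> width\<^sup>2")
    case True
    then have "z\<^sup>2 / width\<^sup>2 \<le> 1" using width by simp
    then have "s * (z\<^sup>2 / width\<^sup>2) \<le> s * 1" using s by (intro mult_left_mono) auto
    then have "t \<le> s" by (simp add: t_def)
    then have "w \<ge> 1 - s / 2" using w1 by linarith
    then show ?thesis using r1 s e by linarith
  next
    case False
    \<comment> \<open>The summand 32 d^2 of \<open>width\<close> squared serves this estimate:
      beyond \<open>width\<close>, d displaces the root coordinate of x by at most a quarter, so h y
      has nearly the same coordinate unless b h is large.\<close>
    have "32 * d\<^sup>2 \<le> width\<^sup>2" using K_nonneg by (simp add: width_square)
    then have "32 * d\<^sup>2 \<le> z\<^sup>2" using False by simp
    then have "(4 * sqrt 2 * d)\<^sup>2 \<le> z\<^sup>2" by (simp add: power_mult_distrib)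
    then have dz: "sqrt 2 * d \<le> z / 4" using z power2_le_imp_le by fastforce
    define rb where "rb = sqrt bb"
    have rb: "rb \<ge> 0" "rb\<^sup>2 = bb" using bb by (auto simp: rb_def)
    have "sqrt (d\<^sup>2 + 2 * bb) \<le> d + sqrt 2 * rb"
    proof (rule real_le_lsqrt)
      show "d\<^sup>2 + 2 * bb \<le> (d + sqrt 2 * rb)\<^sup>2"
        using d_nonneg rb by (simp add: power2_sum power_mult_distrib)
    qed (use d_nonneg rb bb in auto)
    then have "sqrt 2 * sqrt (d\<^sup>2 + 2 * bb) \<le> sqrt 2 * (d + sqrt 2 * rb)" by simp
    also have "\<dots> = sqrt 2 * d + 2 * rb" by (simp add: algebra_simps)
    finally have "sqrt 2 * sqrt (d\<^sup>2 + 2 * bb) \<le> z / 4 + 2 * rb" using dz by linarith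
    then have ip: "\<bar>h y \<bullet> a - x \<bullet> a\<bar> \<le> z / 4 + 2 * rb"
      using inner_orbit_root[OF a h] by (simp add: bb_def)
    have "b' - bb = (x \<bullet> a) * (h y \<bullet> a)" using b_refl[OF a h] by (simp add: b'_def bb_def)
    also have "\<dots> = z\<^sup>2 + (x \<bullet> a) * (h y \<bullet> a - x \<bullet> a)" by (simp add: z_def xi_def power2_eq_square algebra_simps)
    also have "\<dots> \<ge> z\<^sup>2 - z * (z / 4 + 2 * rb)"
    proof -
      have "\<bar>(x \<bullet> a) * (h y \<bullet> a - x \<bullet> a)\<bar> \<le> z * (z / 4 + 2 * rb)"
        unfolding abs_mult z_def xi_def[symmetric] using ip z by (intro mult_left_mono) (auto simp: z_def)
      then show ?thesis by linarith
    qed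
    finally have "b' - bb \<ge> z\<^sup>2 - z * (z / 4 + 2 * rb)" .
    moreover have "2 * z * rb \<le> z\<^sup>2 / 4 + 4 * bb"
      using zero_le_power2[of "z / 2 - 2 * rb"] rb by (simp add: power2_eq_square algebra_simps)
    ultimately have "b' \<ge> z\<^sup>2 / 2 - 3 * bb" by (simp add: algebra_simps power2_eq_square)
    then have "s * b' \<ge> s * (z\<^sup>2 / 2 - 3 * bb)" using s by (intro mult_left_mono)
    then have q': "s * b' \<ge> s * z\<^sup>2 / 2 - 3 * (s * bb)" by (simp add: algebra_simps)
    \<comment> \<open>The summand 24 (K + 1) is 12 A; it is what keeps each error term of the last
      case below X / 12.\<close>
    have aaA: "width\<^sup>2 \<ge> 12 * A" by (simp add: width_square A_def)
    show ?thesis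
    proof (cases "s * bb \<ge> s * z\<^sup>2 / 12")
      case True
      have "t \<le> (12 * (s * bb)) / (12 * A)"
        unfolding t_def using True aaA A s bb by (intro frac_le) auto
      also have "\<dots> = 2 * e" by (simp add: e_def)
      finally show ?thesis using r1 w1 s e by linarith
    next
      case False
      define X where "X = s * z\<^sup>2"
      have X: "X \<ge> 0" using s by (simp add: X_def)
      have lt: "s * bb \<le> X / 12" "s * b' \<ge> X / 4" using False q' by (auto simp: X_def)
      have K2: "s * bb \<le> A" using q by (simp add: A_def bb_def)
      have "A / width\<^sup>2 \<le> 1 / 12" using aaA width by (simp add: divide_le_eq)
      then have 1: "A / width\<^sup>2 * X \<le> 1 / 12 * X" using X by (rule mult_right_mono)
      have "(s * bb) * (X / width\<^sup>2) \<le> A * (X / width\<^sup>2)" using K2 X by (intro mult_right_mono) auto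
      also have "\<dots> = A / width\<^sup>2 * X" by simp
      finally have 2: "(s * bb) * (X / width\<^sup>2) \<le> 1 / 12 * X" using 1 by (rule order_trans)
      \<comment> \<open>Beside A the product has three terms, each at most X / 12, against s b'
        \<ge> X / 4.\<close>
      have "(A + s * bb) * (1 + X / width\<^sup>2) = A + s * bb + A / width\<^sup>2 * X + (s * bb) * (X / width\<^sup>2)"
        by (simp add: distrib_left distrib_right add_divide_distrib)
      then have "(A + s * bb) * (1 + X / width\<^sup>2) \<le> A + s * b'"
        using lt 1 2 by linarith
      moreover have "1 + X / width\<^sup>2 > 0" using X by (simp add: add_pos_nonneg)
      moreover have "A + s * b' > 0" using A s bb by (simp add: add_pos_nonneg)
      ultimately have "(A + s * bb) / (A + s * b') \<le> 1 / (1 + X / width\<^sup>2)"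
        by (simp add: field_simps)
      then have "sqrt ((A + s * bb) / (A + s * b')) \<le> sqrt (1 / (1 + X / width\<^sup>2))" by simp
      also have "\<dots> = w" by (simp add: w_def X_def real_sqrt_divide)
      finally show ?thesis using s e by linarith
    qed
  qed
  then show ?thesis unfolding profile_drop e(2)[symmetric] by (simp add: A_def bb_def b'_def)
qed

end

section \<open>The differential system on the orbit and its comparison principle\<close>

locale orbit_system = orbit_pair R k x y for R :: "(real ^ 'n) set" and k x y +
  fixes u :: "(real ^ 'n \<Rightarrow> real ^ 'n) \<Rightarrow> real \<Rightarrow> real"
  assumes u0: "h \<in> G \<Longrightarrow> u h 0 = 1"
    and ucont: "h \<in> G \<Longrightarrow> continuous_on {0..1} (u h)"
    and uder: "h \<in> G \<Longrightarrow> 0 < s \<Longrightarrow> s \<le> 1 \<Longrightarrow> (u h has_real_derivative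
      (- b h * u h s - (\<Sum>a\<in>R. kap a * (u h s - u (root_reflection a \<circ> h) s)) / s)) (at s)"
begin

text \<open>The function exp (- L s) is a subsolution: it is the same at all orbit points, so the
  reflection terms vanish, and L is at least every decay rate b.\<close>

lemma u_pos:
  assumes "h \<in> G" "s \<in> {0..1}"
  shows "u h s > 0"
proof -
  define L where "L = (\<Sum>g\<in>G. b g)"
  have L: "b g \<le> L" if "g \<in> G" for g
    unfolding L_def using that by (intro member_le_sum) (auto simp: b_nonneg)
  have "exp (- L * s) - u h s \<le> 0"
  proof (rule max_principle[where I = G and z = "\<lambda>h s. exp (- L * s) - u h s" and C = 0 and
        z' = "\<lambda>h s. - L * exp (- L * s) - (- b h * u h s - (\<Sum>a\<in>R. kap a * (u h s - u (root_reflection a \<circ> h) s)) / s)"])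
    fix g and t :: real assume g: "g \<in> G" and t: "0 < t" "t \<le> 1"
    show "((\<lambda>s. exp (- L * s) - u g s) has_real_derivative
       - L * exp (- L * t) - (- b g * u g t - (\<Sum>a\<in>R. kap a * (u g t - u (root_reflection a \<circ> g) t)) / t)) (at t)"
      by (rule derivative_eq_intros uder[OF g t] refl | simp)+
    assume pos: "exp (- L * t) - u g t > 0"
      and max: "\<And>j. j \<in> G \<Longrightarrow> exp (- L * t) - u j t \<le> exp (- L * t) - u g t"
    have "u g t \<le> u (root_reflection a \<circ> g) t" if "a \<in> R" for a
      using max[of "root_reflection a \<circ> g"] that g by auto
    then have "(\<Sum>a\<in>R. kap a * (u g t - u (root_reflection a \<circ> g) t)) \<le> (\<Sum>a\<in>R. kap a * 0)"
      by (intro sum_kap_mono) auto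
    then have 1: "(\<Sum>a\<in>R. kap a * (u g t - u (root_reflection a \<circ> g) t)) / t \<le> 0"
      using t by (simp add: divide_nonpos_pos)
    have "b g * u g t \<le> b g * exp (- L * t)" using pos b_nonneg[OF g] by (intro mult_left_mono) auto
    also have "\<dots> \<le> L * exp (- L * t)" using L[OF g] by simp
    finally show "- L * exp (- L * t) - (- b g * u g t - (\<Sum>a\<in>R. kap a * (u g t - u (root_reflection a \<circ> g) t)) / t)
        \<le> 0 * (exp (- L * t) - u g t)" using 1 by simp
  qed (use assms in \<open>auto simp: u0 intro!: continuous_intros ucont\<close>)
  then show ?thesis by (smt (verit) exp_gt_zero)
qed

lemma u_le_supersolution:
  assumes v0: "\<And>h. h \<in> G \<Longrightarrow> v h 0 \<ge> 1"
    and vcont: "\<And>h. h \<in> G \<Longrightarrow> continuous_on {0..1} (v h)"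
    and vder: "\<And>h s. h \<in> G \<Longrightarrow> 0 < s \<Longrightarrow> s \<le> 1 \<Longrightarrow> (v h has_real_derivative v' h s) (at s)"
    and super: "\<And>h s. h \<in> G \<Longrightarrow> 0 < s \<Longrightarrow> s \<le> 1 \<Longrightarrow>
      s * v' h s \<ge> - (s * b h) * v h s - (\<Sum>a\<in>R. kap a * (v h s - v (root_reflection a \<circ> h) s))"
    and h: "h \<in> G" and s: "s \<in> {0..1}"
  shows "u h s \<le> v h s"
proof -
  have "u h s - v h s \<le> 0"
  proof (rule max_principle[where I = G and z = "\<lambda>h s. u h s - v h s" and C = 0 and
        z' = "\<lambda>h s. (- b h * u h s - (\<Sum>a\<in>R. kap a * (u h s - u (root_reflection a \<circ> h) s)) / s) - v' h s"])
    fix g and t :: real assume g: "g \<in> G" and t: "0 < t" "t \<le> 1"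
    show "((\<lambda>s. u g s - v g s) has_real_derivative
      (- b g * u g t - (\<Sum>a\<in>R. kap a * (u g t - u (root_reflection a \<circ> g) t)) / t) - v' g t) (at t)"
      by (intro DERIV_diff uder vder g t)
    assume pos: "u g t - v g t > 0" and max: "\<And>j. j \<in> G \<Longrightarrow> u j t - v j t \<le> u g t - v g t"
    have "v g t - v (root_reflection a \<circ> g) t \<le> u g t - u (root_reflection a \<circ> g) t" if "a \<in> R" for a
      using max[of "root_reflection a \<circ> g"] that g by force
    then have 1: "(\<Sum>a\<in>R. kap a * (v g t - v (root_reflection a \<circ> g) t)) \<le>
        (\<Sum>a\<in>R. kap a * (u g t - u (root_reflection a \<circ> g) t))"
      by (intro sum_kap_mono) auto
    have "t * b g * (u g t - v g t) \<ge> 0" using t pos b_nonneg[OF g] by simp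
    then have "t * (- b g * u g t) - (\<Sum>a\<in>R. kap a * (u g t - u (root_reflection a \<circ> g) t)) - t * v' g t \<le> 0"
      using super[OF g t] 1 by (simp add: algebra_simps)
    also have "t * (- b g * u g t) - (\<Sum>a\<in>R. kap a * (u g t - u (root_reflection a \<circ> g) t)) - t * v' g t
      = t * (- b g * u g t - (\<Sum>a\<in>R. kap a * (u g t - u (root_reflection a \<circ> g) t)) / t - v' g t)"
      using t by (simp add: algebra_simps)
    finally show "- b g * u g t - (\<Sum>a\<in>R. kap a * (u g t - u (root_reflection a \<circ> g) t)) / t - v' g t
        \<le> 0 * (u g t - v g t)" unfolding mult_zero_left using t(1) by (simp only: mult_le_0_iff) linarith
  qed (use h s u0 v0 in \<open>auto intro!: continuous_intros ucont vcont\<close>)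
  then show ?thesis by simp
qed

subsection \<open>Upper bound\<close>

text \<open>The last factor makes neighbours with larger b count less. With a function depending on
  s alone the reflection terms would vanish, and at a nearest point, where there is no decay either,
  nothing would balance the drop of the profile.\<close>

lemma u_upper_weighted:
  assumes h: "h \<in> G" and s: "s \<in> {0..1}"
  shows "u h s \<le> exp (K * s + log_profile s - ln (1 + s * b h / (2 * (K + 1))) / 2)"
proof -
  define A where "A = 2 * (K + 1)"
  have A: "A > 0" using K_nonneg by (simp add: A_def)
  define v where "v = (\<lambda>h s. exp (K * s + log_profile s - ln (1 + s * b h / A) / 2))"
  define v' where "v' = (\<lambda>h s. v h s * (K + - (\<Sum>a\<in>R. kap a * profile_drop a s) / s - b h / A / (1 + s * b h / A) / 2))"
  have pos1: "1 + t * b g / A > 0" if "g \<in> G" "t \<ge> 0" for g t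
    using that A b_nonneg by (intro add_pos_nonneg) auto
  have "u h s \<le> v h s"
  proof (rule u_le_supersolution[where v' = v'])
    fix g assume g: "g \<in> G"
    show "v g 0 \<ge> 1" by (simp add: v_def log_profile_0)
    show "continuous_on {0..1} (v g)"
    proof -
      have "1 + t * b g / A \<noteq> 0" if "t \<in> {0..1}" for t using pos1[OF g, of t] that by auto
      moreover have "A \<noteq> 0" using A by simp
      ultimately show ?thesis unfolding v_def by (intro continuous_intros log_profile_cont) auto
    qed
    fix t :: real assume t: "0 < t" "t \<le> 1"
    have dl: "((\<lambda>t. ln (1 + t * b g / A)) has_real_derivative (1 / (1 + t * b g / A)) * (b g / A)) (at t)"
    proof (rule DERIV_chain2[where f = ln])
      show "(ln has_real_derivative 1 / (1 + t * b g / A)) (at (1 + t * b g / A))"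
        using DERIV_ln_divide[OF pos1[OF g]] t by simp
      show "((\<lambda>t. 1 + t * b g / A) has_real_derivative b g / A) (at t)"
        using A by (auto intro!: derivative_eq_intros)
    qed
    have "((\<lambda>s. K * s + log_profile s - ln (1 + s * b g / A) / 2) has_real_derivative
      (K + - (\<Sum>a\<in>R. kap a * profile_drop a t) / t - (1 / (1 + t * b g / A)) * (b g / A) / 2)) (at t)"
      using DERIV_diff[OF DERIV_add[OF DERIV_cmult[OF DERIV_ident, of K] log_profile_deriv[OF t(1)]] DERIV_cdivide[OF dl, of 2]]
      by simp
    from DERIV_chain2[OF DERIV_exp this]
    show "(v g has_real_derivative v' g t) (at t)"
      unfolding v'_def v_def by (simp add: mult.commute)
    define q where "q = t * b g"
    have q: "q \<ge> 0" using t b_nonneg[OF g] by (simp add: q_def)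
    define ra where "ra = (\<lambda>a. sqrt ((A + q) / (A + t * b (root_reflection a \<circ> g))))"
    have ratio: "v (root_reflection a \<circ> g) t = v g t * ra a" if a: "a \<in> R" for a
    proof -
      define q' where "q' = t * b (root_reflection a \<circ> g)"
      have q': "q' \<ge> 0" unfolding q'_def using t a g by (intro mult_nonneg_nonneg b_nonneg) auto
      have "ra a = exp (ln ((A + q) / (A + q')) / 2)"
      proof -
        have X: "(A + q) / (A + q') > 0" using A q q' by (intro divide_pos_pos add_pos_nonneg)
        have "exp (ln ((A + q) / (A + q')) / 2) = exp (ln (sqrt ((A + q) / (A + q'))))"
          by (simp only: ln_sqrt[OF less_imp_le[OF X]])
        also have "\<dots> = sqrt ((A + q) / (A + q'))" by (rule exp_ln) (simp only: real_sqrt_gt_0_iff X)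
        finally show ?thesis by (simp only: ra_def q'_def)
      qed
      also have "(A + q) / (A + q') = (1 + q / A) / (1 + q' / A)"
      proof -
        have "1 + q / A = (A + q) / A" "1 + q' / A = (A + q') / A" using A by (simp_all add: add_divide_distrib)
        then show ?thesis using A by simp
      qed
      also have "ln \<dots> = ln (1 + q / A) - ln (1 + q' / A)"
        using A q q' by (intro ln_divide_pos) (auto intro!: add_pos_nonneg)
      finally have "ra a = exp (ln (1 + q / A) / 2 - ln (1 + q' / A) / 2)" by (simp add: diff_divide_distrib)
      then show ?thesis
        by (simp add: v_def q_def[symmetric] q'_def[symmetric] flip: exp_add)
    qed
    have sumv: "(\<Sum>a\<in>R. kap a * (v g t - v (root_reflection a \<circ> g) t)) = v g t * (\<Sum>a\<in>R. kap a * (1 - ra a))"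
      unfolding sum_distrib_left by (intro sum.cong) (simp_all add: ratio algebra_simps del: comp_apply)
    have S0: "(\<Sum>a\<in>R. kap a * profile_drop a t) \<le> K"
      using sum_kap_mono[of "\<lambda>a. profile_drop a t" "\<lambda>_. 1"] profile_drop_bounds t sum_kap_const[of 1] by simp
    define f where "f = q / A"
    have f: "f \<ge> 0" "q = 2 * (K * f) + 2 * f" "K * f \<ge> 0"     proof -
      have "q = A * f" using A by (simp add: f_def)
      then show "q = 2 * (K * f) + 2 * f" by (simp add: A_def algebra_simps)
    qed (use A q K_nonneg in \<open>simp_all add: f_def\<close>)
    have main: "K * t - (\<Sum>a\<in>R. kap a * profile_drop a t) - q / (A + q) / 2 \<ge> - q - (\<Sum>a\<in>R. kap a * (1 - ra a))"
    proof -
      have qA: "q / (A + q) / 2 \<le> f / 2" unfolding f_def using A q by (intro divide_right_mono divide_left_mono) (auto intro!: mult_pos_pos add_pos_nonneg)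
      show ?thesis
      \<comment> \<open>Beyond 2 K one half of q pays for the entire drop of the profile, which is
        at most K, and the other half for the crude bound 1 + f / 2 on the ratio. Up to 2 K the
        finer \<open>profile_inequality\<close> is used.\<close>
      proof (cases "q \<le> 2 * K")
        case True
        have "(\<Sum>a\<in>R. kap a * ra a) \<le> (\<Sum>a\<in>R. kap a * ((1 + f + t) - profile_drop a t))"
        proof (intro sum_kap_mono)
          fix a assume a: "a \<in> R"
          show "ra a \<le> 1 + f + t - profile_drop a t"
            using profile_inequality[OF b_nonneg[OF g] g a less_imp_le[OF t(1)] t(2)] True
            unfolding ra_def f_def q_def A_def by simp
        qed
        also have "\<dots> = K * (1 + f + t) - (\<Sum>a\<in>R. kap a * profile_drop a t)"
          by (simp only: right_diff_distrib sum_subtractf sum_kap_const)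
        finally have "(\<Sum>a\<in>R. kap a * ra a) \<le> K + K * f + K * t - (\<Sum>a\<in>R. kap a * profile_drop a t)"
          by (simp add: distrib_left)
        moreover have "(\<Sum>a\<in>R. kap a * (1 - ra a)) = K - (\<Sum>a\<in>R. kap a * ra a)"
          by (simp add: right_diff_distrib sum_subtractf K_def[symmetric])
        ultimately show ?thesis using qA f by linarith
      next
        case False
        have "ra a \<le> 1 + f / 2" if a: "a \<in> R" for a
        proof -
          have "t * b (root_reflection a \<circ> g) \<ge> 0" using t b_nonneg a g by (intro mult_nonneg_nonneg b_nonneg) auto
          then have "(A + q) / (A + t * b (root_reflection a \<circ> g)) \<le> (A + q) / A"
            using A q by (intro divide_left_mono mult_pos_pos add_pos_nonneg) auto
          also have "\<dots> \<le> (1 + q / A / 2)\<^sup>2"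
            using A zero_le_power2[of "q / A / 2"] by (simp add: power2_sum add_divide_distrib)
          finally have "ra a \<le> sqrt ((1 + q / A / 2)\<^sup>2)" unfolding ra_def by (rule real_sqrt_le_mono)
          also have "\<dots> = 1 + f / 2" using A q by (simp add: f_def)
          finally show ?thesis .
        qed
        then have "(\<Sum>a\<in>R. kap a * (1 - ra a)) \<ge> (\<Sum>a\<in>R. kap a * (- (f / 2)))"
          by (intro sum_kap_mono) (simp add: algebra_simps)
        then have "(\<Sum>a\<in>R. kap a * (1 - ra a)) \<ge> K * (- (f / 2))"
          by (simp only: sum_kap_const)
        then have "(\<Sum>a\<in>R. kap a * (1 - ra a)) \<ge> - (K * f) / 2" by simp
        moreover have "K * t \<ge> 0" using t K_nonneg by simp
        ultimately show ?thesis using qA S0 False f by linarith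
      qed
    qed
    have "t * v' g t = v g t * (K * t - (\<Sum>a\<in>R. kap a * profile_drop a t) - q / (A + q) / 2)"
    proof -
      have "1 + t * b g / A = (A + q) / A" using A by (simp add: q_def add_divide_distrib)
      then have "t * (b g / A / (1 + t * b g / A) / 2) = q / (A + q) / 2" using A by (simp add: q_def)
      moreover have "t * v' g t = v g t * (K * t + - (\<Sum>a\<in>R. kap a * profile_drop a t) - t * (b g / A / (1 + t * b g / A) / 2))"
        using t by (simp add: v'_def distrib_left right_diff_distrib mult_ac)
      ultimately show ?thesis by simp
    qed
    moreover have "v g t > 0" by (simp add: v_def)
    ultimately have "t * v' g t \<ge> v g t * (- q - (\<Sum>a\<in>R. kap a * (1 - ra a)))"
      using main by simp
    then show "t * v' g t \<ge> - (t * b g) * v g t - (\<Sum>a\<in>R. kap a * (v g t - v (root_reflection a \<circ> g) t))"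
      unfolding sumv q_def by (simp add: algebra_simps)
  qed (use h s in auto)
  then show ?thesis by (simp add: v_def A_def)
qed

lemma u_upper:
  assumes h: "h \<in> G" and s: "s \<in> {0..1}"
  shows "u h s \<le> exp (K * s + log_profile s)"
proof -
  have "ln (1 + s * b h / (2 * (K + 1))) \<ge> 0"
    using b_nonneg[OF h] s K_nonneg by simp
  then have "exp (K * s + log_profile s - ln (1 + s * b h / (2 * (K + 1))) / 2) \<le> exp (K * s + log_profile s)" by simp
  with u_upper_weighted[OF h s] show ?thesis by (rule order_trans)
qed

subsection \<open>Lower bound at the nearest points of the orbit\<close>

text \<open>In the estimate of the logarithmic ratio 1 comes from 2 sqrt q \<le> 1 + q, and 2 K from
  twice the total drop of the profile.\<close>

definition drift_const :: real where "drift_const = 2 * K + 1"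
definition Phi where "Phi h s = K * s + log_profile s - ln (u h s)"
definition log_u_deriv where
  "log_u_deriv h s = - b h - (\<Sum>a\<in>R. kap a * (1 - u (root_reflection a \<circ> h) s / u h s)) / s"

lemma Phi_nonneg: "h \<in> G \<Longrightarrow> s \<in> {0..1} \<Longrightarrow> Phi h s \<ge> 0"
  using u_upper[of h s] u_pos[of h s] by (simp add: Phi_def ln_le_cancel_iff[symmetric] del: ln_le_cancel_iff)

lemma ln_u_deriv:
  assumes "h \<in> G" "0 < s" "s \<le> 1"
  shows "((\<lambda>s. ln (u h s)) has_real_derivative log_u_deriv h s) (at s)"
proof -
  have p: "u h s > 0" using u_pos assms by simp
  have "((\<lambda>s. ln (u h s)) has_real_derivative 1 / u h s *
     (- b h * u h s - (\<Sum>a\<in>R. kap a * (u h s - u (root_reflection a \<circ> h) s)) / s)) (at s)"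
    by (rule DERIV_chain2[where f = ln, OF DERIV_ln_divide[OF p] uder[OF assms]])
  also have "1 / u h s * (- b h * u h s - (\<Sum>a\<in>R. kap a * (u h s - u (root_reflection a \<circ> h) s)) / s)
    = - b h - ((\<Sum>a\<in>R. kap a * (u h s - u (root_reflection a \<circ> h) s)) / u h s) / s"
    using p by (simp add: right_diff_distrib)
  also have "(\<Sum>a\<in>R. kap a * (u h s - u (root_reflection a \<circ> h) s)) / u h s =
    (\<Sum>a\<in>R. kap a * (1 - u (root_reflection a \<circ> h) s / u h s))"
    using p by (simp add: sum_divide_distrib diff_divide_distrib right_diff_distrib)
  finally show ?thesis by (simp add: log_u_deriv_def)
qed

lemma ln_u_cont: "h \<in> G \<Longrightarrow> continuous_on {0..1} (\<lambda>s. ln (u h s))"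
  by (intro continuous_on_ln ucont ballI) (use u_pos in force)+

lemma Phi_deriv:
  assumes "h \<in> G" "0 < s" "s \<le> 1"
  shows "(Phi h has_real_derivative K - (\<Sum>a\<in>R. kap a * profile_drop a s) / s - log_u_deriv h s) (at s)"
  unfolding Phi_def
  using DERIV_diff[OF DERIV_add[OF DERIV_cmult[OF DERIV_ident, of K] log_profile_deriv[OF assms(2)]] ln_u_deriv[OF assms]]
  by simp

lemma Phi_cont: "h \<in> G \<Longrightarrow> continuous_on {0..1} (Phi h)"
  unfolding Phi_def by (intro continuous_intros log_profile_cont ln_u_cont)

lemma sum_profile_drop_le: "s \<ge> 0 \<Longrightarrow> (\<Sum>a\<in>R. kap a * profile_drop a s) \<le> K"
  using sum_kap_mono[of "\<lambda>a. profile_drop a s" "\<lambda>_. 1"] profile_drop_bounds sum_kap_const[of 1] by simp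

text \<open>The logarithmic ratio across a reflection is a subsolution of the equation satisfied, up to
  a source term, by \<open>Phi\<close>: conjugating by \<open>u\<close> turns the system into a Markov generator, for
  which \<open>Phi\<close> is a Lyapunov function.\<close>

lemma log_ratio_le:
  assumes c: "c \<in> R" and h: "h \<in> G" and s: "s \<in> {0..1}"
  shows "ln (u h s) - ln (u (root_reflection c \<circ> h) s) \<le>
    2 * (sqrt s * xi c) * (drift_const + Phi h s) + s * (xi c * (xi c + sqrt 2 * d))"
proof -
  define m where "m = xi c * (xi c + sqrt 2 * d)"
  define p where "p = (\<lambda>h s. ln (u h s) - ln (u (root_reflection c \<circ> h) s))"
  define z where "z = (\<lambda>h s. p h s - 2 * (sqrt s * xi c) * (drift_const + Phi h s) - s * m)"
  define z' where "z' = (\<lambda>h s. log_u_deriv h s - log_u_deriv (root_reflection c \<circ> h) s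
     - (2 * (inverse (sqrt s) / 2 * xi c) * (drift_const + Phi h s)
        + 2 * (sqrt s * xi c) * (K - (\<Sum>a\<in>R. kap a * profile_drop a s) / s - log_u_deriv h s)) - m)"
  have "z h s \<le> 0"
  proof (rule max_principle[where I = G and C = 0 and z = z and z' = z'])
    fix g assume g: "g \<in> G"
    have cg: "root_reflection c \<circ> g \<in> G" using c g by auto
    show "continuous_on {0..1} (z g)" unfolding z_def p_def
      by (intro continuous_intros ln_u_cont Phi_cont g cg)
    show "z g 0 \<le> 0" using u0[OF g] u0[OF cg] by (simp add: z_def p_def)
    fix t :: real assume t: "0 < t" "t \<le> 1"
    show "(z g has_real_derivative z' g t) (at t)"
      unfolding z_def z'_def p_def
      by (rule derivative_eq_intros ln_u_deriv[OF g t] ln_u_deriv[OF cg t] Phi_deriv[OF g t] DERIV_real_sqrt t refl | simp add: algebra_simps)+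
    assume "z g t > 0" and max: "\<And>j. j \<in> G \<Longrightarrow> z j t \<le> z g t"
    define w where "w = (\<lambda>a. u (root_reflection a \<circ> g) t / u g t)"
    have tt: "t \<in> {0..1}" using t by simp
    have up: "u j t > 0" if "j \<in> G" for j using u_pos[OF that tt] .
    have ag: "root_reflection a \<circ> g \<in> G" if "a \<in> R" for a using that g by auto
    have w: "w a > 0" if "a \<in> R" for a using up[OF ag[OF that]] up[OF g] by (simp add: w_def del: comp_apply)
    define S where "S = (\<Sum>a\<in>R. kap a * (1 - w a))"
    define r where "r = 2 * (sqrt t * xi c)"
    have r: "r \<ge> 0" using t by (simp add: r_def xi_nonneg)
    define w' where "w' = (\<lambda>a. u (root_reflection c \<circ> (root_reflection a \<circ> g)) t / u (root_reflection c \<circ> g) t)"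
    have D1: "t * log_u_deriv g t = - t * b g - S"
      using t by (simp add: log_u_deriv_def S_def w_def right_diff_distrib del: comp_apply)
    \<comment> \<open>Reindexing the roots by \<sigma>_c pairs the neighbour \<sigma>_a g of g with
      the neighbour \<sigma>_c \<sigma>_a g of \<sigma>_c g.\<close>
    have "(\<Sum>a\<in>R. kap a * (1 - w' a)) =
      (\<Sum>a\<in>R. kap a * (1 - u (root_reflection (root_reflection c a) \<circ> (root_reflection c \<circ> g)) t / u (root_reflection c \<circ> g) t))"
    proof (intro sum.cong refl)
      fix a assume a: "a \<in> R"
      have "root_reflection (root_reflection c a) \<circ> (root_reflection c \<circ> g) = root_reflection c \<circ> (root_reflection a \<circ> g)"
        using G_conj[OF refl_in_G[OF c] a] by (metis comp_assoc)
      then show "kap a * (1 - w' a) = kap a * (1 - u (root_reflection (root_reflection c a) \<circ> (root_reflection c \<circ> g)) t / u (root_reflection c \<circ> g) t)"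
        by (simp only: w'_def)
    qed
    also have "\<dots> = (\<Sum>a\<in>R. kap a * (1 - u (root_reflection a \<circ> (root_reflection c \<circ> g)) t / u (root_reflection c \<circ> g) t))"
      by (rule sum_kap_reindex[OF refl_in_G[OF c], of "\<lambda>a. 1 - u (root_reflection a \<circ> (root_reflection c \<circ> g)) t / u (root_reflection c \<circ> g) t"])
    finally have D2: "t * log_u_deriv (root_reflection c \<circ> g) t = - t * b (root_reflection c \<circ> g) - (\<Sum>a\<in>R. kap a * (1 - w' a))"
      using t by (simp add: log_u_deriv_def right_diff_distrib del: comp_apply)
    \<comment> \<open>Maximality of z at g bounds -v by r times the increment of \<open>Phi\<close>,
      that is by - r ln (w a). Since w ln (1 / w) \<le> 1 - w, the jump terms of the ratio are at
      most r times those of ln u, which \<open>Phi\<close> contributes with the opposite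
      sign.\<close>
    have ww: "w a - w' a \<le> r * (1 - w a)" if a: "a \<in> R" for a
    proof -
      have cag: "root_reflection c \<circ> (root_reflection a \<circ> g) \<in> G" using ag[OF a] c by blast
      define v where "v = p g t - p (root_reflection a \<circ> g) t"
      have "exp v = u g t / u (root_reflection c \<circ> g) t * (u (root_reflection c \<circ> (root_reflection a \<circ> g)) t / u (root_reflection a \<circ> g) t)"
        unfolding v_def p_def exp_diff using up[OF g] up[OF cg] up[OF cag] up[OF ag[OF a]]
        by (simp del: comp_apply)
      then have "w' a = w a * exp v"
        using up[OF g] up[OF ag[OF a]] by (simp add: w_def w'_def del: comp_apply)
      also have "\<dots> \<ge> w a * (1 + v)" using w[OF a] exp_ge_add_one_self[of v] by (intro mult_left_mono) auto
      finally have 1: "w a - w' a \<le> w a * (- v)" by (simp add: algebra_simps)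
      have "- v \<le> r * (Phi (root_reflection a \<circ> g) t - Phi g t)"
        using max[OF ag[OF a]] by (simp add: z_def v_def r_def algebra_simps)
      also have "Phi (root_reflection a \<circ> g) t - Phi g t = - ln (w a)"
        using up[OF g] up[OF ag[OF a]] by (simp add: Phi_def w_def ln_div del: comp_apply)
      finally have "w a * (- v) \<le> w a * (r * (- ln (w a)))" using w[OF a] by (intro mult_left_mono) auto
      also have "\<dots> = r * (w a * ln (1 / w a))" using w[OF a] by (simp add: ln_div)
      also have "\<dots> \<le> r * (w a * (1 / w a - 1))"
        using w[OF a] r by (intro mult_left_mono ln_le_minus_one) auto
      also have "\<dots> = r * (1 - w a)" using w[OF a] by (simp add: field_simps)
      finally show ?thesis using 1 by linarith
    qed
    have "(\<Sum>a\<in>R. kap a * (1 - w' a)) - S = (\<Sum>a\<in>R. kap a * (w a - w' a))"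
      by (simp add: S_def right_diff_distrib sum_subtractf)
    also have "\<dots> \<le> (\<Sum>a\<in>R. kap a * (r * (1 - w a)))" using ww by (rule sum_kap_mono)
    also have "\<dots> = r * S" by (simp add: S_def sum_distrib_left mult.left_commute)
    finally have 2: "(\<Sum>a\<in>R. kap a * (1 - w' a)) - S \<le> r * S" .
    define q where "q = t * b g"
    have q: "q \<ge> 0" using t b_nonneg[OF g] by (simp add: q_def)
    have be: "t * b (root_reflection c \<circ> g) - t * b g \<le> t * m + r / 2 * (1 + q)"
    proof -
      have "t * b (root_reflection c \<circ> g) - t * b g = t * ((x \<bullet> c) * (g y \<bullet> c))"
        using b_refl[OF c g] by (simp add: algebra_simps)
      also have "(x \<bullet> c) * (g y \<bullet> c) \<le> \<bar>x \<bullet> c\<bar> * \<bar>g y \<bullet> c\<bar>" by (metis abs_ge_self abs_mult)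
      also have "\<bar>g y \<bullet> c\<bar> \<le> xi c + sqrt 2 * sqrt (d\<^sup>2 + 2 * b g)"
        using inner_orbit_root[OF c g] by (simp add: xi_def)
      also have "sqrt (d\<^sup>2 + 2 * b g) \<le> d + sqrt (2 * b g)"
        using sqrt_add_le_add_sqrt[of "d\<^sup>2" "2 * b g"] d_nonneg b_nonneg[OF g] by simp
      finally have "t * b (root_reflection c \<circ> g) - t * b g \<le> t * (xi c * (xi c + sqrt 2 * (d + sqrt (2 * b g))))"
        using t by (simp add: xi_def mult_left_mono)
      also have "sqrt 2 * (d + sqrt (2 * b g)) = sqrt 2 * d + 2 * sqrt (b g)"
        by (simp add: real_sqrt_mult algebra_simps)
      also have "t * (xi c * (xi c + (sqrt 2 * d + 2 * sqrt (b g)))) = t * m + r / 2 * (2 * sqrt q)"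
      proof -
        have "t * sqrt (b g) = sqrt t * sqrt q" using t by (simp add: q_def real_sqrt_mult)
        then show ?thesis unfolding m_def r_def by (simp add: algebra_simps)
      qed
      also have "2 * sqrt q \<le> 1 + q"
        using zero_le_power2[of "1 - sqrt q"] q by (simp add: power2_diff)
      finally show ?thesis using r by (simp add: mult_left_mono del: comp_apply)
    qed
    \<comment> \<open>Differentiating the factor sqrt s produces r / 2 times
      \<open>drift_const\<close> plus \<open>Phi\<close> with a favourable sign; this pays for the
      cross term in \<open>be\<close>.\<close>
    have it: "t * (2 * (inverse (sqrt t) / 2 * xi c)) = r / 2"
      using t by (simp add: r_def field_simps)
    have "t * z' g t = t * log_u_deriv g t - t * log_u_deriv (root_reflection c \<circ> g) t - r / 2 * (drift_const + Phi g t)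
        - r * (t * K - (\<Sum>a\<in>R. kap a * profile_drop a t) - t * log_u_deriv g t) - t * m"
      using t unfolding z'_def r_def[symmetric] it[symmetric] by (simp add: algebra_simps)
    also have "\<dots> = (t * b (root_reflection c \<circ> g) - t * b g) + ((\<Sum>a\<in>R. kap a * (1 - w' a)) - S) - r / 2 * (drift_const + Phi g t)
        - r * (t * K - (\<Sum>a\<in>R. kap a * profile_drop a t) + q + S) - t * m"
      unfolding D1 D2 q_def by (simp add: algebra_simps)
    also have "\<dots> \<le> r / 2 * (1 + q) - r / 2 * (drift_const + Phi g t) - r * (t * K - (\<Sum>a\<in>R. kap a * profile_drop a t) + q)"
      using 2 be by (simp add: algebra_simps)
    also have "\<dots> = r / 2 * ((1 + q) - (drift_const + Phi g t) - 2 * (t * K - (\<Sum>a\<in>R. kap a * profile_drop a t) + q))"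
      by (simp add: algebra_simps)
    also have "\<dots> \<le> 0"
    proof (rule mult_nonneg_nonpos)
      define Sm where "Sm = (\<Sum>a\<in>R. kap a * profile_drop a t)"
      have "Sm \<le> K" unfolding Sm_def using t by (intro sum_profile_drop_le) simp
      moreover have "t * K \<ge> 0" using t K_nonneg by simp
      ultimately show "(1 + q) - (drift_const + Phi g t) - 2 * (t * K - (\<Sum>a\<in>R. kap a * profile_drop a t) + q) \<le> 0"
        unfolding drift_const_def Sm_def[symmetric] using Phi_nonneg[OF g tt] q by (simp add: algebra_simps)
    qed (use r in simp)
    finally show "z' g t \<le> 0 * z g t" using t by (simp add: mult_le_0_iff)
  qed (use h s in auto)
  then show ?thesis by (simp add: z_def p_def m_def)
qed

end

text \<open>The rational function on the right is \<open>s \<partial>\<^sub>s\<close> of \<open>2 ln ((1 + Q y) / (Q + y))\<close> with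
  \<open>y = \<surd>s \<xi>\<close>; it stays bounded by a multiple of \<open>ln Q\<close> for all scales.\<close>

lemma scale_window:
  fixes Q F y :: real
  assumes "Q \<ge> 2" "y \<ge> 0" "F \<le> 1" "F \<le> Q * y" "F * y \<le> Q"
  shows "F \<le> 16 / 3 * (y * (Q\<^sup>2 - 1) / ((1 + Q * y) * (Q + y)))"
proof -
  define Y where "Y = Q\<^sup>2 * y"
  have 1: "F * Q \<le> Y" using mult_right_mono[OF assms(4), of Q] assms(1)
    by (simp add: Y_def power2_eq_square mult_ac)
  have 2: "F * y \<le> y" using mult_right_mono[OF assms(3,2)] by simp
  have 3: "F * Y \<le> Y" using mult_right_mono[OF assms(3), of Y] assms(2) by (simp add: Y_def)
  have 4: "F * y * (Q * y) \<le> Y" using mult_right_mono[OF assms(5), of "Q * y"] assms(1,2)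
    by (simp add: Y_def power2_eq_square mult_ac)
  have Q2: "Q\<^sup>2 \<ge> 4" using assms power_mono[of 2 Q 2] by simp
  then have 5: "4 * y \<le> Y" unfolding Y_def using assms by (intro mult_right_mono) auto
  have 6: "F * ((1 + Q * y) * (Q + y)) = F * Q + F * y + F * Y + F * y * (Q * y)"
    by (simp add: Y_def algebra_simps power2_eq_square)
  have "y * (Q\<^sup>2 - 1) = Y - y" by (simp add: Y_def algebra_simps)
  then have "16 / 3 * (y * (Q\<^sup>2 - 1)) = 16 / 3 * Y - 16 / 3 * y" by simp
  moreover have "3 * Y + y \<le> 16 / 3 * Y - 16 / 3 * y" using 5 assms(2) by simp
  ultimately have "F * ((1 + Q * y) * (Q + y)) \<le> 16 / 3 * (y * (Q\<^sup>2 - 1))"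
    unfolding 6 using 1 2 3 4 by linarith
  moreover have "(1 + Q * y) * (Q + y) > 0" using assms by (intro mult_pos_pos add_pos_nonneg) auto
  ultimately show ?thesis by (simp add: pos_le_divide_eq)
qed

text \<open>The logarithm is replaced by a line of slope e = 1 / (4 (C + 1)). As C e \<le> 1/4, the
  right side contains at most half of L, which moves to the left.\<close>

lemma log_bootstrap:
  fixes L K C P :: real
  assumes L: "L \<ge> 0" "L \<le> K + C * ln (P + 2 * L)" and C: "C \<ge> 0" and P: "P \<ge> 1"
  shows "L \<le> 2 * K + 1 + 2 * C * ln (4 * (C + 1)) + 2 * C * ln P"
proof -
  define e where "e = 1 / (4 * (C + 1))"
  have e: "e > 0" using C by (simp add: e_def)
  have "P + 2 * L \<le> P * (1 + 2 * L)" using mult_right_mono[of 1 P "2 * L"] L P by (simp add: algebra_simps)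
  then have "ln (P + 2 * L) \<le> ln (P * (1 + 2 * L))" using L P by (intro ln_mono) auto
  also have "\<dots> = ln P + ln (1 + 2 * L)" using L P by (intro ln_mult_pos) auto
  also have "ln (1 + 2 * L) = ln (e * (1 + 2 * L)) + ln (4 * (C + 1))"
  proof -
    have "ln (e * (1 + 2 * L)) = ln e + ln (1 + 2 * L)" using L e by (intro ln_mult_pos) auto
    moreover have "ln e = - ln (4 * (C + 1))" using C unfolding e_def by (subst ln_divide_pos) auto
    ultimately show ?thesis by simp
  qed
  also have "ln (e * (1 + 2 * L)) \<le> e * (1 + 2 * L) - 1" using L e by (intro ln_le_minus_one) auto
  finally have "ln (P + 2 * L) \<le> ln P + (e * (1 + 2 * L) + ln (4 * (C + 1)))" by simp
  then have "C * ln (P + 2 * L) \<le> C * (ln P + (e * (1 + 2 * L) + ln (4 * (C + 1))))"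
    using C by (rule mult_left_mono)
  moreover have "C * e \<le> 1 / 4" using C by (simp add: e_def divide_simps)
  then have "C * e * (1 + 2 * L) \<le> 1 / 4 * (1 + 2 * L)" using L by (intro mult_right_mono) auto
  ultimately show ?thesis using L(2) by (simp add: algebra_simps)
qed

context orbit_system
begin

text \<open>At a nearest point there is no decay, and s Phi' is K s plus, for each root, kappa times
  F = 1 - \<open>profile_drop\<close> - w. Always F \<le> 1; it is at most Q sqrt s \<xi> by the
  logarithmic ratio and at most Q / (sqrt s \<xi>) by the profile. So F matters only for sqrt s
  \<xi> between 1 / Q and Q, a window of length of order ln Q in ln s. As Q contains the maximum L
  of \<open>Phi\<close>, the outcome is an inequality for L that \<open>log_bootstrap\<close>
  resolves.\<close>

lemma Phi_min_bound:
  assumes e: "e \<in> G" "b e = 0" and s: "s \<in> {0..1}"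
  shows "Phi e s \<le> 2 * K + 1 + 2 * (64 / 3 * K) * ln (4 * (64 / 3 * K + 1))
    + 2 * (64 / 3 * K) * ln (width + 2 * drift_const + sqrt 2 * d + 1)"
proof -
  obtain sm where sm: "sm \<in> {0..1}" "\<And>s. s \<in> {0..1} \<Longrightarrow> Phi e s \<le> Phi e sm"
    using continuous_attains_sup[OF _ _ Phi_cont[OF e(1)]] by auto
  define L where "L = Phi e sm"
  have L: "L \<ge> 0" using Phi_nonneg e sm by (simp add: L_def)
  define Q where "Q = width + 2 * drift_const + sqrt 2 * d + 1 + 2 * L"
  have Q: "Q \<ge> 2" "Q \<ge> width" using L width_ge_1 d_nonneg K_nonneg by (auto simp: Q_def drift_const_def)
  \<comment> \<open>Normalised to vanish at s = 0. It never exceeds 4 ln Q, and 64/3 is 4 times the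
    constant 16/3 of \<open>scale_window\<close>.\<close>
  define Y where "Y = (\<lambda>a s. 2 * ln (1 + Q * (sqrt s * xi a)) - 2 * ln (Q + sqrt s * xi a) + 2 * ln Q)"
  define z where "z = (\<lambda>s. Phi e s - K * s - (\<Sum>a\<in>R. kap a * (16 / 3 * Y a s)))"
  define Y' where "Y' = (\<lambda>a s. sqrt s * xi a * (Q\<^sup>2 - 1) / ((1 + Q * (sqrt s * xi a)) * (Q + sqrt s * xi a)) / s)"
  define z' where "z' = (\<lambda>s. K - (\<Sum>a\<in>R. kap a * profile_drop a s) / s - log_u_deriv e s - K - (\<Sum>a\<in>R. kap a * (16 / 3 * Y' a s)))"
  have pos: "1 + Q * (sqrt t * xi a) > 0" "Q + sqrt t * xi a > 0" if "t \<ge> 0" for t a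
    using Q that xi_nonneg[of a] by (auto intro!: add_pos_nonneg)
  have Ycont: "continuous_on {0..1} (Y a)" for a
  proof -
    have "1 + Q * (sqrt t * xi a) \<noteq> 0" "Q + sqrt t * xi a \<noteq> 0" if "t \<in> {0..1}" for t
      using pos[of t a] that by auto
    then show ?thesis unfolding Y_def by (intro continuous_intros) auto
  qed
  \<comment> \<open>With a one-point index set the maximum principle just says that z, starting at a
    nonpositive value with z' \<le> 0, stays nonpositive.\<close>
  have "(\<lambda>_::unit. z) () sm \<le> 0"
  proof (rule max_principle[where I = "{()}" and C = 0 and z = "\<lambda>_. z" and z' = "\<lambda>_. z'"])
    show "continuous_on {0..1} z" unfolding z_def
      by (intro continuous_intros Phi_cont e Ycont)
    have "Y a 0 = 0" for a using Q by (simp add: Y_def)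
    then show "z 0 \<le> 0" using u0[OF e(1)] by (simp add: z_def Phi_def log_profile_0)
    fix t :: real assume t: "0 < t" "t \<le> 1"
    have Yder: "(Y a has_real_derivative Y' a t) (at t)" for a
    proof -
      define i where "i = inverse (sqrt t) / 2"
      have 1: "((\<lambda>t. sqrt t * xi a) has_real_derivative i * xi a) (at t)"
        unfolding i_def by (intro DERIV_cmult_right DERIV_real_sqrt t)
      have 2: "((\<lambda>t. ln (1 + Q * (sqrt t * xi a))) has_real_derivative 1 / (1 + Q * (sqrt t * xi a)) * (Q * (i * xi a))) (at t)"
      proof (rule DERIV_chain2[where f = ln])
        show "(ln has_real_derivative 1 / (1 + Q * (sqrt t * xi a))) (at (1 + Q * (sqrt t * xi a)))"
          using DERIV_ln_divide[OF pos(1)] t by simp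
        show "((\<lambda>t. 1 + Q * (sqrt t * xi a)) has_real_derivative Q * (i * xi a)) (at t)"
          using DERIV_add[OF DERIV_const DERIV_cmult[OF 1]] by simp
      qed
      have 3: "((\<lambda>t. ln (Q + sqrt t * xi a)) has_real_derivative 1 / (Q + sqrt t * xi a) * (i * xi a)) (at t)"
      proof (rule DERIV_chain2[where f = ln])
        show "(ln has_real_derivative 1 / (Q + sqrt t * xi a)) (at (Q + sqrt t * xi a))"
          using DERIV_ln_divide[OF pos(2)] t by simp
        show "((\<lambda>t. Q + sqrt t * xi a) has_real_derivative i * xi a) (at t)"
          using DERIV_add[OF DERIV_const 1] by simp
      qed
      have "(Y a has_real_derivative 2 * (1 / (1 + Q * (sqrt t * xi a)) * (Q * (i * xi a)))
          - 2 * (1 / (Q + sqrt t * xi a) * (i * xi a)) + 0) (at t)"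
        unfolding Y_def by (intro DERIV_add DERIV_diff DERIV_cmult 2 3 DERIV_const)
      also have "2 * (1 / (1 + Q * (sqrt t * xi a)) * (Q * (i * xi a))) - 2 * (1 / (Q + sqrt t * xi a) * (i * xi a)) + 0
         = (2 * i * xi a) * (Q / (1 + Q * (sqrt t * xi a)) - 1 / (Q + sqrt t * xi a))"
        by (simp add: algebra_simps)
      also have "Q / (1 + Q * (sqrt t * xi a)) - 1 / (Q + sqrt t * xi a)
          = (Q\<^sup>2 - 1) / ((1 + Q * (sqrt t * xi a)) * (Q + sqrt t * xi a))"
        using pos[of t a] t by (simp add: diff_frac_eq power2_eq_square algebra_simps)
      also have "2 * i * xi a = sqrt t * xi a / t"
        using t by (simp add: i_def field_simps)
      also have "sqrt t * xi a / t * ((Q\<^sup>2 - 1) / ((1 + Q * (sqrt t * xi a)) * (Q + sqrt t * xi a))) = Y' a t"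
        by (simp add: Y'_def mult_ac)
      finally show ?thesis .
    qed
    have "((\<lambda>s. \<Sum>a\<in>R. kap a * (16 / 3 * Y a s)) has_real_derivative (\<Sum>a\<in>R. kap a * (16 / 3 * Y' a t))) (at t)"
      by (intro DERIV_sum DERIV_cmult Yder)
    from DERIV_diff[OF DERIV_diff[OF Phi_deriv[OF e(1) t] DERIV_cmult[OF DERIV_ident, of K]] this]
    show "(z has_real_derivative z' t) (at t)"
      unfolding z_def z'_def by (simp only: mult_1_right)
    define w where "w = (\<lambda>a. u (root_reflection a \<circ> e) t / u e t)"
    have tt: "t \<in> {0..1}" using t by simp
    have le: "(1 - profile_drop a t - w a) \<le> 16 / 3 * (t * Y' a t)" if a: "a \<in> R" for a
    proof -
      define yy where "yy = sqrt t * xi a"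
      define F where "F = 1 - profile_drop a t - w a"
      have yy: "yy \<ge> 0" using t by (simp add: yy_def xi_nonneg)
      have ae: "root_reflection a \<circ> e \<in> G" using a e by auto
      have wp: "w a > 0" using u_pos[OF e(1) tt] u_pos[OF ae tt] by (simp add: w_def del: comp_apply)
      have F1: "F \<le> 1" using wp profile_drop_bounds(1)[of t a] t by (simp add: F_def)
      have F2: "F \<le> Q * yy"
      proof (cases "yy \<le> 1")
        case True
        have "- ln (w a) = ln (u e t) - ln (u (root_reflection a \<circ> e) t)"
          using u_pos[OF e(1) tt] u_pos[OF ae tt] by (simp add: w_def ln_div del: comp_apply)
        also have "\<dots> \<le> 2 * yy * (drift_const + Phi e t) + t * (xi a * (xi a + sqrt 2 * d))"
          using log_ratio_le[OF a e(1) tt] by (simp add: yy_def)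
        also have "\<dots> \<le> 2 * yy * (drift_const + L) + (yy * yy + yy * (sqrt 2 * d))"
        proof (intro add_mono mult_left_mono)
          have "sqrt t * sqrt t = t" using t by simp
          then have "t * (xi a * xi a) = yy * yy" by (simp add: yy_def mult_ac)
          moreover have "t * xi a \<le> yy"
          proof -
            have "t \<le> sqrt t" using t by (intro real_le_rsqrt) (simp add: power2_eq_square mult_left_le_one_le)
            then show ?thesis by (simp add: yy_def mult_right_mono xi_nonneg)
          qed
          then have "t * xi a * (sqrt 2 * d) \<le> yy * (sqrt 2 * d)"
            using d_nonneg by (intro mult_right_mono) auto
          ultimately show "t * (xi a * (xi a + sqrt 2 * d)) \<le> yy * yy + yy * (sqrt 2 * d)"
            by (simp add: algebra_simps)
        qed (use sm(2)[OF tt] yy in \<open>auto simp: L_def\<close>)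
        also have "\<dots> = yy * (2 * drift_const + 2 * L + yy + sqrt 2 * d)" by (simp add: algebra_simps)
        also have "\<dots> \<le> yy * Q" using True yy width_ge_1 by (intro mult_left_mono) (auto simp: Q_def)
        finally have "- ln (w a) \<le> yy * Q" .
        moreover have "ln (w a) \<le> w a - 1" using wp by (intro ln_le_minus_one)
        ultimately show ?thesis using profile_drop_bounds(1)[of t a] t by (simp add: F_def mult.commute)
      next
        case False
        then have "1 * 1 \<le> Q * yy" using Q by (intro mult_mono) auto
        then show ?thesis using F1 by simp
      qed
      have "(1 - profile_drop a t) * yy \<le> width"
      proof -
        have "yy / width \<le> sqrt (1 + t * (xi a)\<^sup>2 / width\<^sup>2)"
          using t by (intro real_le_rsqrt) (simp add: yy_def power_mult_distrib power_divide)
        moreover have "sqrt (1 + t * (xi a)\<^sup>2 / width\<^sup>2) > 0" using t by (simp add: add_pos_nonneg)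
        ultimately show ?thesis using width_ge_1 by (simp add: profile_drop_def divide_le_eq mult.commute)
      qed
      moreover have "F * yy \<le> (1 - profile_drop a t) * yy" using wp yy by (intro mult_right_mono) (auto simp: F_def)
      ultimately have F3: "F * yy \<le> Q" using Q by linarith
      have "t * Y' a t = yy * (Q\<^sup>2 - 1) / ((1 + Q * yy) * (Q + yy))" using t by (simp add: Y'_def yy_def)
      then show ?thesis using scale_window[OF Q(1) yy F1 F2 F3] by (simp add: F_def)
    qed
    have "t * z' t = - (\<Sum>a\<in>R. kap a * profile_drop a t) - t * log_u_deriv e t - t * (\<Sum>a\<in>R. kap a * (16 / 3 * Y' a t))"
      using t by (simp add: z'_def algebra_simps)
    also have "t * log_u_deriv e t = - (\<Sum>a\<in>R. kap a * (1 - w a))"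
      using t by (simp add: log_u_deriv_def e w_def del: comp_apply)
    also have "t * (\<Sum>a\<in>R. kap a * (16 / 3 * Y' a t)) = (\<Sum>a\<in>R. kap a * (16 / 3 * (t * Y' a t)))"
      by (simp add: sum_distrib_left mult_ac)
    also have "- (\<Sum>a\<in>R. kap a * profile_drop a t) - - (\<Sum>a\<in>R. kap a * (1 - w a)) = (\<Sum>a\<in>R. kap a * (1 - profile_drop a t - w a))"
      by (simp add: right_diff_distrib sum_subtractf)
    finally have "t * z' t \<le> 0" using sum_kap_mono[OF le] by simp
    then show "z' t \<le> 0 * z t" using t by (simp add: mult_le_0_iff)
  qed (use sm in auto)
  then have zsm: "z sm \<le> 0" .
  have "L \<le> K + 64 / 3 * K * ln Q"
  proof -
    have "Y a sm \<le> 4 * ln Q" for a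
    proof -
      have p: "1 + Q * (sqrt sm * xi a) > 0" "Q + sqrt sm * xi a > 0" using pos sm by auto
      have "1 + Q * (sqrt sm * xi a) \<le> Q * (Q + sqrt sm * xi a)"
        using Q mult_mono[of 1 Q 1 Q] by (simp add: algebra_simps)
      then have "ln (1 + Q * (sqrt sm * xi a)) \<le> ln (Q * (Q + sqrt sm * xi a))" using p by (intro ln_mono) auto
      also have "\<dots> = ln Q + ln (Q + sqrt sm * xi a)" using Q p by (intro ln_mult_pos) auto
      finally show ?thesis by (simp add: Y_def)
    qed
    then have "(\<Sum>a\<in>R. kap a * (16 / 3 * Y a sm)) \<le> (\<Sum>a\<in>R. kap a * (16 / 3 * (4 * ln Q)))"
      by (intro sum_kap_mono) auto
    also have "\<dots> = K * (16 / 3 * (4 * ln Q))" by (rule sum_kap_const)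
    finally have "(\<Sum>a\<in>R. kap a * (16 / 3 * Y a sm)) \<le> 64 / 3 * K * ln Q" by simp
    moreover have "K * sm \<le> K" using sm K_nonneg by (simp add: mult_left_le)
    ultimately show ?thesis using zsm by (simp add: z_def L_def)
  qed
  then have "L \<le> 2 * K + 1 + 2 * (64 / 3 * K) * ln (4 * (64 / 3 * K + 1))
    + 2 * (64 / 3 * K) * ln (width + 2 * drift_const + sqrt 2 * d + 1)"
    using L K_nonneg width_ge_1 d_nonneg
    by (intro log_bootstrap) (auto simp: Q_def drift_const_def)
  then show ?thesis using sm(2)[OF s] by (simp add: L_def)
qed

end

section \<open>Summation over paths\<close>

locale path_system = orbit_system R k x y u for R :: "(real ^ 'n) set" and k x y u +
  fixes Rp :: "(real ^ 'n) set"
  assumes Rp: "R = Rp \<union> uminus ` Rp"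
begin

text \<open>Each letter is weighted by the point it leaves, so the end point of the path carries no
  factor. The parameter r will be a running time.\<close>

primrec path_weight :: "real \<Rightarrow> (real ^ 'n) list \<Rightarrow> (real ^ 'n \<Rightarrow> real ^ 'n) \<Rightarrow> real" where
  "path_weight r [] h = 1"
| "path_weight r (a # as) h = 1 / (1 + r * b h) * path_weight r as (root_reflection a \<circ> h)"

definition short_seqs :: "(real ^ 'n) list set"
  where "short_seqs = {as. set as \<subseteq> Rp \<and> length as \<le> 2 * card G}"
definition Admissible :: "(real ^ 'n \<Rightarrow> real ^ 'n) \<Rightarrow> (real ^ 'n) list set"
  where "Admissible h = {as \<in> short_seqs. b (seq_reflection as \<circ> h) = 0}"
definition path_sum :: "real \<Rightarrow> (real ^ 'n \<Rightarrow> real ^ 'n) \<Rightarrow> real"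
  where "path_sum r h = (\<Sum>as\<in>Admissible h. path_weight r as h)"

lemma Rp_sub: "Rp \<subseteq> R" using Rp by auto

lemma Rp_rep: "a \<in> R \<Longrightarrow> \<exists>a'\<in>Rp. root_reflection a' = root_reflection a"
  using Rp refl_uminus by (metis Un_iff image_iff)

lemma finite_short_seqs: "finite short_seqs"
proof -
  have "finite Rp" using Rp_sub finR finite_subset by blast
  then show ?thesis using finite_lists_length_le[of Rp "2 * card G"] by (simp add: short_seqs_def)
qed

lemma finite_Admissible: "finite (Admissible h)"
  using finite_short_seqs by (auto simp: Admissible_def)

lemma AdmissibleD: "as \<in> Admissible h \<Longrightarrow> set as \<subseteq> Rp \<and> length as \<le> 2 * card G \<and> b (seq_reflection as \<circ> h) = 0"
  by (simp add: Admissible_def short_seqs_def)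

lemma refl_comp_G: "a \<in> Rp \<Longrightarrow> h \<in> G \<Longrightarrow> root_reflection a \<circ> h \<in> G"
  using Rp_sub by auto

lemma seq_comp_G: "set as \<subseteq> Rp \<Longrightarrow> h \<in> G \<Longrightarrow> seq_reflection as \<circ> h \<in> G"
  using Rp_sub by (intro comp_in_G seq_in_G) auto

lemma path_weight_bounds:
  assumes "set as \<subseteq> Rp" "h \<in> G" "r \<ge> 0"
  shows "0 < path_weight r as h \<and> path_weight r as h \<le> 1"
  using assms(1,2)
proof (induction as arbitrary: h)
  case (Cons a as)
  have IH: "0 < path_weight r as (root_reflection a \<circ> h)" "path_weight r as (root_reflection a \<circ> h) \<le> 1"
    using Cons.IH[OF _ refl_comp_G, of a h] Cons.prems by (simp_all del: comp_apply)
  have "r * b h \<ge> 0" using b_nonneg Cons.prems assms(3) by simp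
  then have "0 < 1 / (1 + r * b h)" "1 / (1 + r * b h) \<le> 1" by auto
  then show ?case using IH by (simp add: mult_le_one del: comp_apply)
qed simp

lemma path_weight_append: "path_weight r (as @ bs) h = path_weight r as h * path_weight r bs (seq_reflection as \<circ> h)"
  by (induction as arbitrary: h) (simp_all add: comp_assoc del: comp_apply)

lemma path_sum_ge: "as \<in> Admissible h \<Longrightarrow> h \<in> G \<Longrightarrow> r \<ge> 0 \<Longrightarrow> path_weight r as h \<le> path_sum r h"
  unfolding path_sum_def using finite_Admissible AdmissibleD path_weight_bounds by (intro member_le_sum) (auto intro: less_imp_le)

text \<open>Cutting a loop out of a path can only increase its weight.\<close>

lemma loop_erasure:
  assumes "h \<in> G" "r \<ge> 0"
  shows "set as \<subseteq> Rp \<Longrightarrow> b (seq_reflection as \<circ> h) = 0 \<Longrightarrow> \<exists>bs\<in>Admissible h. path_weight r as h \<le> path_weight r bs h"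
proof (induction "length as" arbitrary: as rule: less_induct)
  case less
  show ?case
  proof (cases "length as \<le> 2 * card G")
    case True
    then show ?thesis using less.prems by (intro bexI[of _ as]) (auto simp: Admissible_def short_seqs_def)
  next
    case False
    define v where "v = (\<lambda>j. seq_reflection (take j as) \<circ> h)"
    have vG: "v j \<in> G" for j
      unfolding v_def using less.prems assms set_take_subset[of j as] by (intro seq_comp_G) auto
    have "\<not> inj_on v {0..card G}"
    proof
      assume "inj_on v {0..card G}"
      then have "card {0..card G} \<le> card G" using vG by (intro card_inj_on_le) auto
      then show False by simp
    qed
    then obtain i j where ij: "i < j" "j \<le> card G" "v i = v j"
      unfolding inj_on_def by (metis atLeastAtMost_iff linorder_neqE_nat)
    define bs where "bs = take i as @ drop j as"
    define mid where "mid = take (j - i) (drop i as)"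
    have tj: "take j as = take i as @ mid"
      using ij by (simp add: mid_def take_add[symmetric])
    then have as: "as = take i as @ mid @ drop j as" by (metis append.assoc append_take_drop_id)
    have sub: "set (take i as) \<subseteq> Rp" "set mid \<subseteq> Rp" "set (drop j as) \<subseteq> Rp"
      using less.prems(1) as by (metis Un_subset_iff set_append)+
    have len: "length bs < length as" using ij False by (simp add: bs_def)
    have "seq_reflection bs \<circ> h = seq_reflection (drop j as) \<circ> v i" by (simp add: bs_def v_def comp_assoc)
    also have "\<dots> = seq_reflection (drop j as) \<circ> v j" using ij(3) by simp
    also have "\<dots> = seq_reflection as \<circ> h"
      using seq_reflection_simps(3)[of "take j as" "drop j as"] by (simp add: v_def comp_assoc)
    finally have "b (seq_reflection bs \<circ> h) = 0" using less.prems(2) by simp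
    then obtain cs where cs: "cs \<in> Admissible h" "path_weight r bs h \<le> path_weight r cs h"
      using less.hyps[OF len] sub by (auto simp: bs_def)
    have "path_weight r as h = path_weight r (take i as) h * (path_weight r mid (v i) * path_weight r (drop j as) (v j))"
      by (subst as, simp only: path_weight_append) (simp add: v_def tj comp_assoc del: comp_apply)
    also have "\<dots> \<le> path_weight r (take i as) h * (1 * path_weight r (drop j as) (v j))"
      using path_weight_bounds[OF sub(1) assms] path_weight_bounds[OF sub(2) vG assms(2)] path_weight_bounds[OF sub(3) vG assms(2)]
      by (intro mult_left_mono mult_right_mono) (auto intro: less_imp_le)
    also have "\<dots> = path_weight r bs h" by (simp add: bs_def path_weight_append ij(3)[symmetric]) (simp add: v_def)
    finally show ?thesis using cs by (intro bexI[of _ cs]) auto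
  qed
qed

text \<open>While b is positive some reflection lowers it, by \<open>b_zeroI\<close>. Along such a
  path b never exceeds its initial value, which bounds each factor from below, and no value of b
  recurs, which bounds the length.\<close>

lemma descending_path:
  assumes "r \<ge> 0"
  shows "h \<in> G \<Longrightarrow> \<exists>as. set as \<subseteq> Rp \<and> b (seq_reflection as \<circ> h) = 0 \<and>
    length as \<le> card {g\<in>G. b g < b h} \<and> (1 / (1 + r * b h)) ^ length as \<le> path_weight r as h"
proof (induction "card {g\<in>G. b g < b h}" arbitrary: h rule: less_induct)
  case less
  show ?case
  proof (cases "b h = 0")
    case True
    then show ?thesis by (intro exI[of _ "[]"]) (simp add: comp_def)
  next
    case False
    then obtain a where a: "a \<in> R" "b (root_reflection a \<circ> h) < b h"
      using b_zeroI[OF less.prems] by (meson not_le)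
    obtain a' where a': "a' \<in> Rp" "root_reflection a' = root_reflection a" using Rp_rep[OF a(1)] by auto
    define h' where "h' = root_reflection a' \<circ> h"
    have h': "h' \<in> G" "b h' < b h" using a a' less.prems refl_comp_G by (auto simp: h'_def)
    have lt: "card {g\<in>G. b g < b h'} < card {g\<in>G. b g < b h}"
      using h' by (intro psubset_card_mono) auto
    obtain as where as: "set as \<subseteq> Rp" "b (seq_reflection as \<circ> h') = 0"
      "length as \<le> card {g\<in>G. b g < b h'}" "(1 / (1 + r * b h')) ^ length as \<le> path_weight r as h'"
      using less.hyps[OF lt h'(1)] by auto
    have r: "r * b h' \<le> r * b h" "r * b h' \<ge> 0" using h' assms b_nonneg by (auto intro: mult_left_mono)
    have "(1 / (1 + r * b h)) ^ length as \<le> (1 / (1 + r * b h')) ^ length as"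
      using r by (intro power_mono divide_left_mono) auto
    then have "1 / (1 + r * b h) * (1 / (1 + r * b h)) ^ length as \<le> 1 / (1 + r * b h) * path_weight r as h'"
      using as(4) r by (intro mult_left_mono) auto
    then show ?thesis using as lt a'
      by (intro exI[of _ "a' # as"]) (auto simp: h'_def comp_assoc simp del: comp_apply)
  qed
qed

lemma path_sum_lower:
  assumes "h \<in> G" "r \<ge> 0"
  shows "(1 / (1 + r * b h)) ^ card G \<le> path_sum r h"
proof -
  obtain as where as: "set as \<subseteq> Rp" "b (seq_reflection as \<circ> h) = 0"
      "length as \<le> card {g\<in>G. b g < b h}" "(1 / (1 + r * b h)) ^ length as \<le> path_weight r as h"
    using descending_path[OF assms(2,1)] by auto
  have "card {g\<in>G. b g < b h} \<le> card G" by (intro card_mono) auto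
  then have len: "length as \<le> card G" using as by simp
  then have "as \<in> Admissible h" using as by (simp add: Admissible_def short_seqs_def)
  then have "path_weight r as h \<le> path_sum r h" using assms by (rule path_sum_ge)
  moreover have "(1 / (1 + r * b h)) ^ card G \<le> (1 / (1 + r * b h)) ^ length as"
    using assms b_nonneg len by (intro power_decreasing) (auto simp: divide_le_eq add_pos_nonneg)
  ultimately show ?thesis using as by linarith
qed

lemma path_sum_nonneg: "h \<in> G \<Longrightarrow> r \<ge> 0 \<Longrightarrow> path_sum r h \<ge> 0"
  unfolding path_sum_def using AdmissibleD path_weight_bounds by (intro sum_nonneg) (auto intro: less_imp_le)

text \<open>A path from the neighbour becomes a path from h when the reflection is put in front, at
  the price of one factor 1 / (1 + r b h). The longer path may violate the length bound; erasing
  loops repairs this.\<close>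

lemma path_sum_neighbour:
  assumes a: "a \<in> R" and h: "h \<in> G" and r: "r \<ge> 0"
  shows "path_sum r (root_reflection a \<circ> h) \<le> real (card short_seqs) * ((1 + r * b h) * path_sum r h)"
proof -
  obtain a' where a': "a' \<in> Rp" "root_reflection a' = root_reflection a" using Rp_rep[OF a] by auto
  have pos: "1 + r * b h > 0" using b_nonneg[OF h] r by (simp add: add_pos_nonneg)
  have "path_weight r as (root_reflection a \<circ> h) \<le> (1 + r * b h) * path_sum r h" if as: "as \<in> Admissible (root_reflection a \<circ> h)" for as
  proof -
    have "\<exists>bs\<in>Admissible h. path_weight r (a' # as) h \<le> path_weight r bs h"
      using AdmissibleD[OF as] a' by (intro loop_erasure h r) (auto simp: comp_assoc simp del: comp_apply)
    then have "path_weight r (a' # as) h \<le> path_sum r h" using path_sum_ge[OF _ h r] by force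
    then have "1 / (1 + r * b h) * path_weight r as (root_reflection a \<circ> h) \<le> path_sum r h" by (simp add: a' del: comp_apply)
    then show ?thesis using pos by (simp add: divide_le_eq mult.commute del: comp_apply)
  qed
  then have "path_sum r (root_reflection a \<circ> h) \<le> real (card (Admissible (root_reflection a \<circ> h))) * ((1 + r * b h) * path_sum r h)"
    unfolding path_sum_def[of r "root_reflection a \<circ> h"] by (intro sum_bounded_above)
  also have "\<dots> \<le> real (card short_seqs) * ((1 + r * b h) * path_sum r h)"
    using pos path_sum_nonneg[OF h r] finite_short_seqs
    by (intro mult_right_mono of_nat_mono card_mono) (auto simp: Admissible_def)
  finally show ?thesis .
qed

text \<open>Each factor has logarithmic derivative - b / (1 + r b), and r b / (1 + r b) \<le> 1;
  hence r times the logarithmic derivative of a path weight is at least minus its length.\<close>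

lemma path_weight_deriv:
  assumes r: "r \<ge> 0"
  shows "set as \<subseteq> Rp \<Longrightarrow> h \<in> G \<Longrightarrow>
    \<exists>D. ((\<lambda>r. path_weight r as h) has_real_derivative D) (at r) \<and> r * D \<ge> - real (length as) * path_weight r as h"
proof (induction as arbitrary: h)
  case Nil
  show ?case by (intro exI[of _ 0]) simp
next
  case (Cons a as)
  have h': "root_reflection a \<circ> h \<in> G" using Cons.prems by (intro refl_comp_G) auto
  then obtain D where D: "((\<lambda>r. path_weight r as (root_reflection a \<circ> h)) has_real_derivative D) (at r)"
    "r * D \<ge> - real (length as) * path_weight r as (root_reflection a \<circ> h)"
    using Cons.IH Cons.prems by auto
  define P where "P = path_weight r as (root_reflection a \<circ> h)"
  have P: "P > 0" unfolding P_def using path_weight_bounds[OF _ h' r] Cons.prems by simp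
  define w where "w = 1 + r * b h"
  have w: "w \<ge> 1" using b_nonneg[OF Cons.prems(2)] r by (simp add: w_def)
  have i: "((\<lambda>r. inverse (1 + r * b h)) has_real_derivative - (inverse w * b h * inverse w)) (at r)"
    unfolding w_def by (rule DERIV_inverse') (use w in \<open>auto intro!: derivative_eq_intros simp: w_def\<close>)
  have "((\<lambda>r. inverse (1 + r * b h) * path_weight r as (root_reflection a \<circ> h)) has_real_derivative
      - (inverse w * b h * inverse w) * P + D * inverse w) (at r)"
    using DERIV_mult[OF i D(1)] by (simp add: P_def w_def)
  moreover have "r * (- (inverse w * b h * inverse w) * P + D * inverse w) \<ge> - real (length (a # as)) * (inverse w * P)"
  proof -
    have "r * b h * inverse w \<le> 1" using w by (simp add: w_def divide_le_eq flip: divide_inverse)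
    then have "(r * b h * inverse w) * (inverse w * P) \<le> 1 * (inverse w * P)"
      using w P by (intro mult_right_mono) auto
    moreover have "inverse w * (r * D) \<ge> inverse w * (- real (length as) * P)"
      using D(2) w unfolding P_def by (intro mult_left_mono) auto
    ultimately show ?thesis by (simp add: algebra_simps)
  qed
  ultimately show ?case
    by (intro exI[of _ "- (inverse w * b h * inverse w) * P + D * inverse w"])
      (simp add: P_def w_def divide_inverse del: comp_apply)
qed

lemma path_sum_deriv:
  assumes r: "r \<ge> 0" and h: "h \<in> G"
  shows "\<exists>D. ((\<lambda>r. path_sum r h) has_real_derivative D) (at r) \<and> r * D \<ge> - real (2 * card G) * path_sum r h"
proof -
  have "\<forall>as\<in>Admissible h. \<exists>D. ((\<lambda>r. path_weight r as h) has_real_derivative D) (at r) \<and> r * D \<ge> - real (length as) * path_weight r as h"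
    using path_weight_deriv[OF r _ h] AdmissibleD by blast
  then obtain D where D: "\<And>as. as \<in> Admissible h \<Longrightarrow> ((\<lambda>r. path_weight r as h) has_real_derivative D as) (at r)"
    "\<And>as. as \<in> Admissible h \<Longrightarrow> r * D as \<ge> - real (length as) * path_weight r as h"
    by metis
  have "- real (2 * card G) * path_weight r as h \<le> r * D as" if as: "as \<in> Admissible h" for as
  proof -
    have "real (length as) * path_weight r as h \<le> real (2 * card G) * path_weight r as h"
      using AdmissibleD[OF as] path_weight_bounds[OF _ h r, of as] by (intro mult_right_mono) auto
    then show ?thesis using D(2)[OF as] by simp
  qed
  then have "(\<Sum>as\<in>Admissible h. - real (2 * card G) * path_weight r as h) \<le> (\<Sum>as\<in>Admissible h. r * D as)"
    by (rule sum_mono)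
  then show ?thesis unfolding path_sum_def using D(1)
    by (intro exI[of _ "\<Sum>as\<in>Admissible h. D as"]) (auto simp: sum_distrib_left intro!: DERIV_sum)
qed

text \<open>On [1/2, 1] the rates 1 / s are at most 2, and \<open>path_sum_neighbour\<close> bounds
  each neighbour by \<open>card short_seqs\<close> times (1 + q) times the path sum. During a time
  t0 the reflection terms then amount to at most (1 + q) / 2, which the decay q can beat.\<close>

definition t0 :: real where "t0 = 1 / (4 * K * real (card short_seqs) + 2)"
text \<open>If U0 times this constant times the path sum is less than U0, then
  \<open>path_sum_lower\<close> forces r b h > 4 |G| + 1, exactly what the final estimate in
  \<open>u_path_upper\<close> requires.\<close>

definition Cpath :: real where "Cpath = (4 * real (card G) + 2) ^ card G"

lemma t0_bounds: "0 < t0" "t0 \<le> 1 / 2" "2 * K * real (card short_seqs) * t0 \<le> 1 / 2"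
proof -
  define c where "c = K * real (card short_seqs)"
  have c: "c \<ge> 0" using K_nonneg by (simp add: c_def)
  have t: "t0 = 1 / (4 * c + 2)" by (simp add: t0_def c_def mult_ac)
  show "0 < t0" "t0 \<le> 1 / 2" using c by (auto simp: t intro!: divide_left_mono)
  have "2 * c * t0 \<le> 1 / 2" using c by (simp add: t divide_simps)
  then show "2 * K * real (card short_seqs) * t0 \<le> 1 / 2" by (simp add: c_def mult_ac)
qed

text \<open>On the short time interval \<open>[1 - t0, 1]\<close> the path sum, with running time \<open>s - (1 - t0)\<close> as its parameter,
  is a supersolution: where \<open>r b h\<close> is small the a priori bound \<open>U0\<close> suffices, and where it is large
  the decay rate \<open>b h\<close> dominates both the reflection terms and the derivative of the path sum.\<close>

lemma u_path_upper:
  assumes U0: "\<And>h s. h \<in> G \<Longrightarrow> 1 / 2 \<le> s \<Longrightarrow> s \<le> 1 \<Longrightarrow> u h s \<le> U0" and h: "h \<in> G"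
  shows "u h 1 \<le> U0 * Cpath * path_sum t0 h"
proof -
  note t0 = t0_bounds
  define s0 where "s0 = 1 - t0"
  have s0: "1 / 2 \<le> s0" "s0 < 1" "s0 > 0" using t0 by (auto simp: s0_def)
  have U0pos: "U0 > 0" using U0[OF h, of 1] u_pos[OF h, of 1] by simp
  have C1: "Cpath \<ge> 1" unfolding Cpath_def by (rule one_le_power) simp
  define M where "M = U0 * Cpath"
  have M: "M > 0" using U0pos C1 by (simp add: M_def)
  have "\<forall>h\<in>G. \<forall>r. r \<ge> 0 \<longrightarrow> (\<exists>D. ((\<lambda>r. path_sum r h) has_real_derivative D) (at r) \<and> r * D \<ge> - real (2 * card G) * path_sum r h)"
    using path_sum_deriv by blast
  then obtain D where D: "\<And>h r. h \<in> G \<Longrightarrow> r \<ge> 0 \<Longrightarrow> ((\<lambda>r. path_sum r h) has_real_derivative D h r) (at r)"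
    "\<And>h r. h \<in> G \<Longrightarrow> r \<ge> 0 \<Longrightarrow> r * D h r \<ge> - real (2 * card G) * path_sum r h"
    by metis
  define z where "z = (\<lambda>h s. u h s - M * path_sum (s - s0) h)"
  define z' where "z' = (\<lambda>h s. (- b h * u h s - (\<Sum>a\<in>R. kap a * (u h s - u (root_reflection a \<circ> h) s)) / s) - M * D h (s - s0))"
  have "z h 1 \<le> 0"
  proof (rule max_principle[where I = G and C = 0 and z = z and z' = z' and a = s0 and b = 1])
    fix g assume g: "g \<in> G"
    have Lder: "((\<lambda>s. path_sum (s - s0) g) has_real_derivative D g (s - s0)) (at s)" if "s \<ge> s0" for s
      using DERIV_chain2[where f = "\<lambda>r. path_sum r g" and g = "\<lambda>s. s - s0", OF D(1)[OF g, of "s - s0"] DERIV_diff[OF DERIV_ident DERIV_const]] that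
      by simp
    have "continuous_on {s0..1} (\<lambda>s. path_sum (s - s0) g)"
      using Lder by (intro DERIV_continuous_on[where D = "\<lambda>s. D g (s - s0)"]) (auto intro: has_field_derivative_at_within)
    moreover have "continuous_on {s0..1} (u g)"
      by (rule continuous_on_subset[OF ucont[OF g]]) (use s0 in auto)
    ultimately show "continuous_on {s0..1} (z g)" unfolding z_def by (intro continuous_intros)
    have "1 \<le> Cpath * path_sum 0 g"
      using path_sum_lower[OF g, of 0] C1 mult_mono[of 1 Cpath 1 "path_sum 0 g"] by simp
    then have "U0 * 1 \<le> U0 * (Cpath * path_sum 0 g)" using U0pos by (intro mult_left_mono) auto
    then show "z g s0 \<le> 0" using U0[OF g, of s0] s0 by (simp add: z_def M_def)
    fix s :: real assume s: "s0 < s" "s \<le> 1"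
    have spos: "s > 0" "s \<ge> 1 / 2" using s s0 by auto
    show "(z g has_real_derivative z' g s) (at s)"
      unfolding z_def z'_def using s
      by (intro DERIV_diff DERIV_cmult uder[OF g spos(1)] Lder) auto
    assume zpos: "z g s > 0" and max: "\<And>j. j \<in> G \<Longrightarrow> z j s \<le> z g s"
    define r where "r = s - s0"
    have r: "r > 0" "r \<le> t0" using s by (auto simp: r_def s0_def)
    define L where "L = path_sum r g"
    have L: "L \<ge> 0" unfolding L_def using path_sum_nonneg[OF g] r by simp
    define q where "q = r * b g"
    have q: "q \<ge> 0" using r b_nonneg[OF g] by (simp add: q_def)
    have uL: "u g s > M * L" using zpos by (simp add: z_def L_def r_def)
    have "U0 * (Cpath * L) < U0 * 1" using uL U0[OF g spos(2) s(2)] by (simp add: M_def mult_ac)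
    then have "Cpath * L < 1" using U0pos by (simp only: mult_less_cancel_left_pos)
    moreover have "Cpath * (1 / (1 + q)) ^ card G \<le> Cpath * L"
      using path_sum_lower[OF g, of r] r C1 unfolding L_def q_def by (intro mult_left_mono) auto
    ultimately have "((4 * real (card G) + 2) / (1 + q)) ^ card G < 1"
      by (simp add: Cpath_def power_divide)
    then have "(4 * real (card G) + 2) / (1 + q) < 1"
      using one_le_power[of "(4 * real (card G) + 2) / (1 + q)" "card G"] by linarith
    then have qbig: "q > 2 * real (2 * card G) + 1" using q by (simp add: divide_less_eq)
    have ub: "u (root_reflection a \<circ> g) s - u g s \<le> M * (real (card short_seqs) * ((1 + q) * L))" if a: "a \<in> R" for a
    proof -
      have ag: "root_reflection a \<circ> g \<in> G" using a g by auto
      have "u (root_reflection a \<circ> g) s - u g s \<le> M * (path_sum r (root_reflection a \<circ> g) - L)"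
        using max[OF ag] by (simp add: z_def r_def L_def algebra_simps)
      also have "\<dots> \<le> M * (real (card short_seqs) * ((1 + q) * L))"
        using path_sum_neighbour[OF a g, of r] r M L unfolding q_def L_def by (intro mult_left_mono) auto
      finally show ?thesis .
    qed
    have "(\<Sum>a\<in>R. kap a * (u (root_reflection a \<circ> g) s - u g s)) \<le> (\<Sum>a\<in>R. kap a * (M * (real (card short_seqs) * ((1 + q) * L))))"
      using ub by (rule sum_kap_mono)
    also have "\<dots> = K * (M * (real (card short_seqs) * ((1 + q) * L)))" by (rule sum_kap_const)
    finally have S: "- (\<Sum>a\<in>R. kap a * (u g s - u (root_reflection a \<circ> g) s)) \<le> K * (M * (real (card short_seqs) * ((1 + q) * L)))"
      by (simp add: right_diff_distrib sum_subtractf)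
    have nn: "K * (M * (real (card short_seqs) * ((1 + q) * L))) \<ge> 0" using K_nonneg M q L by simp
    have "- (\<Sum>a\<in>R. kap a * (u g s - u (root_reflection a \<circ> g) s)) / s \<le> K * (M * (real (card short_seqs) * ((1 + q) * L))) / s"
      using S spos by (intro divide_right_mono) auto
    also have "\<dots> \<le> K * (M * (real (card short_seqs) * ((1 + q) * L))) / (1 / 2)"
      using nn spos by (intro divide_left_mono) auto
    finally have S2: "- (\<Sum>a\<in>R. kap a * (u g s - u (root_reflection a \<circ> g) s)) / s \<le> 2 * K * real (card short_seqs) * (M * L * (1 + q))"
      by (simp add: mult_ac)
    have "r * z' g s = - q * u g s + r * (- (\<Sum>a\<in>R. kap a * (u g s - u (root_reflection a \<circ> g) s)) / s) - M * (r * D g r)"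
      by (simp add: z'_def r_def[symmetric] q_def algebra_simps)
    also have "\<dots> \<le> - q * (M * L) + r * (2 * K * real (card short_seqs) * (M * L * (1 + q))) - M * (- real (2 * card G) * L)"
    proof (intro diff_mono add_mono)
      show "- q * u g s \<le> - q * (M * L)" using mult_left_mono[OF less_imp_le[OF uL] q] by simp
      show "r * (- (\<Sum>a\<in>R. kap a * (u g s - u (root_reflection a \<circ> g) s)) / s) \<le> r * (2 * K * real (card short_seqs) * (M * L * (1 + q)))"
        using S2 r by (intro mult_left_mono) auto
      have "- real (2 * card G) * L \<le> r * D g r" using D(2)[OF g, of r] r by (simp add: L_def)
      then show "M * (- real (2 * card G) * L) \<le> M * (r * D g r)" using M by (intro mult_left_mono) auto
    qed
    also have "r * (2 * K * real (card short_seqs) * (M * L * (1 + q))) = (2 * K * real (card short_seqs) * r) * (M * L * (1 + q))"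
      by (simp add: mult_ac)
    also have "\<dots> \<le> 1 / 2 * (M * L * (1 + q))"
    proof (intro mult_right_mono)
      have "2 * K * real (card short_seqs) * r \<le> 2 * K * real (card short_seqs) * t0"
        using r K_nonneg by (intro mult_left_mono) auto
      then show "2 * K * real (card short_seqs) * r \<le> 1 / 2" using t0(3) by linarith
    qed (use M L q in auto)
    also have "- q * (M * L) + 1 / 2 * (M * L * (1 + q)) - M * (- real (2 * card G) * L)
      = (M * L) * (1 / 2 + real (2 * card G) - q / 2)" by (simp add: algebra_simps)
    also have "\<dots> \<le> 0" using qbig M L by (intro mult_nonneg_nonpos) auto
    finally show "z' g s \<le> 0 * z g s" using r by (simp add: mult_le_0_iff)
  qed (use h s0 in auto)
  then show ?thesis by (simp add: z_def M_def s0_def)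
qed

text \<open>For r \<le> 1 one has r (1 + b) \<le> 1 + r b, so replacing the parameter r by 1 costs a
  factor 1 / r per letter.\<close>

lemma path_weight_rescale:
  assumes "0 < r" "r \<le> 1"
  shows "set as \<subseteq> Rp \<Longrightarrow> h \<in> G \<Longrightarrow> path_weight r as h \<le> (1 / r) ^ length as * path_weight 1 as h"
proof (induction as arbitrary: h)
  case (Cons a as)
  have h': "root_reflection a \<circ> h \<in> G" using Cons.prems by (intro refl_comp_G) auto
  have bn: "b h \<ge> 0" using b_nonneg Cons.prems by simp
  have "r * (1 + b h) \<le> 1 + r * b h" using assms by (simp add: algebra_simps)
  then have "1 / (1 + r * b h) \<le> 1 / (r * (1 + b h))"
    using assms bn by (intro divide_left_mono mult_pos_pos add_pos_nonneg) auto
  then have "1 / (1 + r * b h) * path_weight r as (root_reflection a \<circ> h) \<le>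
      1 / (r * (1 + b h)) * ((1 / r) ^ length as * path_weight 1 as (root_reflection a \<circ> h))"
    using Cons.IH[OF _ h'] Cons.prems path_weight_bounds[OF _ h', of as r] assms bn
    by (intro mult_mono) (auto intro: less_imp_le simp del: comp_apply)
  then show ?case by (simp add: mult_ac del: comp_apply)
qed simp

lemma path_sum_rescale:
  assumes h: "h \<in> G"
  shows "path_sum t0 h \<le> (1 / t0) ^ (2 * card G) * path_sum 1 h"
  unfolding path_sum_def sum_distrib_left
proof (rule sum_mono)
  fix as assume as: "as \<in> Admissible h"
  have "path_weight t0 as h \<le> (1 / t0) ^ length as * path_weight 1 as h"
    using path_weight_rescale[of t0] t0_bounds AdmissibleD[OF as] h by auto
  also have "\<dots> \<le> (1 / t0) ^ (2 * card G) * path_weight 1 as h"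
    using AdmissibleD[OF as] t0_bounds path_weight_bounds[OF _ h, of as 1]
    by (intro mult_right_mono power_increasing) (auto simp: le_divide_eq)
  finally show "path_weight t0 as h \<le> (1 / t0) ^ (2 * card G) * path_weight 1 as h" .
qed

subsection \<open>Lower bound\<close>

text \<open>The inflow from the single neighbour is at least c and the loss rate at most be, so any
  function starting from 0 with l' \<le> c - be l lies below u_h on [s/2, s].\<close>

lemma u_step_lower:
  assumes a: "a \<in> R" and h: "h \<in> G" and s: "0 < s" "s \<le> 1" and I: "I \<ge> 0"
    and nb: "\<And>t. s / 2 \<le> t \<Longrightarrow> t \<le> s \<Longrightarrow> u (root_reflection a \<circ> h) t \<ge> I"
  shows "u h s \<ge> kap a / (2 * (1 + K)) * (1 / (1 + b h)) * I"
proof -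
  define c where "c = kap a * I / s"
  \<comment> \<open>The outflow coefficient K / t is at most 2 K / s for t in [s/2, s].\<close>
  define be where "be = b h + 2 * K / s"
  have c: "c \<ge> 0" using kap_nonneg[OF a] I s by (simp add: c_def)
  have bn: "b h \<ge> 0" using b_nonneg[OF h] .
  have be: "be \<ge> 0" using bn K_nonneg s by (simp add: be_def)
  \<comment> \<open>A rational stand-in for c (1 - exp (- be \<tau>)) / be with \<tau> = t - s/2;
    its derivative c / (1 + be \<tau>)^2 is below c - be l = c / (1 + be \<tau>).\<close>
  define l where "l = (\<lambda>t. c * (t - s / 2) / (1 + be * (t - s / 2)))"
  define z where "z = (\<lambda>(_::unit) t. l t - u h t)"
  define z' where "z' = (\<lambda>(_::unit) t. c / (1 + be * (t - s / 2))\<^sup>2 - (- b h * u h t - (\<Sum>g\<in>R. kap g * (u h t - u (root_reflection g \<circ> h) t)) / t))"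
  have pos: "1 + be * (t - s / 2) > 0" if "t \<ge> s / 2" for t
    using be that by (intro add_pos_nonneg) auto
  have lder: "(l has_real_derivative c / (1 + be * (t - s / 2))\<^sup>2) (at t)" if "t \<ge> s / 2" for t
  proof -
    define w where "w = 1 + be * (t - s / 2)"
    have w: "w > 0" using pos[OF that] by (simp add: w_def)
    have "(l has_real_derivative (c * w - c * (t - s / 2) * be) / (w * w)) (at t)"
      unfolding l_def w_def
      by (rule DERIV_divide) (use w in \<open>auto intro!: derivative_eq_intros simp: w_def\<close>)
    also have "c * w - c * (t - s / 2) * be = c" by (simp add: w_def algebra_simps)
    finally show ?thesis by (simp add: w_def power2_eq_square)
  qed
  have "z () s \<le> 0"
  proof (rule max_principle[where I = "{()}" and C = 0 and z = z and z' = z' and a = "s / 2" and b = s])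
    have "continuous_on {s/2..s} l"
      using lder by (intro DERIV_continuous_on[where D = "\<lambda>t. c / (1 + be * (t - s / 2))\<^sup>2"]) (auto intro: has_field_derivative_at_within)
    moreover have "continuous_on {s/2..s} (u h)"
      by (rule continuous_on_subset[OF ucont[OF h]]) (use s in auto)
    ultimately show "continuous_on {s/2..s} (z i)" for i unfolding z_def by (intro continuous_intros)
    show "z i (s / 2) \<le> 0" for i using u_pos[OF h, of "s / 2"] s by (simp add: z_def l_def)
    fix t assume t: "s / 2 < t" "t \<le> s"
    have t': "0 < t" "t \<le> 1" using t s by auto
    show "(z i has_real_derivative z' i t) (at t)" for i
      unfolding z_def z'_def using t by (intro DERIV_diff lder uder[OF h t']) auto
    fix i assume zp: "z i t > 0"
    define w where "w = be * (t - s / 2)"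
    have w: "w \<ge> 0" using be t by (simp add: w_def)
    have up: "u g t > 0" if "g \<in> G" for g using u_pos[OF that] t' by simp
    have "(\<Sum>g\<in>R. kap g * u (root_reflection g \<circ> h) t) \<ge> kap a * u (root_reflection a \<circ> h) t"
      using a h up by (intro member_le_sum mult_nonneg_nonneg kap_nonneg less_imp_le[OF up]) (auto simp del: comp_apply)
    moreover have "kap a * u (root_reflection a \<circ> h) t \<ge> kap a * I" using nb[of t] t kap_nonneg[OF a] by (intro mult_left_mono) auto
    ultimately have S: "(\<Sum>g\<in>R. kap g * (u h t - u (root_reflection g \<circ> h) t)) \<le> K * u h t - kap a * I"
      by (simp add: right_diff_distrib sum_subtractf sum_kap_const)
    have "(\<Sum>g\<in>R. kap g * (u h t - u (root_reflection g \<circ> h) t)) / t \<le> (K * u h t - kap a * I) / t"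
      using S t' by (intro divide_right_mono) auto
    also have "\<dots> = K / t * u h t - kap a * I / t" by (simp add: diff_divide_distrib)
    also have "\<dots> \<le> 2 * K / s * u h t - kap a * I / s"
    proof (intro diff_mono mult_right_mono)
      have "K / t \<le> K / (s / 2)" using t s K_nonneg by (intro divide_left_mono) auto
      then show "K / t \<le> 2 * K / s" by (simp add: mult.commute)
      show "kap a * I / s \<le> kap a * I / t" using t t' I kap_nonneg[OF a] s by (intro divide_left_mono) auto
    qed (use up[OF h] in auto)
    finally have "z' i t \<le> c / (1 + w)\<^sup>2 + be * u h t - c"
      by (simp add: z'_def w_def be_def c_def algebra_simps)
    also have "be * u h t \<le> be * l t" using zp be by (intro mult_left_mono) (auto simp: z_def)
    also have "be * l t = c * (w / (1 + w))" by (simp add: l_def w_def)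
    also have "c / (1 + w)\<^sup>2 + c * (w / (1 + w)) - c = c * (1 / (1 + w)\<^sup>2 - 1 / (1 + w))"
    proof -
      have i: "w / (1 + w) = 1 - 1 / (1 + w)" using w by (simp add: field_simps)
      show ?thesis unfolding i by (simp add: right_diff_distrib)
    qed
    also have "\<dots> \<le> 0"
    proof (rule mult_nonneg_nonpos[OF c])
      have "1 / (1 + w)\<^sup>2 \<le> 1 / (1 + w)" using w by (intro divide_left_mono) (auto simp: power2_eq_square)
      then show "1 / (1 + w)\<^sup>2 - 1 / (1 + w) \<le> 0" by simp
    qed
    finally show "z' i t \<le> 0 * z i t" by simp
  qed (use s in auto)
  then have "l s \<le> u h s" by (simp add: z_def)
  moreover have "kap a / (2 * (1 + K)) * (1 / (1 + b h)) * I \<le> l s"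
  proof -
    have "s - s / 2 = s / 2" by simp
    then have "l s = (c * s / 2) / (1 + be * s / 2)" by (simp only: l_def times_divide_eq_right)
    also have "c * s / 2 = kap a * I / 2" using s by (simp add: c_def)
    also have "1 + be * s / 2 = 1 + b h * s / 2 + K" using s by (simp add: be_def field_simps)
    finally have l: "l s = kap a * I / 2 / (1 + b h * s / 2 + K)" .
    have "b h * s / 2 \<le> b h" using bn s mult_left_le[of s "b h"] by linarith
    then have "1 + b h * s / 2 + K \<le> (1 + K) * (1 + b h)"
    proof -
      have "(1 + K) * (1 + b h) = 1 + b h + K + K * b h" by (simp add: algebra_simps)
      then show ?thesis using \<open>b h * s / 2 \<le> b h\<close> mult_nonneg_nonneg[OF K_nonneg bn] by linarith
    qed
    then have "kap a * I / 2 / ((1 + K) * (1 + b h)) \<le> l s"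
      unfolding l using kap_nonneg[OF a] I K_nonneg bn s
      by (intro divide_left_mono mult_pos_pos add_pos_nonneg add_nonneg_pos) auto
    then show ?thesis by (simp add: field_simps)
  qed
  ultimately show ?thesis by linarith
qed

text \<open>The path is followed backwards from its nearest point. A bound at time s uses the bound
  for the next point on all of [s/2, s], so each letter halves the available time; this is the
  origin of the power of 2.\<close>

lemma u_path_lower:
  assumes c0: "c0 > 0" "\<And>a. a \<in> R \<Longrightarrow> c0 \<le> kap a / (2 * (1 + K))"
    and m: "m \<ge> 0" and s0: "s0 > 0"
    and low: "\<And>e t. e \<in> G \<Longrightarrow> b e = 0 \<Longrightarrow> s0 \<le> t \<Longrightarrow> t \<le> 1 \<Longrightarrow> m \<le> u e t"
  shows "set as \<subseteq> Rp \<Longrightarrow> h \<in> G \<Longrightarrow> b (seq_reflection as \<circ> h) = 0 \<Longrightarrow>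
    2 ^ length as * s0 \<le> s \<Longrightarrow> s \<le> 1 \<Longrightarrow> c0 ^ length as * m * path_weight 1 as h \<le> u h s"
proof (induction as arbitrary: h s)
  case Nil
  then show ?case using low[of h s] by (simp add: comp_def)
next
  case (Cons a as)
  have aR: "a \<in> R" "a \<in> Rp" using Cons.prems Rp_sub by auto
  have h': "root_reflection a \<circ> h \<in> G" using Cons.prems by (intro refl_comp_G) auto
  define I where "I = c0 ^ length as * m * path_weight 1 as (root_reflection a \<circ> h)"
  have pwp: "path_weight 1 as (root_reflection a \<circ> h) > 0" using path_weight_bounds[OF _ h', of as 1] Cons.prems by simp
  have I: "I \<ge> 0" using c0 m pwp by (simp add: I_def del: comp_apply)
  have s: "s > 0"
    using Cons.prems(4) s0 by (smt (verit) mult_pos_pos zero_less_power)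
  have "kap a / (2 * (1 + K)) * (1 / (1 + b h)) * I \<le> u h s"
  proof (rule u_step_lower[OF aR(1) Cons.prems(2) s Cons.prems(5) I])
    fix t assume t: "s / 2 \<le> t" "t \<le> s"
    show "I \<le> u (root_reflection a \<circ> h) t"
      unfolding I_def using Cons.prems t by (intro Cons.IH h') (auto simp: comp_assoc simp del: comp_apply)
  qed
  moreover have "c0 * (1 / (1 + b h)) * I \<le> kap a / (2 * (1 + K)) * (1 / (1 + b h)) * I"
    using c0(2)[OF aR(1)] I b_nonneg[OF Cons.prems(2)] by (intro mult_right_mono) auto
  ultimately show ?case by (simp add: I_def mult_ac del: comp_apply)
qed

end

section \<open>Commutativity of Dunkl operators\<close>

text \<open>Symmetry of the second derivative is carried along by the closure rules for sums,
  products and linear substitutions, instead of being deduced from continuity.\<close>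

definition smooth2 :: "(real ^ 'n \<Rightarrow> real) \<Rightarrow> bool" where
  "smooth2 F \<longleftrightarrow> (\<exists>F' F''. (\<forall>x. (F has_derivative F' x) (at x)) \<and>
     (\<forall>x h. ((\<lambda>z. F' z h) has_derivative (\<lambda>j. F'' x j h)) (at x)) \<and>
     (\<forall>x j h. F'' x j h = F'' x h j))"

lemma smooth2_const: "smooth2 (\<lambda>x. c)"
  unfolding smooth2_def
  by (intro exI[of _ "\<lambda>x h. 0"] exI[of _ "\<lambda>x j h. 0"]) auto

lemma smooth2_inner: "smooth2 (\<lambda>x. x \<bullet> v)"
  unfolding smooth2_def
  by (intro exI[of _ "\<lambda>x h. h \<bullet> v"] exI[of _ "\<lambda>x j h. 0"])
    (auto intro!: derivative_eq_intros)

lemma smooth2_add: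
  assumes "smooth2 F" "smooth2 H" shows "smooth2 (\<lambda>x. F x + H x)"
proof -
  obtain F' F'' where F: "\<And>x. (F has_derivative F' x) (at x)"
    "\<And>x h. ((\<lambda>z. F' z h) has_derivative (\<lambda>j. F'' x j h)) (at x)" "\<And>x j h. F'' x j h = F'' x h j"
    using assms(1) unfolding smooth2_def by metis
  obtain H' H'' where H: "\<And>x. (H has_derivative H' x) (at x)"
    "\<And>x h. ((\<lambda>z. H' z h) has_derivative (\<lambda>j. H'' x j h)) (at x)" "\<And>x j h. H'' x j h = H'' x h j"
    using assms(2) unfolding smooth2_def by metis
  show ?thesis unfolding smooth2_def
    by (intro exI[of _ "\<lambda>x h. F' x h + H' x h"] exI[of _ "\<lambda>x j h. F'' x j h + H'' x j h"] conjI allI has_derivative_add F(1,2) H(1,2))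
       (simp add: F(3) H(3))
qed

lemma smooth2_mult:
  assumes "smooth2 F" "smooth2 H" shows "smooth2 (\<lambda>x. F x * H x)"
proof -
  obtain F' F'' where F: "\<And>x. (F has_derivative F' x) (at x)"
    "\<And>x h. ((\<lambda>z. F' z h) has_derivative (\<lambda>j. F'' x j h)) (at x)" "\<And>x j h. F'' x j h = F'' x h j"
    using assms(1) unfolding smooth2_def by metis
  obtain H' H'' where H: "\<And>x. (H has_derivative H' x) (at x)"
    "\<And>x h. ((\<lambda>z. H' z h) has_derivative (\<lambda>j. H'' x j h)) (at x)" "\<And>x j h. H'' x j h = H'' x h j"
    using assms(2) unfolding smooth2_def by metis
  show ?thesis unfolding smooth2_def
    by (intro exI[of _ "\<lambda>x h. F x * H' x h + F' x h * H x"]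
        exI[of _ "\<lambda>x j h. (F x * H'' x j h + F' x j * H' x h) + (F' x h * H' x j + F'' x j h * H x)"]
        conjI allI has_derivative_add has_derivative_mult F(1,2) H(1,2))
       (simp add: F(3) H(3))
qed

lemma smooth2_compose_linear:
  assumes "smooth2 F" "linear g" shows "smooth2 (\<lambda>x. F (g x))"
proof -
  obtain F' F'' where F: "\<And>x. (F has_derivative F' x) (at x)"
    "\<And>x h. ((\<lambda>z. F' z h) has_derivative (\<lambda>j. F'' x j h)) (at x)" "\<And>x j h. F'' x j h = F'' x h j"
    using assms(1) unfolding smooth2_def by metis
  have g: "(g has_derivative g) (at x)" for x
    using assms(2) by (simp add: bounded_linear_imp_has_derivative linear_conv_bounded_linear)
  show ?thesis unfolding smooth2_def
    by (intro exI[of _ "\<lambda>x h. F' (g x) (g h)"] exI[of _ "\<lambda>x j h. F'' (g x) (g j) (g h)"] conjI allI)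
      (rule has_derivative_compose[OF g F(1)] has_derivative_compose[OF g F(2)] F(3))+
qed

lemma smooth2_sum:
  assumes "finite A" "\<And>a. a \<in> A \<Longrightarrow> smooth2 (F a)" shows "smooth2 (\<lambda>x. \<Sum>a\<in>A. F a x)"
  using assms by (induction A) (auto intro: smooth2_const smooth2_add)

section \<open>Pairs of reflections with a prescribed product\<close>

context dunkl
begin

definition wedge :: "real ^ 'n \<Rightarrow> real ^ 'n \<Rightarrow> real ^ 'n \<Rightarrow> real ^ 'n \<Rightarrow> real"
  where "wedge u v a b = (a \<bullet> u) * (b \<bullet> v) - (a \<bullet> v) * (b \<bullet> u)"

lemma wedge_swap: "wedge u v b a = - wedge u v a b"
  by (simp add: wedge_def algebra_simps)

lemma wedge_refl: "a \<in> R \<Longrightarrow> wedge u v a (root_reflection a b) = wedge u v a b"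
  by (simp add: wedge_def refl_eq inner_diff_left algebra_simps)

text \<open>The right side involves a and b only through the product of their reflections. Hence the
  quotient of two wedges with different u, v is the same for all pairs with that product.\<close>

lemma wedge_product:
  assumes "a \<in> R" "b \<in> R"
  shows "(a \<bullet> b) * wedge u v a b =
    u \<bullet> (root_reflection a \<circ> root_reflection b) v - v \<bullet> (root_reflection a \<circ> root_reflection b) u"
  using assms by (simp add: wedge_def refl_eq inner_diff_left inner_diff_right inner_commute algebra_simps)

definition pairs_of where
  "pairs_of W = {p \<in> R \<times> R. root_reflection (fst p) \<circ> root_reflection (snd p) = W}"

text \<open>Moving one reflection past the other replaces it by a conjugate and preserves the
  product. This permutation of the pairs turns second components into first ones.\<close>

lemma pairs_shift:
  "bij_betw (\<lambda>p. (root_reflection (fst p) (snd p), fst p)) (pairs_of W) (pairs_of W)"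
proof (rule bij_betwI[of _ _ _ "\<lambda>p. (snd p, root_reflection (snd p) (fst p))"])
  have c: "root_reflection (root_reflection a b) \<circ> root_reflection a = root_reflection a \<circ> root_reflection b"
    if "a \<in> R" "b \<in> R" for a b
    using G_conj[OF refl_in_G[OF that(1)] that(2)] by simp
  show "(\<lambda>p. (root_reflection (fst p) (snd p), fst p)) \<in> pairs_of W \<rightarrow> pairs_of W"
    using c by (auto simp: pairs_of_def simp del: comp_apply)
  have c': "root_reflection b \<circ> root_reflection (root_reflection b a) = root_reflection a \<circ> root_reflection b"
    if "a \<in> R" "b \<in> R" for a b
    using c[OF that(2) refl_root[OF that(2,1)]] that by (simp only: refl_refl)
  show "(\<lambda>p. (snd p, root_reflection (snd p) (fst p))) \<in> pairs_of W \<rightarrow> pairs_of W"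
    using c' by (auto simp: pairs_of_def simp del: comp_apply)
qed (auto simp: pairs_of_def)

text \<open>Dunkl's identity, the algebraic heart of commutativity. If the product is an involution,
  the sum is antisymmetric under exchanging a and b; otherwise every term is a difference of a
  quantity at a and at b, and the shift makes the sum telescope.\<close>

lemma pairs_sum_zero:
  assumes x: "regular x"
  shows "(\<Sum>p\<in>pairs_of W. kap (fst p) * kap (snd p) * (wedge u v (fst p) (snd p) / ((fst p \<bullet> x) * (snd p \<bullet> x)))) = 0"
    (is "(\<Sum>p\<in>_. ?f p) = 0")
proof (cases "\<exists>p\<in>pairs_of W. wedge u v (fst p) (snd p) \<noteq> 0")
  case False
  then show ?thesis by (intro sum.neutral) auto
next
  case True
  then obtain a0 b0 where ab0: "(a0, b0) \<in> pairs_of W" "wedge u v a0 b0 \<noteq> 0" by auto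
  have R0: "a0 \<in> R" "b0 \<in> R" "root_reflection a0 \<circ> root_reflection b0 = W" using ab0 by (auto simp: pairs_of_def)
  have inv: "root_reflection b \<circ> root_reflection a \<circ> (root_reflection a \<circ> root_reflection b) = id" if "a \<in> R" "b \<in> R" for a b
    using that by (auto simp: fun_eq_iff)
  show ?thesis
  proof (cases "W \<circ> W = id")
    \<comment> \<open>Here \<sigma>_b \<sigma>_a is the inverse of W and thus W itself, so
      exchanging the roots permutes the pairs while the wedge changes sign.\<close>
    case True
    have "(snd p, fst p) \<in> pairs_of W" if "p \<in> pairs_of W" for p
    proof -
      have ab: "fst p \<in> R" "snd p \<in> R" "root_reflection (fst p) \<circ> root_reflection (snd p) = W"
        using that by (auto simp: pairs_of_def)
      have "root_reflection (snd p) \<circ> root_reflection (fst p) = root_reflection (snd p) \<circ> root_reflection (fst p) \<circ> (W \<circ> W)"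
        using True by simp
      also have "\<dots> = (root_reflection (snd p) \<circ> root_reflection (fst p) \<circ> W) \<circ> W" by (simp only: comp_assoc)
      also have "\<dots> = W" using inv[OF ab(1,2)] ab(3) by simp
      finally show ?thesis using ab by (simp add: pairs_of_def)
    qed
    then have bij: "bij_betw prod.swap (pairs_of W) (pairs_of W)"
      by (intro bij_betwI[of _ _ _ prod.swap]) (auto simp: prod.swap_def)
    have "sum ?f (pairs_of W) = (\<Sum>p\<in>pairs_of W. ?f (prod.swap p))"
      by (rule sum.reindex_bij_betw[OF bij, symmetric])
    also have "\<dots> = (\<Sum>p\<in>pairs_of W. - ?f p)"
      by (intro sum.cong refl) (simp add: wedge_swap[of _ _ "snd _"] mult_ac)
    finally show ?thesis by (simp add: sum_negf)
  next
    case False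
    \<comment> \<open>The vector in the plane of a0 and b0 that is orthogonal to x. Its wedge with x
      takes the value z \<bullet> z on (a0, b0), so c1 below is nonzero and all wedges can be
      measured against it.\<close>
    define z where "z = (b0 \<bullet> x) *\<^sub>R a0 - (a0 \<bullet> x) *\<^sub>R b0"
    have nz: "a \<bullet> x \<noteq> 0" if "a \<in> R" for a using x that by (simp add: regular_def inner_commute)
    have "z \<noteq> 0"
    proof
      assume "z = 0"
      then have "(a0 \<bullet> x) *\<^sub>R b0 = (b0 \<bullet> x) *\<^sub>R a0" by (simp add: z_def)
      then have "b0 = ((b0 \<bullet> x) / (a0 \<bullet> x)) *\<^sub>R a0"
        using nz[OF R0(1)] by (metis divide_inverse_commute scaleR_scaleR vector_fraction_eq_iff eq_vector_fraction_iff)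
      then have "b0 = a0 \<or> b0 = - a0" using root_parallel R0 by blast
      then have "wedge u v a0 b0 = 0" by (auto simp: wedge_def)
      then show False using ab0 by simp
    qed
    have wz: "wedge z x a0 b0 = z \<bullet> z"
      by (simp add: wedge_def z_def inner_diff_left inner_diff_right inner_commute algebra_simps)
    have orth: "a \<bullet> b \<noteq> 0" if "a \<in> R" "b \<in> R" "root_reflection a \<circ> root_reflection b = W" for a b
    proof
      assume 0: "a \<bullet> b = 0"
      have "root_reflection a \<circ> root_reflection b = root_reflection b \<circ> root_reflection a"
        using that(1,2) 0 by (auto simp: fun_eq_iff refl_eq inner_diff_left inner_commute algebra_simps)
      then have "W \<circ> W = id" using inv[OF that(1,2)] that(3) by simp
      then show False using False by simp
    qed
    define c1 where "c1 = z \<bullet> W x - x \<bullet> W z"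
    define c2 where "c2 = u \<bullet> W v - v \<bullet> W u"
    have c1: "c1 \<noteq> 0"
    proof -
      have "c1 = (a0 \<bullet> b0) * (z \<bullet> z)" using wedge_product[OF R0(1,2), of z x] R0(3) wz by (simp only: c1_def)
      then show ?thesis using \<open>z \<noteq> 0\<close> orth[OF R0] by simp
    qed
    \<comment> \<open>Dividing the wedge of z and x by (a \<bullet> x)(b \<bullet> x) gives c a - c
      b, the form that telescopes under \<open>pairs_shift\<close>.\<close>
    define c where "c = (\<lambda>a. (a \<bullet> z) / (a \<bullet> x))"
    have f: "?f p = c2 / c1 * (kap (fst p) * kap (snd p) * c (fst p)) - c2 / c1 * (kap (fst p) * kap (snd p) * c (snd p))"
      if "p \<in> pairs_of W" for p
    proof -
      obtain a b where p: "p = (a, b)" by force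
      have ab: "a \<in> R" "b \<in> R" "root_reflection a \<circ> root_reflection b = W" using that p by (auto simp: pairs_of_def)
      have 1: "(a \<bullet> b) * wedge u v a b = c2" "(a \<bullet> b) * wedge z x a b = c1"
        using wedge_product[OF ab(1,2)] ab(3) by (simp_all add: c1_def c2_def)
      have "(a \<bullet> b) * (wedge u v a b * c1) = (a \<bullet> b) * (wedge z x a b * c2)"
        using 1 by (simp only: mult.assoc[symmetric]) (simp add: mult.commute)
      then have "wedge u v a b * c1 = wedge z x a b * c2" using orth[OF ab] by simp
      then have "wedge u v a b = c2 / c1 * wedge z x a b" using c1 by (simp add: field_simps)
      moreover have "wedge z x a b / ((a \<bullet> x) * (b \<bullet> x)) = c a - c b"
        using nz[OF ab(1)] nz[OF ab(2)] by (simp add: wedge_def c_def divide_simps)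
      ultimately have "wedge u v a b / ((a \<bullet> x) * (b \<bullet> x)) = c2 / c1 * (c a - c b)"
        by (metis times_divide_eq_right)
      then show ?thesis unfolding p fst_conv snd_conv by (simp only:) (simp add: algebra_simps)
    qed
    have "(\<Sum>p\<in>pairs_of W. c2 / c1 * (kap (fst p) * kap (snd p) * c (snd p))) =
      (\<Sum>p\<in>pairs_of W. c2 / c1 * (kap (root_reflection (fst p) (snd p)) * kap (fst p) * c (fst p)))"
      using sum.reindex_bij_betw[OF pairs_shift, of "\<lambda>p. c2 / c1 * (kap (fst p) * kap (snd p) * c (snd p))" W] by simp
    also have "\<dots> = (\<Sum>p\<in>pairs_of W. c2 / c1 * (kap (fst p) * kap (snd p) * c (fst p)))"
      by (intro sum.cong refl) (auto simp: pairs_of_def kap_G refl_in_G)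
    finally have "(\<Sum>p\<in>pairs_of W. c2 / c1 * (kap (fst p) * kap (snd p) * c (fst p))
       - c2 / c1 * (kap (fst p) * kap (snd p) * c (snd p))) = 0"
      by (simp only: sum_subtractf)
    then show ?thesis using f by (simp cong: sum.cong)
  qed
qed

lemma product_sum_zero:
  assumes x: "regular x"
  shows "(\<Sum>a\<in>R. \<Sum>b\<in>R. kap a * kap b * (wedge u v a b / ((a \<bullet> x) * (b \<bullet> x))) * H (root_reflection a \<circ> root_reflection b)) = 0"
proof -
  define f where "f = (\<lambda>p. kap (fst p) * kap (snd p) * (wedge u v (fst p) (snd p) / ((fst p \<bullet> x) * (snd p \<bullet> x))))"
  define W where "W = (\<lambda>p :: (real^'n) \<times> (real^'n). root_reflection (fst p) \<circ> root_reflection (snd p))"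
  have "(\<Sum>p\<in>R \<times> R. f p * H (W p)) = (\<Sum>w\<in>G. \<Sum>p\<in>{p\<in>R \<times> R. W p = w}. f p * H (W p))"
    by (rule sum.group[symmetric]) (auto simp: W_def intro!: comp_in_G refl_in_G)
  also have "\<dots> = (\<Sum>w\<in>G. (\<Sum>p\<in>pairs_of w. f p) * H w)"
    by (intro sum.cong refl) (simp add: pairs_of_def W_def sum_distrib_right)
  also have "\<dots> = 0" using pairs_sum_zero[OF x] by (simp add: f_def)
  finally show ?thesis
    by (simp add: sum.cartesian_product f_def W_def case_prod_unfold del: comp_apply)
qed

lemma sum_wedge_swap:
  "(\<Sum>a\<in>R. \<Sum>b\<in>R. kap a * kap b * (wedge u v a b / ((a \<bullet> x) * (b \<bullet> x))) * H a b) =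
   - (\<Sum>a\<in>R. \<Sum>b\<in>R. kap a * kap b * (wedge u v a b / ((a \<bullet> x) * (b \<bullet> x))) * H b a)"
proof -
  have "(\<Sum>a\<in>R. \<Sum>b\<in>R. kap a * kap b * (wedge u v a b / ((a \<bullet> x) * (b \<bullet> x))) * H a b) =
    (\<Sum>b\<in>R. \<Sum>a\<in>R. kap a * kap b * (wedge u v a b / ((a \<bullet> x) * (b \<bullet> x))) * H a b)"
    by (rule sum.swap)
  also have "\<dots> = (\<Sum>b\<in>R. \<Sum>a\<in>R. - (kap b * kap a * (wedge u v b a / ((b \<bullet> x) * (a \<bullet> x))) * H a b))"
    by (intro sum.cong refl) (simp add: wedge_swap[of u v _ _] mult_ac wedge_def diff_divide_distrib algebra_simps)
  finally show ?thesis by (simp add: sum_negf)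
qed

text \<open>For a root a, total division gives 0 on the hyperplane instead of the continuous
  extension; the commutation and eigenvalue identities are therefore stated at regular
  points.\<close>

definition refl_quot :: "real ^ 'n \<Rightarrow> (real ^ 'n \<Rightarrow> real) \<Rightarrow> real ^ 'n \<Rightarrow> real"
  where "refl_quot a F x = (F x - F (root_reflection a x)) / (a \<bullet> x)"

definition dunkl_op :: "(real ^ 'n \<Rightarrow> real ^ 'n \<Rightarrow> real) \<Rightarrow> (real ^ 'n \<Rightarrow> real) \<Rightarrow> real ^ 'n \<Rightarrow> real ^ 'n \<Rightarrow> real"
  where "dunkl_op F' F v x = F' x v + (\<Sum>a\<in>R. kap a * ((a \<bullet> v) * refl_quot a F x))"

definition dunkl_op_deriv where
  "dunkl_op_deriv F'' F' F v x u = F'' x u v + (\<Sum>a\<in>R. kap a * ((a \<bullet> v) *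
     ((F' x u - F' (root_reflection a x) (root_reflection a u)) / (a \<bullet> x)
      - (F x - F (root_reflection a x)) * (a \<bullet> u) / (a \<bullet> x)\<^sup>2)))"

lemma regular_refl: "regular x \<Longrightarrow> a \<in> R \<Longrightarrow> regular (root_reflection a x)"
  by (auto simp: regular_def inner_root_reflection)

lemma regular_G: "regular x \<Longrightarrow> g \<in> G \<Longrightarrow> regular (g x)"
  by (auto simp: regular_def) (metis G_inner G_inv_simps(2) G_root inv_in_G)

lemma dunkl_op_deriv:
  assumes F: "\<And>x. (F has_derivative F' x) (at x)"
    "\<And>x h. ((\<lambda>z. F' z h) has_derivative (\<lambda>j. F'' x j h)) (at x)"
    and x: "regular x"
  shows "(dunkl_op F' F v has_derivative dunkl_op_deriv F'' F' F v x) (at x)"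
  unfolding dunkl_op_def dunkl_op_deriv_def
proof (intro has_derivative_add F(2) has_derivative_sum)
  fix a assume a: "a \<in> R"
  have nz: "a \<bullet> x \<noteq> 0" using x a by (simp add: regular_def inner_commute)
  have lin: "(root_reflection a has_derivative root_reflection a) (at x)"
    using linear_refl[of a] by (simp add: bounded_linear_imp_has_derivative linear_conv_bounded_linear)
  have 1: "((\<lambda>x. F x - F (root_reflection a x)) has_derivative (\<lambda>h. F' x h - F' (root_reflection a x) (root_reflection a h))) (at x)"
    by (intro has_derivative_diff F(1) has_derivative_compose[OF lin F(1)])
  have 2: "((\<lambda>x. a \<bullet> x) has_derivative (\<lambda>h. a \<bullet> h)) (at x)" by (auto intro!: derivative_eq_intros)
  have "((\<lambda>x. (F x - F (root_reflection a x)) / (a \<bullet> x)) has_derivative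
    (\<lambda>h. ((F' x h - F' (root_reflection a x) (root_reflection a h)) * (a \<bullet> x)
      - (F x - F (root_reflection a x)) * (a \<bullet> h)) / ((a \<bullet> x) * (a \<bullet> x)))) (at x)"
    by (rule has_derivative_divide'[OF 1 2 nz])
  also have "(\<lambda>h. ((F' x h - F' (root_reflection a x) (root_reflection a h)) * (a \<bullet> x)
      - (F x - F (root_reflection a x)) * (a \<bullet> h)) / ((a \<bullet> x) * (a \<bullet> x)))
    = (\<lambda>u. (F' x u - F' (root_reflection a x) (root_reflection a u)) / (a \<bullet> x)
      - (F x - F (root_reflection a x)) * (a \<bullet> u) / (a \<bullet> x)\<^sup>2)"
    using nz by (simp add: fun_eq_iff diff_divide_distrib power2_eq_square)
  finally show "((\<lambda>x. kap a * ((a \<bullet> v) * refl_quot a F x)) has_derivative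
    (\<lambda>u. kap a * ((a \<bullet> v) * ((F' x u - F' (root_reflection a x) (root_reflection a u)) / (a \<bullet> x)
      - (F x - F (root_reflection a x)) * (a \<bullet> u) / (a \<bullet> x)\<^sup>2)))) (at x)"
    unfolding refl_quot_def by (intro has_derivative_mult_right)
qed

text \<open>Antisymmetrising in u and v produces the wedge, multiplied by four values of F. The
  value at x drops out by antisymmetry, the two singly reflected sums cancel, and the doubly
  reflected one vanishes by \<open>product_sum_zero\<close>.\<close>

lemma refl_quot_double_sum:
  assumes x: "regular x"
  shows "(\<Sum>a\<in>R. kap a * ((a \<bullet> u) * ((\<Sum>b\<in>R. kap b * ((b \<bullet> v) * refl_quot b F x))
      - (\<Sum>b\<in>R. kap b * ((b \<bullet> v) * refl_quot b F (root_reflection a x)))) / (a \<bullet> x)))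
    = (\<Sum>a\<in>R. kap a * ((a \<bullet> v) * ((\<Sum>b\<in>R. kap b * ((b \<bullet> u) * refl_quot b F x))
      - (\<Sum>b\<in>R. kap b * ((b \<bullet> u) * refl_quot b F (root_reflection a x)))) / (a \<bullet> x)))" (is "?S u v = ?S v u")
proof -
  define e where "e = (\<lambda>a b. kap a * kap b * (wedge u v a b / ((a \<bullet> x) * (b \<bullet> x))))"
  have nz: "a \<bullet> x \<noteq> 0" if "a \<in> R" for a using x that by (simp add: regular_def inner_commute)
  have S: "?S p q = (\<Sum>a\<in>R. \<Sum>b\<in>R. kap a * kap b * ((a \<bullet> p) * (b \<bullet> q)) / (a \<bullet> x) * (refl_quot b F x - refl_quot b F (root_reflection a x)))" for p q
    by (intro sum.cong refl)
      (simp add: sum_subtractf[symmetric] sum_distrib_left sum_divide_distrib right_diff_distrib[symmetric] mult_ac)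
  define X where "X = (\<lambda>p q. \<Sum>a\<in>R. \<Sum>b\<in>R. kap a * kap b * ((a \<bullet> p) * (b \<bullet> q)) / (a \<bullet> x) * (refl_quot b F x - refl_quot b F (root_reflection a x)))"
  have "?S u v - ?S v u = X u v - X v u" by (simp only: S X_def)
  also have "\<dots> = (\<Sum>a\<in>R. \<Sum>b\<in>R. kap a * kap b * wedge u v a b / (a \<bullet> x) * (refl_quot b F x - refl_quot b F (root_reflection a x)))"
    unfolding X_def sum_subtractf[symmetric]
    by (intro sum.cong refl) (simp add: wedge_def left_diff_distrib right_diff_distrib diff_divide_distrib mult_ac)
  also have "\<dots> = (\<Sum>a\<in>R. (\<Sum>b\<in>R. kap a * kap b * wedge u v a b / (a \<bullet> x) * refl_quot b F x)
      - (\<Sum>b\<in>R. kap a * kap b * wedge u v a b / (a \<bullet> x) * refl_quot b F (root_reflection a x)))"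
    by (simp only: right_diff_distrib sum_subtractf)
  also have "\<dots> = (\<Sum>a\<in>R. (\<Sum>b\<in>R. e a b * (F x - F (root_reflection b x)))
      - (\<Sum>b\<in>R. e a b * (F (root_reflection a x) - F (root_reflection a (root_reflection b x)))))"
  proof (rule sum.cong[OF refl])
    fix a assume a: "a \<in> R"
    have "(\<Sum>b\<in>R. kap a * kap b * wedge u v a b / (a \<bullet> x) * refl_quot b F x) = (\<Sum>b\<in>R. e a b * (F x - F (root_reflection b x)))"
      by (simp add: e_def refl_quot_def)
    moreover have "(\<Sum>b\<in>R. kap b * (kap a * wedge u v a b / (a \<bullet> x) * refl_quot b F (root_reflection a x)))
      = (\<Sum>b\<in>R. kap b * (kap a * wedge u v a (root_reflection a b) / (a \<bullet> x) * refl_quot (root_reflection a b) F (root_reflection a x)))"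
      using sum_kap_reindex[OF refl_in_G[OF a], of "\<lambda>b. kap a * wedge u v a b / (a \<bullet> x) * refl_quot b F (root_reflection a x)"] by simp
    moreover have "refl_quot (root_reflection a b) F (root_reflection a x) = (F (root_reflection a x) - F (root_reflection a (root_reflection b x))) / (b \<bullet> x)"
      if b: "b \<in> R" for b
    proof -
      have "root_reflection (root_reflection a b) (root_reflection a x) = root_reflection a (root_reflection b x)"
        using G_conj[OF refl_in_G[OF a] b] by (metis comp_apply)
      then show ?thesis using inner_refl_refl[OF a, of b x] by (simp add: refl_quot_def)
    qed
    ultimately show "(\<Sum>b\<in>R. kap a * kap b * wedge u v a b / (a \<bullet> x) * refl_quot b F x)
      - (\<Sum>b\<in>R. kap a * kap b * wedge u v a b / (a \<bullet> x) * refl_quot b F (root_reflection a x))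
      = (\<Sum>b\<in>R. e a b * (F x - F (root_reflection b x)))
      - (\<Sum>b\<in>R. e a b * (F (root_reflection a x) - F (root_reflection a (root_reflection b x))))"
      using a by (simp add: e_def wedge_refl mult_ac cong: sum.cong)
  qed
  also have "\<dots> = (\<Sum>a\<in>R. \<Sum>b\<in>R. e a b * F x) - (\<Sum>a\<in>R. \<Sum>b\<in>R. e a b * F (root_reflection b x))
     - (\<Sum>a\<in>R. \<Sum>b\<in>R. e a b * F (root_reflection a x)) + (\<Sum>a\<in>R. \<Sum>b\<in>R. e a b * F (root_reflection a (root_reflection b x)))"
    by (simp add: right_diff_distrib sum_subtractf)
  also have "(\<Sum>a\<in>R. \<Sum>b\<in>R. e a b * F x) = 0"
    using sum_wedge_swap[of u v x "\<lambda>_ _. F x"] by (simp add: e_def)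
  also have "(\<Sum>a\<in>R. \<Sum>b\<in>R. e a b * F (root_reflection a (root_reflection b x))) = 0"
    using product_sum_zero[OF x, of u v "\<lambda>w. F (w x)"] by (simp add: e_def)
  also have "(\<Sum>a\<in>R. \<Sum>b\<in>R. e a b * F (root_reflection b x)) = - (\<Sum>a\<in>R. \<Sum>b\<in>R. e a b * F (root_reflection a x))"
    using sum_wedge_swap[of u v x "\<lambda>a b. F (root_reflection b x)"] by (simp add: e_def)
  finally show ?thesis by simp
qed

text \<open>Each side is a composition of two Dunkl operators. Its second-order part is symmetric by
  hypothesis; its first-order part becomes so once the derivative at the reflected point is split
  along a; the pure differences are \<open>refl_quot_double_sum\<close>.\<close>

lemma dunkl_op_commute:
  assumes F: "\<And>x. (F has_derivative F' x) (at x)"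
    and sym: "\<And>x j h. F'' x j h = F'' x h j" and x: "regular x"
  shows "dunkl_op_deriv F'' F' F v x u + (\<Sum>a\<in>R. kap a * ((a \<bullet> u) * refl_quot a (dunkl_op F' F v) x)) =
    dunkl_op_deriv F'' F' F u x v + (\<Sum>a\<in>R. kap a * ((a \<bullet> v) * refl_quot a (dunkl_op F' F u) x))"
proof -
  have lin: "linear (F' z)" for z using F has_derivative_linear by blast
  have E: "dunkl_op_deriv F'' F' F q x p + (\<Sum>a\<in>R. kap a * ((a \<bullet> p) * refl_quot a (dunkl_op F' F q) x))
    = F'' x p q + (\<Sum>a\<in>R. kap a * (((a \<bullet> q) * ((F' x p - F' (root_reflection a x) (root_reflection a p)) / (a \<bullet> x)
      - (F x - F (root_reflection a x)) * (a \<bullet> p) / (a \<bullet> x)\<^sup>2)) + (a \<bullet> p) * (F' x q - F' (root_reflection a x) q) / (a \<bullet> x)))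
     + (\<Sum>a\<in>R. kap a * ((a \<bullet> p) * ((\<Sum>b\<in>R. kap b * ((b \<bullet> q) * refl_quot b F x))
      - (\<Sum>b\<in>R. kap b * ((b \<bullet> q) * refl_quot b F (root_reflection a x)))) / (a \<bullet> x)))" for p q
  proof -
    have "(\<Sum>a\<in>R. kap a * ((a \<bullet> p) * refl_quot a (dunkl_op F' F q) x)) =
      (\<Sum>a\<in>R. kap a * ((a \<bullet> p) * (F' x q - F' (root_reflection a x) q) / (a \<bullet> x)) +
        kap a * ((a \<bullet> p) * ((\<Sum>b\<in>R. kap b * ((b \<bullet> q) * refl_quot b F x))
          - (\<Sum>b\<in>R. kap b * ((b \<bullet> q) * refl_quot b F (root_reflection a x)))) / (a \<bullet> x)))"
    proof (intro sum.cong refl)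
      fix a
      define A where "A = (\<Sum>b\<in>R. kap b * ((b \<bullet> q) * refl_quot b F x))"
      define B where "B = (\<Sum>b\<in>R. kap b * ((b \<bullet> q) * refl_quot b F (root_reflection a x)))"
      show "kap a * ((a \<bullet> p) * refl_quot a (dunkl_op F' F q) x) =
        kap a * ((a \<bullet> p) * (F' x q - F' (root_reflection a x) q) / (a \<bullet> x)) + kap a * ((a \<bullet> p) * (A - B) / (a \<bullet> x))"
        unfolding refl_quot_def[of a "dunkl_op F' F q"] dunkl_op_def A_def[symmetric] B_def[symmetric]
        by (simp add: add_divide_distrib diff_divide_distrib algebra_simps)
    qed
    then show ?thesis by (simp add: dunkl_op_deriv_def sum.distrib distrib_left)
  qed
  have "(a \<bullet> q) * ((F' x p - F' (root_reflection a x) (root_reflection a p)) / (a \<bullet> x)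
      - (F x - F (root_reflection a x)) * (a \<bullet> p) / (a \<bullet> x)\<^sup>2) + (a \<bullet> p) * (F' x q - F' (root_reflection a x) q) / (a \<bullet> x)
    = ((a \<bullet> q) * (F' x p - F' (root_reflection a x) p) + (a \<bullet> p) * (F' x q - F' (root_reflection a x) q)) / (a \<bullet> x)
     + (a \<bullet> p) * (a \<bullet> q) * (F' (root_reflection a x) a / (a \<bullet> x) - (F x - F (root_reflection a x)) / (a \<bullet> x)\<^sup>2)"
    if "a \<in> R" for a p q
    using lin[of "root_reflection a x"] that
    by (simp add: refl_eq linear_diff linear_scale inner_commute add_divide_distrib diff_divide_distrib algebra_simps)
  then have "(\<Sum>a\<in>R. kap a * (((a \<bullet> v) * ((F' x u - F' (root_reflection a x) (root_reflection a u)) / (a \<bullet> x)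
      - (F x - F (root_reflection a x)) * (a \<bullet> u) / (a \<bullet> x)\<^sup>2)) + (a \<bullet> u) * (F' x v - F' (root_reflection a x) v) / (a \<bullet> x)))
    = (\<Sum>a\<in>R. kap a * (((a \<bullet> u) * ((F' x v - F' (root_reflection a x) (root_reflection a v)) / (a \<bullet> x)
      - (F x - F (root_reflection a x)) * (a \<bullet> v) / (a \<bullet> x)\<^sup>2)) + (a \<bullet> v) * (F' x u - F' (root_reflection a x) u) / (a \<bullet> x)))"
    by (intro sum.cong refl) (simp add: add.commute mult.commute)
  then show ?thesis unfolding E using sym[of x u v] refl_quot_double_sum[OF x, of u v F] by simp
qed

end

section \<open>The homogeneous components of the Dunkl kernel\<close>

context dunkl
begin

text \<open>The coefficient of g in the j-th power of \<Sum> \<kappa>_a \<sigma>_a in the group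
  algebra.\<close>

primrec walk :: "nat \<Rightarrow> (real ^ 'n \<Rightarrow> real ^ 'n) \<Rightarrow> real" where
  "walk 0 g = (if g = id then 1 else 0)"
| "walk (Suc j) g = (\<Sum>a\<in>R. kap a * walk j (g \<circ> root_reflection a))"

text \<open>Neumann series for the inverse of \<open>n + K - \<Sum>\<^sub>a \<kappa>\<^sub>a \<sigma>\<^sub>a\<close> in the group algebra.\<close>

definition neumann_coeff :: "nat \<Rightarrow> (real ^ 'n \<Rightarrow> real ^ 'n) \<Rightarrow> real"
  where "neumann_coeff n g = (\<Sum>j. walk j g / (real n + K) ^ Suc j)"

lemma walk_nonneg: "walk j g \<ge> 0"
  by (induction j arbitrary: g) (auto intro!: sum_nonneg mult_nonneg_nonneg kap_nonneg)

lemma walk_sum: "(\<Sum>g\<in>G. walk j g) = K ^ j"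
proof (induction j)
  case 0
  have "(\<Sum>g\<in>G. walk 0 g) = (\<Sum>g\<in>G. if g = id then 1 else 0)" by simp
  also have "\<dots> = 1" by (subst sum.delta) auto
  finally show ?case by simp
next
  case (Suc j)
  have "(\<Sum>g\<in>G. walk (Suc j) g) = (\<Sum>a\<in>R. kap a * (\<Sum>g\<in>G. walk j (g \<circ> root_reflection a)))"
    by (simp add: sum_distrib_left) (rule sum.swap)
  also have "\<dots> = (\<Sum>a\<in>R. kap a * K ^ j)"
    using sum.reindex_bij_betw[OF bij_betw_G_right[OF refl_in_G], of _ "walk j"] Suc
    by (intro sum.cong) auto
  finally show ?case by (simp add: sum_kap_const)
qed

lemma walk_le: "g \<in> G \<Longrightarrow> walk j g \<le> K ^ j"
  using member_le_sum[of g G "walk j"] by (simp add: walk_sum walk_nonneg)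

lemma neumann_coeff_summable:
  assumes "g \<in> G" "n > 0"
  shows "summable (\<lambda>j. walk j g / (real n + K) ^ Suc j)"
proof (rule summable_comparison_test')
  have "K / (real n + K) < 1" "K / (real n + K) \<ge> 0" using assms K_nonneg by auto
  then show "summable (\<lambda>j. (1 / (real n + K)) * (K / (real n + K)) ^ j)"
    by (intro summable_mult summable_geometric) (simp only: real_norm_def abs_of_nonneg)
  fix j
  have "norm (walk j g / (real n + K) ^ Suc j) = walk j g / (real n + K) ^ Suc j"
    using walk_nonneg K_nonneg by simp
  also have "\<dots> \<le> K ^ j / (real n + K) ^ Suc j"
    using walk_le[OF assms(1)] K_nonneg by (intro divide_right_mono) auto
  also have "\<dots> = (1 / (real n + K)) * (K / (real n + K)) ^ j" by (simp add: power_divide)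
  finally show "norm (walk j g / (real n + K) ^ Suc j) \<le> (1 / (real n + K)) * (K / (real n + K)) ^ j" .
qed

lemma neumann_coeff_nonneg: "g \<in> G \<Longrightarrow> n > 0 \<Longrightarrow> neumann_coeff n g \<ge> 0"
  unfolding neumann_coeff_def using neumann_coeff_summable walk_nonneg K_nonneg by (intro suminf_nonneg) auto

lemma neumann_coeff_relation:
  assumes g: "g \<in> G" and n: "n > 0"
  shows "(real n + K) * neumann_coeff n g - (\<Sum>a\<in>R. kap a * neumann_coeff n (g \<circ> root_reflection a)) = (if g = id then 1 else 0)"
proof -
  have nz: "real n + K > 0" using n K_nonneg by (simp add: add_pos_nonneg)
  define w where "w = (\<lambda>j. walk j g / (real n + K) ^ j)"
  have w: "w j = (real n + K) * (walk j g / (real n + K) ^ Suc j)" for j using nz by (simp add: w_def)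
  have sw: "summable w" unfolding w by (intro summable_mult neumann_coeff_summable g n)
  have "(real n + K) * neumann_coeff n g = (\<Sum>j. w j)"
    by (simp only: neumann_coeff_def w suminf_mult[OF neumann_coeff_summable[OF g n]])
  also have "\<dots> = w 0 + (\<Sum>j. w (Suc j))" using suminf_split_head[OF sw] by simp
  also have "(\<Sum>j. w (Suc j)) = (\<Sum>j. \<Sum>a\<in>R. kap a * (walk j (g \<circ> root_reflection a) / (real n + K) ^ Suc j))"
    by (simp add: w_def sum_divide_distrib)
  also have "\<dots> = (\<Sum>a\<in>R. \<Sum>j. kap a * (walk j (g \<circ> root_reflection a) / (real n + K) ^ Suc j))"
    using g n by (intro suminf_sum summable_mult neumann_coeff_summable) auto
  also have "\<dots> = (\<Sum>a\<in>R. kap a * neumann_coeff n (g \<circ> root_reflection a))"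
    unfolding neumann_coeff_def using g n by (intro sum.cong refl suminf_mult neumann_coeff_summable) auto
  finally show ?thesis by (simp add: w_def)
qed

text \<open>On constants the inverted operator is multiplication by n, so its inverse has total mass
  1 / n. With nonnegative coefficients this yields one factor 1 / n per degree, that is the
  factorials in the bounds below.\<close>

lemma neumann_coeff_sum:
  assumes n: "n > 0"
  shows "(\<Sum>g\<in>G. neumann_coeff n g) = 1 / real n"
proof -
  have "(\<Sum>g\<in>G. (real n + K) * neumann_coeff n g - (\<Sum>a\<in>R. kap a * neumann_coeff n (g \<circ> root_reflection a))) = (\<Sum>g\<in>G. if g = id then 1 else 0)"
    using neumann_coeff_relation n by (intro sum.cong) auto
  also have "\<dots> = 1" by (subst sum.delta) auto
  also have "(\<Sum>g\<in>G. (real n + K) * neumann_coeff n g - (\<Sum>a\<in>R. kap a * neumann_coeff n (g \<circ> root_reflection a)))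
    = (real n + K) * (\<Sum>g\<in>G. neumann_coeff n g) - (\<Sum>g\<in>G. \<Sum>a\<in>R. kap a * neumann_coeff n (g \<circ> root_reflection a))"
    by (simp only: sum_subtractf sum_distrib_left)
  also have "(\<Sum>g\<in>G. \<Sum>a\<in>R. kap a * neumann_coeff n (g \<circ> root_reflection a)) = (\<Sum>a\<in>R. \<Sum>g\<in>G. kap a * neumann_coeff n (g \<circ> root_reflection a))"
    by (rule sum.swap)
  also have "\<dots> = (\<Sum>a\<in>R. kap a * (\<Sum>g\<in>G. neumann_coeff n g))"
    using sum.reindex_bij_betw[OF bij_betw_G_right[OF refl_in_G], of _ "neumann_coeff n"]
    by (intro sum.cong) (simp_all add: sum_distrib_left[symmetric])
  also have "\<dots> = K * (\<Sum>g\<in>G. neumann_coeff n g)" by (rule sum_kap_const)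
  finally show ?thesis using n by (simp add: algebra_simps divide_simps)
qed

end

locale dunkl_eigen = dunkl R k for R :: "(real ^ 'n) set" and k +
  fixes y :: "real ^ 'n"
begin

text \<open>On functions homogeneous of degree n + 1 the operator \<Sum> x_i T_i acts as n + 1 + K -
  \<Sum> \<kappa>_a \<sigma>_a. Applying its inverse to (x \<bullet> y) f_n is thus forced by the
  eigenvalue equations.\<close>

primrec hom_part :: "nat \<Rightarrow> real ^ 'n \<Rightarrow> real" where
  "hom_part 0 x = 1"
| "hom_part (Suc n) x = (\<Sum>g\<in>G. neumann_coeff (Suc n) g * ((g x \<bullet> y) * hom_part n (g x)))"

primrec hom_part_deriv :: "nat \<Rightarrow> real ^ 'n \<Rightarrow> real ^ 'n \<Rightarrow> real" where
  "hom_part_deriv 0 x h = 0"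
| "hom_part_deriv (Suc n) x h = (\<Sum>g\<in>G. neumann_coeff (Suc n) g * ((g x \<bullet> y) * hom_part_deriv n (g x) (g h) + (g h \<bullet> y) * hom_part n (g x)))"

lemma hom_part_relation:
  "(real (Suc n) + K) * hom_part (Suc n) x - (\<Sum>a\<in>R. kap a * hom_part (Suc n) (root_reflection a x)) = (x \<bullet> y) * hom_part n x"
proof -
  define P where "P = (\<lambda>z. (z \<bullet> y) * hom_part n z)"
  have f: "hom_part (Suc n) z = (\<Sum>g\<in>G. neumann_coeff (Suc n) g * P (g z))" for z by (simp add: P_def)
  have "hom_part (Suc n) (root_reflection a x) = (\<Sum>g\<in>G. neumann_coeff (Suc n) (g \<circ> root_reflection a) * P (g x))" if a: "a \<in> R" for a
    using sum.reindex_bij_betw[OF bij_betw_G_right[OF refl_in_G[OF a]], of "\<lambda>g. neumann_coeff (Suc n) g * P (g (root_reflection a x))"] a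
    unfolding f by simp
  then have "(\<Sum>a\<in>R. kap a * hom_part (Suc n) (root_reflection a x)) =
     (\<Sum>a\<in>R. \<Sum>g\<in>G. kap a * neumann_coeff (Suc n) (g \<circ> root_reflection a) * P (g x))"
    by (intro sum.cong refl) (simp only: sum_distrib_left mult.assoc)
  also have "\<dots> = (\<Sum>g\<in>G. (\<Sum>a\<in>R. kap a * neumann_coeff (Suc n) (g \<circ> root_reflection a)) * P (g x))"
    by (subst sum.swap) (simp only: sum_distrib_right)
  finally have "(real (Suc n) + K) * hom_part (Suc n) x - (\<Sum>a\<in>R. kap a * hom_part (Suc n) (root_reflection a x))
    = (\<Sum>g\<in>G. ((real (Suc n) + K) * neumann_coeff (Suc n) g - (\<Sum>a\<in>R. kap a * neumann_coeff (Suc n) (g \<circ> root_reflection a))) * P (g x))"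
    unfolding f by (simp only: sum_distrib_left sum_subtractf[symmetric] left_diff_distrib mult.assoc)
  also have "\<dots> = (\<Sum>g\<in>G. (if g = id then 1 else 0) * P (g x))"
    by (intro sum.cong refl) (simp only: neumann_coeff_relation zero_less_Suc)
  also have "\<dots> = (\<Sum>g\<in>G. if g = id then P x else 0)" by (intro sum.cong) auto
  also have "\<dots> = P x" by (subst sum.delta) auto
  finally show ?thesis by (simp only: P_def)
qed

lemma G_has_derivative: "g \<in> G \<Longrightarrow> (g has_derivative g) (at x)"
  using G_linear[of g] by (simp add: bounded_linear_imp_has_derivative linear_conv_bounded_linear)

lemma hom_part_deriv: "(hom_part n has_derivative hom_part_deriv n x) (at x)"
proof (induction n arbitrary: x)
  case 0
  show ?case by (simp add: hom_part.simps[abs_def] hom_part_deriv.simps[abs_def])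
next
  case (Suc n)
  have "((\<lambda>x. \<Sum>g\<in>G. neumann_coeff (Suc n) g * ((g x \<bullet> y) * hom_part n (g x))) has_derivative
    (\<lambda>h. \<Sum>g\<in>G. neumann_coeff (Suc n) g * ((g x \<bullet> y) * hom_part_deriv n (g x) (g h) + (g h \<bullet> y) * hom_part n (g x)))) (at x)"
  proof (intro has_derivative_sum has_derivative_mult_right has_derivative_mult)
    fix g assume g: "g \<in> G"
    show "((\<lambda>x. hom_part n (g x)) has_derivative (\<lambda>h. hom_part_deriv n (g x) (g h))) (at x)"
      by (rule has_derivative_compose[OF G_has_derivative[OF g] Suc])
    show "((\<lambda>x. g x \<bullet> y) has_derivative (\<lambda>h. g h \<bullet> y)) (at x)"
      by (intro has_derivative_inner_left G_has_derivative g)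
  qed
  then show ?case by (simp add: hom_part.simps[abs_def] hom_part_deriv.simps[abs_def])
qed

lemma hom_part_smooth2: "smooth2 (hom_part n)"
proof (induction n)
  case 0
  show ?case using smooth2_const[of 1] by (simp add: hom_part.simps[abs_def])
next
  case (Suc n)
  have "smooth2 (\<lambda>x. \<Sum>g\<in>G. neumann_coeff (Suc n) g * ((g x \<bullet> y) * hom_part n (g x)))"
  proof (intro smooth2_sum smooth2_mult smooth2_const finite_G)
    fix g assume g: "g \<in> G"
    show "smooth2 (\<lambda>x. g x \<bullet> y)" using smooth2_compose_linear[OF smooth2_inner[of y] G_linear[OF g]] .
    show "smooth2 (\<lambda>x. hom_part n (g x))" using smooth2_compose_linear[OF Suc G_linear[OF g]] .
  qed
  then show ?case by (simp add: hom_part.simps[abs_def])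
qed

lemma hom_part_deriv_deriv:
  obtains F'' where "\<And>x h. ((\<lambda>z. hom_part_deriv n z h) has_derivative (\<lambda>j. F'' x j h)) (at x)"
    "\<And>x j h. F'' x j h = F'' x h j"
proof -
  obtain F' F'' where F: "\<And>x. (hom_part n has_derivative F' x) (at x)"
    "\<And>x h. ((\<lambda>z. F' z h) has_derivative (\<lambda>j. F'' x j h)) (at x)" "\<And>x j h. F'' x j h = F'' x h j"
    using hom_part_smooth2[of n] unfolding smooth2_def by metis
  have "F' = hom_part_deriv n" using has_derivative_unique[OF F(1) hom_part_deriv] by (simp add: fun_eq_iff)
  then show ?thesis using that F by metis
qed

lemma hom_part_homogeneous: "hom_part n (c *\<^sub>R x) = c ^ n * hom_part n x"
proof (induction n arbitrary: x)
  case (Suc n)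
  show ?case unfolding hom_part.simps sum_distrib_left
  proof (intro sum.cong refl)
    fix g assume "g \<in> G"
    then have "g (c *\<^sub>R x) = c *\<^sub>R g x" using G_linear by (simp add: linear_scale)
    then show "neumann_coeff (Suc n) g * (g (c *\<^sub>R x) \<bullet> y * hom_part n (g (c *\<^sub>R x))) = c ^ Suc n * (neumann_coeff (Suc n) g * (g x \<bullet> y * hom_part n (g x)))"
      using Suc by simp
  qed
qed simp

lemma hom_part_deriv_homogeneous: "hom_part_deriv (Suc n) (c *\<^sub>R x) h = c ^ n * hom_part_deriv (Suc n) x h"
proof (induction n arbitrary: x h)
  case 0
  show ?case by simp
next
  case (Suc n)
  show ?case unfolding hom_part_deriv.simps(2)[of "Suc n"] sum_distrib_left
  proof (intro sum.cong refl)
    fix g assume "g \<in> G"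
    then have g: "g (c *\<^sub>R x) = c *\<^sub>R g x" using G_linear by (simp add: linear_scale)
    show "neumann_coeff (Suc (Suc n)) g * (g (c *\<^sub>R x) \<bullet> y * hom_part_deriv (Suc n) (g (c *\<^sub>R x)) (g h) + g h \<bullet> y * hom_part (Suc n) (g (c *\<^sub>R x)))
      = c ^ Suc n * (neumann_coeff (Suc (Suc n)) g * (g x \<bullet> y * hom_part_deriv (Suc n) (g x) (g h) + g h \<bullet> y * hom_part (Suc n) (g x)))"
      unfolding g Suc hom_part_homogeneous[of "Suc n"] by (simp add: distrib_left mult_ac del: hom_part_deriv.simps hom_part.simps)
  qed
qed

lemma hom_part_deriv_linear: "linear (hom_part_deriv n x)"
  using hom_part_deriv has_derivative_linear by blast

lemma hom_part_deriv_euler: "hom_part_deriv n x x = real n * hom_part n x"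
proof -
  have "((\<lambda>s. s *\<^sub>R x) has_derivative (\<lambda>s. s *\<^sub>R x)) (at 1)" by (auto intro!: derivative_eq_intros)
  from has_derivative_compose[OF this, of "hom_part n" "hom_part_deriv n x"]
  have "((\<lambda>s. hom_part n (s *\<^sub>R x)) has_derivative (\<lambda>s. hom_part_deriv n x (s *\<^sub>R x))) (at 1)"
    using hom_part_deriv by simp
  then have "((\<lambda>s. s ^ n * hom_part n x) has_derivative (\<lambda>s. s * hom_part_deriv n x x)) (at 1)"
    by (simp add: hom_part_homogeneous linear_scale[OF hom_part_deriv_linear])
  then have "((\<lambda>s. s ^ n * hom_part n x) has_real_derivative hom_part_deriv n x x) (at 1)"
    by (simp add: has_field_derivative_def mult_commute_abs)
  moreover have "((\<lambda>s. s ^ n * hom_part n x) has_real_derivative real n * hom_part n x) (at 1)"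
    by (auto intro!: derivative_eq_intros)
  ultimately show ?thesis by (rule DERIV_unique)
qed

text \<open>The failure of T_v f_{n+1} = (v \<bullet> y) f_n. The recursion directly guarantees this
  equation only in the radial direction v = x.\<close>

definition eigen_defect :: "nat \<Rightarrow> real ^ 'n \<Rightarrow> real ^ 'n \<Rightarrow> real"
  where "eigen_defect n v x = dunkl_op (hom_part_deriv (Suc n)) (hom_part (Suc n)) v x - (v \<bullet> y) * hom_part n x"

lemma eigen_defect_linear: "linear (\<lambda>v. eigen_defect n v x)"
  unfolding eigen_defect_def dunkl_op_def
  by (rule linearI) (simp_all add: linear_add[OF hom_part_deriv_linear] linear_scale[OF hom_part_deriv_linear] inner_add_left inner_add_right
     distrib_left distrib_right sum.distrib sum_distrib_left right_diff_distrib mult_ac del: hom_part_deriv.simps hom_part.simps)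

lemma eigen_defect_add: "eigen_defect n (v + w) x = eigen_defect n v x + eigen_defect n w x"
  and eigen_defect_scale: "eigen_defect n (c *\<^sub>R v) x = c * eigen_defect n v x"
  and eigen_defect_diff: "eigen_defect n (v - w) x = eigen_defect n v x - eigen_defect n w x"
  using linear_add[OF eigen_defect_linear] linear_scale[OF eigen_defect_linear] linear_diff[OF eigen_defect_linear] by simp_all

lemma eigen_defect_diag:
  assumes "regular x"
  shows "eigen_defect n x x = 0"
proof -
  have nz: "a \<bullet> x \<noteq> 0" if "a \<in> R" for a using assms that by (simp add: regular_def inner_commute)
  have "(\<Sum>a\<in>R. kap a * ((a \<bullet> x) * refl_quot a (hom_part (Suc n)) x)) = (\<Sum>a\<in>R. kap a * (hom_part (Suc n) x - hom_part (Suc n) (root_reflection a x)))"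
    using nz by (intro sum.cong refl) (simp add: refl_quot_def del: hom_part.simps)
  also have "\<dots> = K * hom_part (Suc n) x - (\<Sum>a\<in>R. kap a * hom_part (Suc n) (root_reflection a x))"
    by (simp only: right_diff_distrib sum_subtractf sum_kap_const)
  finally show ?thesis using hom_part_relation[of n x] hom_part_deriv_euler[of "Suc n" x]
    by (simp add: eigen_defect_def dunkl_op_def algebra_simps del: hom_part.simps hom_part_deriv.simps)
qed

lemma eigen_defect_homogeneous:
  assumes "c \<noteq> 0"
  shows "eigen_defect n v (c *\<^sub>R x) = c ^ n * eigen_defect n v x"
proof -
  have "refl_quot a (hom_part (Suc n)) (c *\<^sub>R x) = c ^ n * refl_quot a (hom_part (Suc n)) x" for a
  proof -
    have "root_reflection a (c *\<^sub>R x) = c *\<^sub>R root_reflection a x" by (rule linear_scale[OF linear_refl])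
    then have "refl_quot a (hom_part (Suc n)) (c *\<^sub>R x) = (c ^ Suc n * hom_part (Suc n) x - c ^ Suc n * hom_part (Suc n) (root_reflection a x)) / (c * (a \<bullet> x))"
      unfolding refl_quot_def by (simp only: hom_part_homogeneous inner_scaleR_right)
    also have "\<dots> = c * (c ^ n * (hom_part (Suc n) x - hom_part (Suc n) (root_reflection a x))) / (c * (a \<bullet> x))"
      by (simp add: right_diff_distrib mult_ac del: hom_part.simps)
    also have "\<dots> = c ^ n * refl_quot a (hom_part (Suc n)) x" unfolding refl_quot_def using assms by simp
    finally show ?thesis .
  qed
  then show ?thesis
    unfolding eigen_defect_def dunkl_op_def hom_part_deriv_homogeneous hom_part_homogeneous[of n]
    by (simp add: distrib_left right_diff_distrib sum_distrib_left mult_ac del: hom_part.simps hom_part_deriv.simps)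
qed

lemma open_regular: "open {x. regular x}"
proof -
  have "open (\<Inter>a\<in>R. {x. x \<bullet> a \<noteq> 0})"
    by (intro open_INT ballI open_Collect_neq continuous_intros) auto
  then show ?thesis by (simp add: regular_def INTER_eq)
qed

text \<open>Differentiating \<open>eigen_defect n x x = 0\<close> and using \<open>T\<^sub>u T\<^sub>v = T\<^sub>v T\<^sub>u\<close> gives a linear equation for \<open>eigen_defect\<close>
  along the diagonal \<open>G\<close>-action on pairs, to which the maximum principle applies.\<close>

lemma eigen_defect_orbit_equation:
  assumes IH: "\<And>v x. regular x \<Longrightarrow> dunkl_op (hom_part_deriv n) (hom_part n) v x = (v \<bullet> y) * (if n = 0 then 0 else hom_part (n - 1) x)"
    and x: "regular x"
  shows "(real n + 1) * eigen_defect n v x + (\<Sum>a\<in>R. kap a * (eigen_defect n v x - eigen_defect n (root_reflection a v) (root_reflection a x))) = 0"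
proof -
  obtain F'' where F'': "\<And>x h. ((\<lambda>z. hom_part_deriv (Suc n) z h) has_derivative (\<lambda>j. F'' x j h)) (at x)"
    "\<And>x j h. F'' x j h = F'' x h j" using hom_part_deriv_deriv[of "Suc n"] by metis
  define dq where "dq = (\<lambda>v x u. dunkl_op_deriv F'' (hom_part_deriv (Suc n)) (hom_part (Suc n)) v x u - (v \<bullet> y) * hom_part_deriv n x u)"
  have dq: "(eigen_defect n v has_derivative dq v z) (at z)" if "regular z" for v z
    unfolding eigen_defect_def dq_def
    by (intro has_derivative_diff dunkl_op_deriv[OF hom_part_deriv F''(1) that] has_derivative_mult_right hom_part_deriv)
  have nz: "a \<bullet> x \<noteq> 0" if "a \<in> R" for a using x that by (simp add: regular_def inner_commute)
  \<comment> \<open>Commutativity is applied to f_{n+1}. The remaining terms are both (u \<bullet>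
    y)(v \<bullet> y) f_{n-1} by the induction hypothesis and hence agree.\<close>
  have sym: "dq u x v + (\<Sum>a\<in>R. kap a * ((a \<bullet> v) * refl_quot a (eigen_defect n u) x)) =
    dq v x u + (\<Sum>a\<in>R. kap a * ((a \<bullet> u) * refl_quot a (eigen_defect n v) x))" for u v
  proof -
    have "refl_quot a (eigen_defect n p) x = refl_quot a (dunkl_op (hom_part_deriv (Suc n)) (hom_part (Suc n)) p) x - (p \<bullet> y) * refl_quot a (hom_part n) x" for a p
      by (simp add: refl_quot_def eigen_defect_def right_diff_distrib diff_divide_distrib del: hom_part.simps hom_part_deriv.simps)
    then have E: "dq p x q + (\<Sum>a\<in>R. kap a * ((a \<bullet> q) * refl_quot a (eigen_defect n p) x)) =
      (dunkl_op_deriv F'' (hom_part_deriv (Suc n)) (hom_part (Suc n)) p x q + (\<Sum>a\<in>R. kap a * ((a \<bullet> q) * refl_quot a (dunkl_op (hom_part_deriv (Suc n)) (hom_part (Suc n)) p) x)))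
      - (p \<bullet> y) * dunkl_op (hom_part_deriv n) (hom_part n) q x" for p q
      unfolding dq_def dunkl_op_def[of "hom_part_deriv n"]
      by (simp add: right_diff_distrib distrib_left sum_subtractf sum_distrib_left mult_ac del: hom_part.simps hom_part_deriv.simps)
    show ?thesis unfolding E IH[OF x] dunkl_op_commute[OF hom_part_deriv F''(2) x] by simp
  qed
  \<comment> \<open>The product rule for z \<mapsto> \<open>eigen_defect n z z\<close>, which
    vanishes near x: differentiating the argument and differentiating the direction must
    cancel.\<close>
  have diag: "dq x x v = - eigen_defect n v x"
  proof -
    have line: "((\<lambda>s. x + s *\<^sub>R v) has_derivative (\<lambda>s. s *\<^sub>R v)) (at 0)" by (auto intro!: derivative_eq_intros)
    have 1: "((\<lambda>s. eigen_defect n w (x + s *\<^sub>R v)) has_derivative (\<lambda>s. s * dq w x v)) (at 0)" for w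
      using has_derivative_compose[OF line, of "eigen_defect n w" "dq w x"] dq[OF x, of w]
        linear_scale[OF has_derivative_linear[OF dq[OF x, of w]]] by simp
    have 2: "((\<lambda>s. eigen_defect n x (x + s *\<^sub>R v)) has_real_derivative dq x x v) (at 0)"
      "((\<lambda>s. eigen_defect n v (x + s *\<^sub>R v)) has_real_derivative dq v x v) (at 0)"
      using 1[of x] 1[of v] by (simp_all add: has_field_derivative_def mult_commute_abs)
    have "((\<lambda>s. eigen_defect n x (x + s *\<^sub>R v) + s * eigen_defect n v (x + s *\<^sub>R v)) has_real_derivative dq x x v + (1 * eigen_defect n v (x + 0 *\<^sub>R v) + dq v x v * 0)) (at 0)"
      by (intro DERIV_add DERIV_mult DERIV_ident 2)
    moreover have "eigen_defect n x (x + s *\<^sub>R v) + s * eigen_defect n v (x + s *\<^sub>R v) = eigen_defect n (x + s *\<^sub>R v) (x + s *\<^sub>R v)" for s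
      by (simp only: eigen_defect_add[of n x "s *\<^sub>R v"] eigen_defect_scale)
    ultimately have D: "((\<lambda>s. eigen_defect n (x + s *\<^sub>R v) (x + s *\<^sub>R v)) has_real_derivative dq x x v + eigen_defect n v x) (at 0)"
      by simp
    have "((\<lambda>s. x + s *\<^sub>R v) \<longlongrightarrow> x + 0 *\<^sub>R v) (at 0)" by (intro tendsto_intros)
    then have "\<forall>\<^sub>F s in at 0. x + s *\<^sub>R v \<in> {x. regular x}"
      using open_regular x by (intro topological_tendstoD) auto
    then have "\<forall>\<^sub>F s in at 0. eigen_defect n (x + s *\<^sub>R v) (x + s *\<^sub>R v) = 0"
      by eventually_elim (simp add: eigen_defect_diag)
    then have ev: "\<forall>\<^sub>F s in nhds 0. eigen_defect n (x + s *\<^sub>R v) (x + s *\<^sub>R v) = 0"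
      using eigen_defect_diag[OF x, of n] by (simp add: eventually_nhds_conv_at)
    then have "((\<lambda>s. 0 :: real) has_real_derivative dq x x v + eigen_defect n v x) (at 0)"
      using D DERIV_cong_ev[OF refl ev refl] by simp
    then have "dq x x v + eigen_defect n v x = 0" using DERIV_unique[OF _ DERIV_const] by blast
    then show ?thesis by simp
  qed
  have euler: "dq v x x = real n * eigen_defect n v x"
  proof -
    have "((\<lambda>s. s *\<^sub>R x) has_derivative (\<lambda>s. s *\<^sub>R x)) (at 1)" by (auto intro!: derivative_eq_intros)
    from has_derivative_compose[OF this, of "eigen_defect n v" "dq v x"]
    have "((\<lambda>s. eigen_defect n v (s *\<^sub>R x)) has_derivative (\<lambda>s. dq v x (s *\<^sub>R x))) (at 1)"
      using dq[OF x] by simp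
    then have "((\<lambda>s. eigen_defect n v (s *\<^sub>R x)) has_derivative (\<lambda>s. s * dq v x x)) (at 1)"
      using linear_scale[OF has_derivative_linear[OF dq[OF x, of v]]] by simp
    then have D: "((\<lambda>s. eigen_defect n v (s *\<^sub>R x)) has_real_derivative dq v x x) (at 1)"
      by (simp add: has_field_derivative_def mult_commute_abs)
    have "\<forall>\<^sub>F s in nhds (1::real). s \<in> {0<..}" by (intro eventually_nhds_in_open) auto
    then have ev: "\<forall>\<^sub>F s in nhds (1::real). eigen_defect n v (s *\<^sub>R x) = s ^ n * eigen_defect n v x"
      by eventually_elim (simp add: eigen_defect_homogeneous)
    then have "((\<lambda>s. s ^ n * eigen_defect n v x) has_real_derivative dq v x x) (at 1)"
      using D DERIV_cong_ev[OF refl ev refl] by simp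
    moreover have "((\<lambda>s. s ^ n * eigen_defect n v x) has_real_derivative real n * eigen_defect n v x) (at 1)"
      by (auto intro!: derivative_eq_intros)
    ultimately show ?thesis by (rule DERIV_unique)
  qed
  have 1: "(\<Sum>a\<in>R. kap a * ((a \<bullet> v) * refl_quot a (eigen_defect n x) x)) = (\<Sum>a\<in>R. kap a * (- ((a \<bullet> v) * eigen_defect n a (root_reflection a x))))"
  proof (intro sum.cong refl)
    fix a assume a: "a \<in> R"
    have "x = root_reflection a x + (x \<bullet> a) *\<^sub>R a" using a by (simp add: refl_eq)
    then have "eigen_defect n x (root_reflection a x) = eigen_defect n (root_reflection a x) (root_reflection a x) + (x \<bullet> a) * eigen_defect n a (root_reflection a x)"
      by (metis eigen_defect_add eigen_defect_scale)
    then have "eigen_defect n x (root_reflection a x) = (x \<bullet> a) * eigen_defect n a (root_reflection a x)"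
      using eigen_defect_diag[OF regular_refl[OF x a]] by simp
    then have "refl_quot a (eigen_defect n x) x = - eigen_defect n a (root_reflection a x)"
      using eigen_defect_diag[OF x] nz[OF a] by (simp add: refl_quot_def inner_commute)
    then show "kap a * ((a \<bullet> v) * refl_quot a (eigen_defect n x) x) = kap a * (- ((a \<bullet> v) * eigen_defect n a (root_reflection a x)))" by simp
  qed
  have 2: "(\<Sum>a\<in>R. kap a * ((a \<bullet> x) * refl_quot a (eigen_defect n v) x)) = (\<Sum>a\<in>R. kap a * (eigen_defect n v x - eigen_defect n v (root_reflection a x)))"
    using nz by (intro sum.cong refl) (simp add: refl_quot_def)
  have 3: "(\<Sum>a\<in>R. kap a * (eigen_defect n v x - eigen_defect n (root_reflection a v) (root_reflection a x)))
    = (\<Sum>a\<in>R. kap a * (eigen_defect n v x - eigen_defect n v (root_reflection a x))) - (\<Sum>a\<in>R. kap a * (- ((a \<bullet> v) * eigen_defect n a (root_reflection a x))))"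
    unfolding sum_subtractf[symmetric]
  proof (intro sum.cong refl)
    fix a assume a: "a \<in> R"
    have "eigen_defect n (root_reflection a v) (root_reflection a x) = eigen_defect n v (root_reflection a x) - (v \<bullet> a) * eigen_defect n a (root_reflection a x)"
      using a by (simp only: refl_eq[of a v] eigen_defect_diff eigen_defect_scale)
    then have *: "eigen_defect n (root_reflection a v) (root_reflection a x) = eigen_defect n v (root_reflection a x) - (a \<bullet> v) * eigen_defect n a (root_reflection a x)"
      by (simp only: inner_commute)
    show "kap a * (eigen_defect n v x - eigen_defect n (root_reflection a v) (root_reflection a x)) =
      kap a * (eigen_defect n v x - eigen_defect n v (root_reflection a x)) - kap a * (- ((a \<bullet> v) * eigen_defect n a (root_reflection a x)))"
      unfolding * by (simp add: algebra_simps)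
  qed
  show ?thesis using sym[of x v] unfolding 1 2 diag euler 3 by (simp add: algebra_simps)
qed

text \<open>At a maximum of Q over the finite orbit the reflection sum is nonnegative, so (n + 1) Q
  \<le> 0 there; at a minimum the signs are reversed.\<close>

lemma eigen_defect_zero: "regular x \<Longrightarrow> eigen_defect n v x = 0"
proof (induction n arbitrary: v x)
  have step: "eigen_defect n v x = 0"
    if IH: "\<And>v x. regular x \<Longrightarrow> dunkl_op (hom_part_deriv n) (hom_part n) v x = (v \<bullet> y) * (if n = 0 then 0 else hom_part (n - 1) x)"
    and x: "regular x" for n v x
  proof -
    define Q where "Q = (\<lambda>g. eigen_defect n (g v) (g x))"
    have eq: "(real n + 1) * Q g + (\<Sum>a\<in>R. kap a * (Q g - Q (root_reflection a \<circ> g))) = 0" if "g \<in> G" for g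
      using eigen_defect_orbit_equation[OF IH regular_G[OF x that], of "g v"] by (simp add: Q_def)
    have "Q id \<le> 0 \<and> - Q id \<le> 0"
    proof
      have ne: "finite (Q ` G)" "Q ` G \<noteq> {}" using id_in_G by blast+
      obtain g where g: "g \<in> G" "Max (Q ` G) = Q g" using Max_in[OF ne] by auto
      have "(\<Sum>a\<in>R. kap a * (Q g - Q (root_reflection a \<circ> g))) \<ge> 0"
        using g ne by (intro sum_nonneg mult_nonneg_nonneg kap_nonneg) (auto simp flip: g(2) simp del: comp_apply intro!: Max_ge)
      then have "Q g \<le> 0" using eq[OF g(1)] by (smt (verit) mult_pos_pos of_nat_0_le_iff)
      then show "Q id \<le> 0" using Max_ge[OF ne(1), of "Q id"] g by auto
      obtain g where g: "g \<in> G" "Min (Q ` G) = Q g" using Min_in[OF ne] by auto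
      have "(\<Sum>a\<in>R. kap a * (Q g - Q (root_reflection a \<circ> g))) \<le> (\<Sum>a\<in>R. kap a * 0)"
        using g ne by (intro sum_kap_mono) (auto simp flip: g(2) simp del: comp_apply intro!: Min_le)
      then have "Q g \<ge> 0" using eq[OF g(1)] by (smt (verit) mult_pos_neg of_nat_0_le_iff sum.neutral mult_zero_right)
      then show "- Q id \<le> 0" using Min_le[OF ne(1), of "Q id"] g by auto
    qed
    then show ?thesis by (simp add: Q_def)
  qed
  { case 0
    show ?case
    proof (rule step[OF _ 0])
      fix v x show "dunkl_op (hom_part_deriv 0) (hom_part 0) v x = (v \<bullet> y) * (if (0::nat) = 0 then 0 else hom_part (0 - 1) x)"
        by (simp add: dunkl_op_def refl_quot_def)
    qed
  next
    case (Suc n)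
    show ?case
    proof (rule step[OF _ Suc.prems])
      fix v x assume "regular x"
      then show "dunkl_op (hom_part_deriv (Suc n)) (hom_part (Suc n)) v x = (v \<bullet> y) * (if Suc n = 0 then 0 else hom_part (Suc n - 1) x)"
        using Suc.IH[of x v] by (simp add: eigen_defect_def del: hom_part.simps hom_part_deriv.simps)
    qed
  }
qed

lemma hom_part_eigen:
  assumes "regular x"
  shows "dunkl_op (hom_part_deriv (Suc n)) (hom_part (Suc n)) v x = (v \<bullet> y) * hom_part n x"
  using eigen_defect_zero[OF assms, of n v] by (simp add: eigen_defect_def del: hom_part.simps hom_part_deriv.simps)

subsection \<open>Bounds\<close>

lemma abs_inner_G: "g \<in> G \<Longrightarrow> \<bar>g x \<bullet> y\<bar> \<le> norm x * norm y"
  using Cauchy_Schwarz_ineq2[of "g x" y] by (simp add: G_norm)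

lemma hom_part_bound: "\<bar>hom_part n x\<bar> \<le> (norm x * norm y) ^ n / fact n"
proof (induction n arbitrary: x)
  case (Suc n)
  define M where "M = (norm x * norm y) ^ Suc n / fact n"
  have "\<bar>hom_part (Suc n) x\<bar> \<le> (\<Sum>g\<in>G. \<bar>neumann_coeff (Suc n) g * ((g x \<bullet> y) * hom_part n (g x))\<bar>)"
    unfolding hom_part.simps by (rule sum_abs)
  also have "\<dots> \<le> (\<Sum>g\<in>G. neumann_coeff (Suc n) g * M)"
  proof (rule sum_mono)
    fix g assume g: "g \<in> G"
    have "\<bar>g x \<bullet> y\<bar> * \<bar>hom_part n (g x)\<bar> \<le> (norm x * norm y) * ((norm x * norm y) ^ n / fact n)"
      using Suc[of "g x"] abs_inner_G[OF g, of x] by (intro mult_mono) (auto simp: G_norm[OF g])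
    also have "\<dots> = M" by (simp add: M_def)
    finally show "\<bar>neumann_coeff (Suc n) g * ((g x \<bullet> y) * hom_part n (g x))\<bar> \<le> neumann_coeff (Suc n) g * M"
      unfolding abs_mult abs_of_nonneg[OF neumann_coeff_nonneg[OF g zero_less_Suc]]
      by (intro mult_left_mono neumann_coeff_nonneg g) auto
  qed
  also have "\<dots> = 1 / real (Suc n) * M" using neumann_coeff_sum[of "Suc n"] by (simp only: sum_distrib_right[symmetric] zero_less_Suc)
  also have "\<dots> = (norm x * norm y) ^ Suc n / fact (Suc n)" by (simp add: M_def)
  finally show ?case .
qed simp

lemma hom_part_deriv_bound: "\<bar>hom_part_deriv (Suc n) x h\<bar> \<le> norm h * norm y * ((norm x * norm y) ^ n / fact n)"
proof (induction n arbitrary: x h)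
  case 0
  have "\<bar>hom_part_deriv (Suc 0) x h\<bar> \<le> (\<Sum>g\<in>G. \<bar>neumann_coeff 1 g * (g h \<bullet> y)\<bar>)"
    using sum_abs[of "\<lambda>g. neumann_coeff 1 g * (g h \<bullet> y)" G] by simp
  also have "\<dots> \<le> (\<Sum>g\<in>G. neumann_coeff 1 g * (norm h * norm y))"
    using abs_inner_G[of _ h] neumann_coeff_nonneg[of _ 1] by (intro sum_mono) (simp add: abs_mult mult_left_mono)
  also have "\<dots> = norm h * norm y" using neumann_coeff_sum[of 1] by (simp add: sum_distrib_right[symmetric])
  finally show ?case by simp
next
  case (Suc n)
  define t where "t = norm x * norm y"
  define F where "F = t ^ Suc n / fact (Suc n)"
  define M where "M = norm h * norm y * F * (real n + 2)"
  have t: "t \<ge> 0" by (simp add: t_def)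
  have "\<bar>hom_part_deriv (Suc (Suc n)) x h\<bar> \<le> (\<Sum>g\<in>G. \<bar>neumann_coeff (Suc (Suc n)) g * ((g x \<bullet> y) * hom_part_deriv (Suc n) (g x) (g h) + (g h \<bullet> y) * hom_part (Suc n) (g x))\<bar>)"
    unfolding hom_part_deriv.simps(2)[of "Suc n"] by (rule sum_abs)
  also have "\<dots> \<le> (\<Sum>g\<in>G. neumann_coeff (Suc (Suc n)) g * M)"
  proof (rule sum_mono)
    fix g assume g: "g \<in> G"
    have 1: "\<bar>g x \<bullet> y\<bar> * \<bar>hom_part_deriv (Suc n) (g x) (g h)\<bar> \<le> t * (norm h * norm y * (t ^ n / fact n))"
      using Suc[of "g x" "g h"] abs_inner_G[OF g, of x] t by (intro mult_mono) (auto simp: G_norm[OF g] t_def simp del: hom_part_deriv.simps)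
    have 2: "\<bar>g h \<bullet> y\<bar> * \<bar>hom_part (Suc n) (g x)\<bar> \<le> (norm h * norm y) * F"
      unfolding F_def using hom_part_bound[of "Suc n" "g x"] abs_inner_G[OF g, of h] by (intro mult_mono) (auto simp: G_norm[OF g] t_def simp del: hom_part.simps)
    have f: "t ^ Suc n / fact n = F * (real n + 1)" by (simp add: F_def divide_simps)
    have "t * (norm h * norm y * (t ^ n / fact n)) = norm h * norm y * (t ^ Suc n / fact n)" by simp
    then have 3: "t * (norm h * norm y * (t ^ n / fact n)) + (norm h * norm y) * F = M"
      unfolding f M_def by (simp only:) (simp add: algebra_simps)
    have "\<bar>(g x \<bullet> y) * hom_part_deriv (Suc n) (g x) (g h) + (g h \<bullet> y) * hom_part (Suc n) (g x)\<bar> \<le> M"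
      using abs_triangle_ineq[of "(g x \<bullet> y) * hom_part_deriv (Suc n) (g x) (g h)" "(g h \<bullet> y) * hom_part (Suc n) (g x)"] 1 2 3
      by (simp only: abs_mult)
    then show "\<bar>neumann_coeff (Suc (Suc n)) g * ((g x \<bullet> y) * hom_part_deriv (Suc n) (g x) (g h) + (g h \<bullet> y) * hom_part (Suc n) (g x))\<bar> \<le> neumann_coeff (Suc (Suc n)) g * M"
      using neumann_coeff_nonneg[OF g, of "Suc (Suc n)"] by (simp add: abs_mult mult_left_mono del: hom_part.simps hom_part_deriv.simps)
  qed
  also have "\<dots> = 1 / real (Suc (Suc n)) * M" using neumann_coeff_sum[of "Suc (Suc n)"] by (simp only: sum_distrib_right[symmetric] zero_less_Suc)
  also have "\<dots> = norm h * norm y * F" by (simp add: M_def divide_simps)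
  finally show ?case by (simp only: t_def F_def)
qed

end

section \<open>Multivariate power series\<close>

definition mon :: "('n \<Rightarrow> nat) \<Rightarrow> real ^ 'n::finite \<Rightarrow> real"
  where "mon m z = (\<Prod>i\<in>UNIV. (z $ i) ^ m i)"

definition deg :: "('n::finite \<Rightarrow> nat) \<Rightarrow> nat"
  where "deg m = (\<Sum>i\<in>UNIV. m i)"

text \<open>M bounds a majorant norm of the coefficients. Under multiplication by an affine factor
  it grows by a controlled constant, which matches the recursion for the homogeneous
  components.\<close>

definition bounded_pser :: "real \<Rightarrow> real \<Rightarrow> (real ^ 'n::finite \<Rightarrow> real) \<Rightarrow> bool"
  where "bounded_pser r M f \<longleftrightarrow> (\<exists>c S. ((\<lambda>m. \<bar>c m\<bar> * r ^ deg m) has_sum S) UNIV \<and> S \<le> M \<and>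
    (\<forall>z\<in>ball 0 r. ((\<lambda>m. c m * mon m z) has_sum f z) UNIV))"

lemma mon_scale: "mon m (s *\<^sub>R z) = s ^ deg m * mon m z"
  by (simp add: mon_def deg_def power_mult_distrib prod.distrib power_sum)

lemma abs_mon_le:
  assumes "norm z \<le> r" shows "\<bar>mon m z\<bar> \<le> r ^ deg m"
proof -
  have "\<bar>mon m z\<bar> = (\<Prod>i\<in>UNIV. \<bar>z $ i\<bar> ^ m i)" by (simp add: mon_def abs_prod power_abs)
  also have "\<dots> \<le> (\<Prod>i\<in>UNIV. r ^ m i)"
  proof (intro prod_mono conjI power_mono)
    fix i show "\<bar>z $ i\<bar> \<le> r" using component_le_norm_cart[of z i] assms by simp
  qed auto
  also have "\<dots> = r ^ deg m" by (simp add: deg_def power_sum)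
  finally show ?thesis .
qed

lemma bounded_pser_mono: "bounded_pser r M f \<Longrightarrow> M \<le> M' \<Longrightarrow> bounded_pser r M' f"
  unfolding bounded_pser_def by (meson order_trans)

lemma bounded_pser_const: "bounded_pser r \<bar>a\<bar> (\<lambda>_ :: real ^ 'n::finite. a)"
proof -
  define c where "c = (\<lambda>m :: 'n \<Rightarrow> nat. if m = (\<lambda>_. 0) then a else 0)"
  have 1: "((\<lambda>m. \<bar>c m\<bar> * r ^ deg m) has_sum \<bar>a\<bar>) UNIV"
  proof -
    have "((\<lambda>m. \<bar>c m\<bar> * r ^ deg m) has_sum \<bar>a\<bar>) {\<lambda>_. 0}"
      by (rule has_sum_finiteI) (auto simp: c_def deg_def)
    then show ?thesis by (subst has_sum_cong_neutral[where T = "{\<lambda>_. 0}"]) (auto simp: c_def)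
  qed
  have 2: "((\<lambda>m. c m * mon m z) has_sum a) UNIV" for z
  proof -
    have "((\<lambda>m. c m * mon m z) has_sum a) {\<lambda>_. 0}"
      by (rule has_sum_finiteI) (auto simp: c_def mon_def)
    then show ?thesis by (subst has_sum_cong_neutral[where T = "{\<lambda>_. 0}"]) (auto simp: c_def)
  qed
  show ?thesis unfolding bounded_pser_def using 1 2
    by (intro exI[of _ c] exI[of _ "\<bar>a\<bar>"] conjI ballI) auto
qed

lemma bounded_pser_cmult: "bounded_pser r M f \<Longrightarrow> bounded_pser r (\<bar>a\<bar> * M) (\<lambda>z. a * f z)"
proof -
  assume "bounded_pser r M f"
  then obtain c S where c: "((\<lambda>m. \<bar>c m\<bar> * r ^ deg m) has_sum S) UNIV" "S \<le> M"
    "\<forall>z\<in>ball 0 r. ((\<lambda>m. c m * mon m z) has_sum f z) UNIV" by (auto simp: bounded_pser_def)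
  have "((\<lambda>m. \<bar>a * c m\<bar> * r ^ deg m) has_sum (\<bar>a\<bar> * S)) UNIV"
    using has_sum_cmult_right[OF c(1), of "\<bar>a\<bar>"] by (simp add: abs_mult mult.assoc)
  moreover have "((\<lambda>m. (a * c m) * mon m z) has_sum (a * f z)) UNIV" if "z \<in> ball 0 r" for z
    using has_sum_cmult_right[OF bspec[OF c(3) that], of a] by (simp add: mult.assoc)
  moreover have "\<bar>a\<bar> * S \<le> \<bar>a\<bar> * M" using c by (simp add: mult_left_mono)
  ultimately show ?thesis unfolding bounded_pser_def
    by (intro exI[of _ "\<lambda>m. a * c m"] exI[of _ "\<bar>a\<bar> * S"] conjI ballI) auto
qed

lemma bounded_pser_add:
  assumes "bounded_pser r M f" "bounded_pser r N g" "r \<ge> 0" shows "bounded_pser r (M + N) (\<lambda>z. f z + g z)"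
proof -
  obtain c S where c: "((\<lambda>m. \<bar>c m\<bar> * r ^ deg m) has_sum S) UNIV" "S \<le> M"
    "\<forall>z\<in>ball 0 r. ((\<lambda>m. c m * mon m z) has_sum f z) UNIV" using assms(1) by (auto simp: bounded_pser_def)
  obtain e T where e: "((\<lambda>m. \<bar>e m\<bar> * r ^ deg m) has_sum T) UNIV" "T \<le> N"
    "\<forall>z\<in>ball 0 r. ((\<lambda>m. e m * mon m z) has_sum g z) UNIV" using assms(2) by (auto simp: bounded_pser_def)
  have s: "((\<lambda>m. \<bar>c m\<bar> * r ^ deg m + \<bar>e m\<bar> * r ^ deg m) has_sum (S + T)) UNIV"
    using has_sum_add[OF c(1) e(1)] .
  have le: "\<bar>c m + e m\<bar> * r ^ deg m \<le> \<bar>c m\<bar> * r ^ deg m + \<bar>e m\<bar> * r ^ deg m" for m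
    unfolding distrib_right[symmetric] using assms(3) by (intro mult_right_mono abs_triangle_ineq) auto
  have sm: "(\<lambda>m. \<bar>c m + e m\<bar> * r ^ deg m) summable_on UNIV"
    by (rule summable_on_comparison_test[OF has_sum_imp_summable[OF s]]) (use le assms(3) in auto)
  have "infsum (\<lambda>m. \<bar>c m + e m\<bar> * r ^ deg m) UNIV \<le> S + T"
    by (rule has_sum_mono[OF has_sum_infsum[OF sm] s]) (rule le)
  moreover have "((\<lambda>m. (c m + e m) * mon m z) has_sum (f z + g z)) UNIV" if "z \<in> ball 0 r" for z
    using has_sum_add[OF bspec[OF c(3) that] bspec[OF e(3) that]] by (simp add: distrib_right)
  ultimately show ?thesis unfolding bounded_pser_def using has_sum_infsum[OF sm] c(2) e(2)
    by (intro exI[of _ "\<lambda>m. c m + e m"] exI[of _ "infsum (\<lambda>m. \<bar>c m + e m\<bar> * r ^ deg m) UNIV"] conjI ballI) auto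
qed

lemma bounded_pser_sum:
  assumes "finite A" "\<And>a. a \<in> A \<Longrightarrow> bounded_pser r (M a) (f a)" "r \<ge> 0"
  shows "bounded_pser r (\<Sum>a\<in>A. M a) (\<lambda>z. \<Sum>a\<in>A. f a z)"
  using assms(1,2)
proof (induction A)
  case empty
  then show ?case using bounded_pser_const[of r 0] by simp
next
  case (insert a A)
  then show ?case using bounded_pser_add[OF _ _ assms(3), of "M a" "f a"] by simp
qed

lemma bounded_pser_coord:
  fixes f :: "real ^ 'n::finite \<Rightarrow> real"
  assumes "bounded_pser r M f" "r \<ge> 0" shows "bounded_pser r (r * M) (\<lambda>z. z $ i * f z)"
proof -
  obtain c S where c: "((\<lambda>m. \<bar>c m\<bar> * r ^ deg m) has_sum S) UNIV" "S \<le> M"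
    "\<forall>z\<in>ball 0 r. ((\<lambda>m. c m * mon m z) has_sum f z) UNIV" using assms(1) by (auto simp: bounded_pser_def)
  define h where "h = (\<lambda>m :: 'n \<Rightarrow> nat. m(i := Suc (m i)))"
  define c' where "c' = (\<lambda>m. if m i = 0 then 0 else c (m(i := m i - 1)))"
  have inj: "inj h"
  proof (rule injI)
    fix m m' assume "h m = h m'"
    then have eq: "h m j = h m' j" for j by simp
    have "m j = m' j" for j using eq[of j] by (cases "j = i") (simp_all add: h_def)
    then show "m = m'" by (rule ext)
  qed
  have c'h: "c' (h m) = c m" for m by (simp add: c'_def h_def)
  have out: "c' m = 0" if "m \<notin> range h" for m
  proof (rule ccontr)
    assume "c' m \<noteq> 0"
    then have "m i \<noteq> 0" by (auto simp: c'_def split: if_splits)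
    then have "m = h (m(i := m i - 1))" by (auto simp: h_def)
    then show False using that by blast
  qed
  have mon: "mon (h m) z = z $ i * mon m z" for m z
    unfolding mon_def h_def by (subst (1 2) prod.remove[of UNIV i]) (auto simp: mult_ac intro!: prod.cong)
  have deg: "deg (h m) = Suc (deg m)" for m
    unfolding deg_def h_def by (subst (1 2) sum.remove[of UNIV i]) (auto intro!: sum.cong)
  have lift: "(F has_sum s) UNIV" if "((\<lambda>m. F (h m)) has_sum s) UNIV" "\<And>m. m \<notin> range h \<Longrightarrow> F m = 0" for F :: "('n \<Rightarrow> nat) \<Rightarrow> real" and s
  proof -
    have "(F has_sum s) (range h)" using that(1) has_sum_reindex[OF inj, of F s] by (simp add: comp_def)
    then show ?thesis by (subst has_sum_cong_neutral[where T = "range h" and g = F]) (use that(2) in auto)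
  qed
  have "((\<lambda>m. \<bar>c' m\<bar> * r ^ deg m) has_sum (r * S)) UNIV"
    by (rule lift) (use has_sum_cmult_right[OF c(1), of r] out in \<open>simp_all add: c'h deg mult_ac\<close>)
  moreover have "((\<lambda>m. c' m * mon m z) has_sum (z $ i * f z)) UNIV" if "z \<in> ball 0 r" for z
    by (rule lift) (use has_sum_cmult_right[OF bspec[OF c(3) that], of "z $ i"] out in \<open>simp_all add: c'h mon mult_ac\<close>)
  moreover have "r * S \<le> r * M" using c(2) assms(2) by (simp add: mult_left_mono)
  ultimately show ?thesis unfolding bounded_pser_def
    by (intro exI[of _ c'] exI[of _ "r * S"] conjI ballI) auto
qed

lemma bounded_pser_affine:
  assumes f: "bounded_pser r M f" and r: "r \<ge> 0" and M: "M \<ge> 0"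
  shows "bounded_pser r ((\<bar>a\<bar> + real CARD('n) * r * norm w) * M) (\<lambda>z. (a + z \<bullet> w) * f (z :: real ^ 'n::finite))"
proof -
  have P: "bounded_pser r (\<bar>a\<bar> * M + (\<Sum>i\<in>(UNIV :: 'n set). \<bar>w $ i\<bar> * (r * M))) (\<lambda>z. a * f z + (\<Sum>i\<in>UNIV. (w $ i) * (z $ i * f z)))"
    by (intro bounded_pser_add bounded_pser_sum bounded_pser_cmult bounded_pser_coord f r) auto
  have E: "a * f z + (\<Sum>i\<in>UNIV. (w $ i) * (z $ i * f z)) = (a + z \<bullet> w) * f z" for z
    by (simp add: inner_vec_def distrib_right sum_distrib_right distrib_left sum_distrib_left mult_ac)
  have "(\<Sum>i\<in>(UNIV :: 'n set). \<bar>w $ i\<bar> * (r * M)) \<le> (\<Sum>i\<in>(UNIV :: 'n set). norm w * (r * M))"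
    using r M by (intro sum_mono mult_right_mono component_le_norm_cart) auto
  then have "\<bar>a\<bar> * M + (\<Sum>i\<in>(UNIV :: 'n set). \<bar>w $ i\<bar> * (r * M)) \<le> (\<bar>a\<bar> + real CARD('n) * r * norm w) * M"
    by (simp add: algebra_simps)
  then show ?thesis using bounded_pser_mono[OF P] unfolding E by blast
qed

text \<open>Summable majorants make the family over pairs (n, m) absolutely summable, so the sum
  over n can be carried out coefficient by coefficient.\<close>

lemma bounded_pser_suminf:
  fixes f :: "nat \<Rightarrow> real ^ 'n::finite \<Rightarrow> real"
  assumes f: "\<And>n. bounded_pser r (M n) (f n)" and M: "summable M" and r: "r > 0"
    and F: "\<And>z. (\<lambda>n. f n z) sums F z"
  shows "\<exists>c. \<forall>z\<in>ball 0 r. ((\<lambda>m. c m * mon m z) has_sum F z) UNIV"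
proof -
  have "\<forall>n. \<exists>c S. ((\<lambda>m. \<bar>c m\<bar> * r ^ deg m) has_sum S) UNIV \<and> S \<le> M n \<and>
    (\<forall>z\<in>ball 0 r. ((\<lambda>m. c m * mon m z) has_sum f n z) UNIV)" using f by (simp add: bounded_pser_def)
  from choice[OF this] obtain c where "\<forall>n. \<exists>S. ((\<lambda>m. \<bar>c n m\<bar> * r ^ deg m) has_sum S) UNIV \<and> S \<le> M n \<and>
    (\<forall>z\<in>ball 0 r. ((\<lambda>m. c n m * mon m z) has_sum f n z) UNIV)" by blast
  from choice[OF this] obtain S where S': "\<forall>n. ((\<lambda>m. \<bar>c n m\<bar> * r ^ deg m) has_sum S n) UNIV \<and> S n \<le> M n \<and>
    (\<forall>z\<in>ball 0 r. ((\<lambda>m. c n m * mon m z) has_sum f n z) UNIV)" by blast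
  then have c: "\<And>n. ((\<lambda>m. \<bar>c n m\<bar> * r ^ deg m) has_sum S n) UNIV" "\<And>n. S n \<le> M n"
    "\<And>n z. z \<in> ball 0 r \<Longrightarrow> ((\<lambda>m. c n m * mon m z) has_sum f n z) UNIV" by simp_all
  have S0: "S n \<ge> 0" for n
    by (rule has_sum_mono[OF has_sum_0 c(1)[of n], of "\<lambda>_. 0"]) (use r in auto)
  have "summable S" by (rule summable_comparison_test'[OF M, of 0]) (use S0 c(2) in auto)
  then have S: "S summable_on UNIV" using summable_on_UNIV_nonneg_real_iff[of S] S0 by simp
  define N where "N = (\<lambda>p. \<bar>c (fst p) (snd p)\<bar> * r ^ deg (snd p))"
  have N: "N summable_on UNIV \<times> UNIV"
    by (rule summable_on_SigmaI[where g = S]) (use c(1) S r in \<open>auto simp: N_def\<close>)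
  define c' where "c' = (\<lambda>m. infsum (\<lambda>n. c n m) UNIV)"
  have "((\<lambda>m. c' m * mon m z) has_sum F z) UNIV" if z: "z \<in> ball 0 r" for z
  proof -
    define V where "V = (\<lambda>p. c (fst p) (snd p) * mon (snd p) z)"
    have "norm z \<le> r" using z by (simp add: dist_norm)
    have "(\<lambda>p. norm (V p)) summable_on UNIV \<times> UNIV"
      by (rule summable_on_comparison_test[OF N])
        (use abs_mon_le[OF \<open>norm z \<le> r\<close>] in \<open>auto simp: N_def V_def abs_mult intro!: mult_left_mono\<close>)
    then have V: "V summable_on UNIV \<times> UNIV" by (rule abs_summable_summable)
    define W where "W = infsum V (UNIV \<times> UNIV)"
    have VW: "(V has_sum W) (UNIV \<times> UNIV)" unfolding W_def using V by simp
    have "((\<lambda>n. f n z) has_sum W) UNIV"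
      by (rule has_sum_SigmaD[OF VW]) (use c(3)[OF z] in \<open>simp add: V_def\<close>)
    then have WF: "W = F z" using F[of z] has_sum_imp_sums sums_unique2 by blast
    have VW': "((\<lambda>(m,n). V (n,m)) has_sum W) (UNIV \<times> UNIV)" using has_sum_swap[THEN iffD1, OF VW] .
    have "((\<lambda>m. c' m * mon m z) has_sum W) UNIV"
    proof (rule has_sum_SigmaD[OF VW'])
      fix m
      have "(\<lambda>(m,n). N (n,m)) summable_on UNIV \<times> UNIV" using summable_on_swap[THEN iffD1, OF N] .
      then have "(\<lambda>n. N (n,m)) summable_on UNIV"
        using summable_on_SigmaD1[of "\<lambda>m n. N (n,m)" UNIV "\<lambda>_. UNIV" m] by simp
      then have "(\<lambda>n. (1 / r ^ deg m) * N (n, m)) summable_on UNIV" by (rule summable_on_cmult_right)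
      moreover have "(1 / r ^ deg m) * N (n, m) = norm (c n m)" for n using r by (simp add: N_def)
      ultimately have "(\<lambda>n. norm (c n m)) summable_on UNIV" by simp
      then have "(\<lambda>n. c n m) summable_on UNIV" by (rule abs_summable_summable)
      then have "((\<lambda>n. mon m z * c n m) has_sum (mon m z * c' m)) UNIV"
        unfolding c'_def by (intro has_sum_cmult_right has_sum_infsum)
      then show "((\<lambda>n. case (m, n) of (m, n) \<Rightarrow> V (n, m)) has_sum c' m * mon m z) UNIV" by (simp add: V_def mult.commute)
    qed
    then show ?thesis using WF by simp
  qed
  then show ?thesis by blast
qed

lemma finite_deg: "finite {m :: 'n::finite \<Rightarrow> nat. deg m = n}"
proof -
  have "{m :: 'n \<Rightarrow> nat. deg m = n} \<subseteq> UNIV \<rightarrow>\<^sub>E {..n}"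
  proof
    fix m :: "'n \<Rightarrow> nat" assume "m \<in> {m. deg m = n}"
    then have "m i \<le> n" for i using member_le_sum[of i UNIV m] by (auto simp: deg_def)
    then show "m \<in> UNIV \<rightarrow>\<^sub>E {..n}" by auto
  qed
  then show ?thesis by (rule finite_subset) (intro finite_PiE, auto)
qed

text \<open>Along a ray the monomials of equal degree merge into one power of t; grouping the
  multi-index series by degree gives an ordinary power series around s0, which can be
  differentiated.\<close>

lemma real_analytic_ray:
  assumes "real_analytic f"
  shows "\<exists>D. ((\<lambda>s. f (s *\<^sub>R p)) has_real_derivative D) (at s0)"
proof -
  obtain r c where r: "r > 0" and c: "\<forall>x\<in>ball (s0 *\<^sub>R p) r.
      ((\<lambda>m. c m * (\<Prod>i\<in>UNIV. (x $ i - (s0 *\<^sub>R p) $ i) ^ m i)) has_sum f x) UNIV"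
    using assms unfolding real_analytic_def by blast
  define d where "d = (\<lambda>n. \<Sum>m\<in>{m. deg m = n}. c m * mon m p)"
  define L where "L = r / (norm p + 1)"
  have L: "L > 0" using r by (simp add: L_def add_nonneg_pos)
  have sums: "(\<lambda>n. d n * t ^ n) sums f (s0 *\<^sub>R p + t *\<^sub>R p)" if t: "norm t < L" for t :: real
  proof -
    have "norm (t *\<^sub>R p) \<le> \<bar>t\<bar> * (norm p + 1)" by (simp add: mult_left_mono)
    also have "\<dots> < r" using t by (simp add: L_def pos_less_divide_eq add_nonneg_pos)
    finally have "s0 *\<^sub>R p + t *\<^sub>R p \<in> ball (s0 *\<^sub>R p) r" by (simp add: dist_norm)
    then have "((\<lambda>m. c m * (\<Prod>i\<in>UNIV. ((s0 *\<^sub>R p + t *\<^sub>R p) $ i - (s0 *\<^sub>R p) $ i) ^ m i)) has_sum f (s0 *\<^sub>R p + t *\<^sub>R p)) UNIV"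
      using c by blast
    moreover have "(\<Prod>i\<in>UNIV. ((s0 *\<^sub>R p + t *\<^sub>R p) $ i - (s0 *\<^sub>R p) $ i) ^ m i) = t ^ deg m * mon m p" for m
      using mon_scale[of m t p] by (simp add: mon_def)
    ultimately have hs: "((\<lambda>m. c m * (t ^ deg m * mon m p)) has_sum f (s0 *\<^sub>R p + t *\<^sub>R p)) UNIV" by simp
    have bij: "bij_betw snd (SIGMA n:UNIV. {m :: 'a \<Rightarrow> nat. deg m = n}) UNIV"
      by (rule bij_betwI[of _ _ _ "\<lambda>m. (deg m, m)"]) auto
    have "((\<lambda>q. c (snd q) * (t ^ deg (snd q) * mon (snd q) p)) has_sum f (s0 *\<^sub>R p + t *\<^sub>R p)) (SIGMA n:UNIV. {m. deg m = n})"
      using has_sum_reindex_bij_betw[OF bij, of "\<lambda>m. c m * (t ^ deg m * mon m p)"] hs by simp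
    then have "((\<lambda>n. d n * t ^ n) has_sum f (s0 *\<^sub>R p + t *\<^sub>R p)) UNIV"
    proof (rule has_sum_SigmaD)
      fix n
      show "((\<lambda>m. c (snd (n, m)) * (t ^ deg (snd (n, m)) * mon (snd (n, m)) p)) has_sum d n * t ^ n) {m. deg m = n}"
        unfolding d_def sum_distrib_right
        by (rule has_sum_finiteI[OF finite_deg]) (auto intro!: sum.cong simp: mult_ac)
    qed
    then show ?thesis by (rule has_sum_imp_sums)
  qed
  define g where "g = (\<lambda>t. \<Sum>n. d n * t ^ n)"
  have g: "(g has_real_derivative (\<Sum>n. diffs d n * 0 ^ n)) (at (s0 - s0))"
    unfolding g_def using termdiffs_strong'[of L d 0] sums L by (auto simp: sums_iff)
  have gd: "((\<lambda>s. g (s - s0)) has_real_derivative (\<Sum>n. diffs d n * 0 ^ n) * 1) (at s0)"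
    by (rule DERIV_chain2[where f = g and g = "\<lambda>s. s - s0", OF g]) (auto intro!: derivative_eq_intros)
  have "\<forall>\<^sub>F s in nhds s0. s \<in> ball s0 L" using L by (intro eventually_nhds_in_open) auto
  then have ev: "\<forall>\<^sub>F s in nhds s0. g (s - s0) = f (s *\<^sub>R p)"
  proof eventually_elim
    case (elim s)
    then have "norm (s - s0) < L" by (simp add: dist_norm norm_minus_commute abs_minus_commute)
    from sums[OF this] show ?case by (simp add: g_def sums_iff algebra_simps)
  qed
  show ?thesis using gd DERIV_cong_ev[OF refl ev refl] by blast
qed

section \<open>Existence and uniqueness of the Dunkl kernel\<close>

context dunkl_eigen
begin

definition is_kernel where
  "is_kernel f \<longleftrightarrow> real_analytic f \<and> (\<forall>\<xi> z. dunkl_operator R k \<xi> f z = (\<xi> \<bullet> y) * f z) \<and> f 0 = 1"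

text \<open>The equation is used at s p in the direction p itself. The factor a \<bullet> p then
  cancels the denominator, and when it is zero the term vanishes whatever value the quotient has
  there. Thus only values on rays through the orbit remain.\<close>

lemma kernel_ray:
  assumes f: "is_kernel f" and s: "s \<noteq> 0"
  shows "((\<lambda>s. f (s *\<^sub>R p)) has_real_derivative
    ((p \<bullet> y) * f (s *\<^sub>R p) - (\<Sum>a\<in>R. kap a * (f (s *\<^sub>R p) - f (s *\<^sub>R root_reflection a p))) / s)) (at s)"
proof -
  obtain D where D: "((\<lambda>s. f (s *\<^sub>R p)) has_real_derivative D) (at s)"
    using real_analytic_ray f by (metis is_kernel_def)
  have "((\<lambda>t. f ((t + s) *\<^sub>R p)) has_real_derivative D) (at 0)"
    using DERIV_shift[of "\<lambda>s. f (s *\<^sub>R p)" D 0 s] D by simp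
  then have "deriv (\<lambda>t. f (s *\<^sub>R p + t *\<^sub>R p)) 0 = D"
    by (intro DERIV_imp_deriv) (simp add: algebra_simps)
  moreover have "(\<Sum>a\<in>R. k a / 2 * (a \<bullet> p) * reflection_quotient a f (s *\<^sub>R p)) =
    (\<Sum>a\<in>R. kap a * (f (s *\<^sub>R p) - f (s *\<^sub>R root_reflection a p)) / s)"
  proof (intro sum.cong refl)
    fix a assume a: "a \<in> R"
    have lin: "root_reflection a (s *\<^sub>R p) = s *\<^sub>R root_reflection a p" by (rule linear_scale[OF linear_refl])
    show "k a / 2 * (a \<bullet> p) * reflection_quotient a f (s *\<^sub>R p) = kap a * (f (s *\<^sub>R p) - f (s *\<^sub>R root_reflection a p)) / s"
    proof (cases "a \<bullet> p = 0")
      case True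
      then have "root_reflection a p = p" using a by (simp add: refl_eq inner_commute)
      then show ?thesis using True by simp
    next
      case False
      then show ?thesis using s by (simp add: reflection_quotient_def lin kap_def)
    qed
  qed
  ultimately have "dunkl_operator R k p f (s *\<^sub>R p) = D + (\<Sum>a\<in>R. kap a * (f (s *\<^sub>R p) - f (s *\<^sub>R root_reflection a p)) / s)"
    by (simp add: dunkl_operator_def)
  then have "D = (p \<bullet> y) * f (s *\<^sub>R p) - (\<Sum>a\<in>R. kap a * (f (s *\<^sub>R p) - f (s *\<^sub>R root_reflection a p))) / s"
    using f by (simp add: is_kernel_def sum_divide_distrib)
  then show ?thesis using D by simp
qed

lemma kernel_ray_cont:
  assumes "is_kernel f" shows "continuous_on S (\<lambda>s. f (s *\<^sub>R p))"
  using real_analytic_ray[of f p] assms unfolding is_kernel_def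
  by (meson DERIV_isCont continuous_at_imp_continuous_on)

text \<open>The differences on the rays through the orbit of p solve a homogeneous linear system
  with zero initial values. The zeroth-order coefficient is at most |p| |y|, the constant of the
  maximum principle. Exchanging f and h gives uniqueness.\<close>

lemma kernel_le:
  assumes f: "is_kernel f" and h: "is_kernel h"
  shows "f p \<le> h p"
proof -
  define z where "z = (\<lambda>g s. f (s *\<^sub>R g p) - h (s *\<^sub>R g p))"
  define z' where "z' = (\<lambda>g s. ((g p \<bullet> y) * f (s *\<^sub>R g p) - (\<Sum>a\<in>R. kap a * (f (s *\<^sub>R g p) - f (s *\<^sub>R root_reflection a (g p)))) / s)
    - ((g p \<bullet> y) * h (s *\<^sub>R g p) - (\<Sum>a\<in>R. kap a * (h (s *\<^sub>R g p) - h (s *\<^sub>R root_reflection a (g p)))) / s))"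
  have "z id 1 \<le> 0"
  proof (rule max_principle[where I = G and C = "norm p * norm y" and z = z and z' = z' and a = 0 and b = 1])
    fix g assume g: "g \<in> G"
    show "continuous_on {0..1} (z g)" unfolding z_def by (intro continuous_intros kernel_ray_cont f h)
    show "z g 0 \<le> 0" using f h by (simp add: z_def is_kernel_def)
    fix s :: real assume s: "0 < s" "s \<le> 1"
    show "(z g has_real_derivative z' g s) (at s)"
      unfolding z_def z'_def using s by (intro DERIV_diff kernel_ray f h) auto
    assume pos: "z g s > 0" and max: "\<And>j. j \<in> G \<Longrightarrow> z j s \<le> z g s"
    have "z' g s = (g p \<bullet> y) * z g s - (\<Sum>a\<in>R. kap a * (z g s - z (root_reflection a \<circ> g) s)) / s"
    proof -
      define A where "A = (\<Sum>a\<in>R. kap a * (f (s *\<^sub>R g p) - f (s *\<^sub>R root_reflection a (g p))))"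
      define B where "B = (\<Sum>a\<in>R. kap a * (h (s *\<^sub>R g p) - h (s *\<^sub>R root_reflection a (g p))))"
      have "(\<Sum>a\<in>R. kap a * (z g s - z (root_reflection a \<circ> g) s)) = A - B"
        unfolding A_def B_def sum_subtractf[symmetric] by (intro sum.cong) (auto simp: z_def algebra_simps)
      then show ?thesis
        by (simp add: z'_def A_def[symmetric] B_def[symmetric]) (simp add: z_def algebra_simps diff_divide_distrib)
    qed
    also have "(\<Sum>a\<in>R. kap a * (z g s - z (root_reflection a \<circ> g) s)) \<ge> 0"
    proof (intro sum_nonneg mult_nonneg_nonneg kap_nonneg)
      fix a assume "a \<in> R"
      then show "z g s - z (root_reflection a \<circ> g) s \<ge> 0" using max[of "root_reflection a \<circ> g"] g by force
    qed
    then have "(g p \<bullet> y) * z g s - (\<Sum>a\<in>R. kap a * (z g s - z (root_reflection a \<circ> g) s)) / s \<le> (g p \<bullet> y) * z g s"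
      using s by simp
    also have "\<dots> \<le> norm p * norm y * z g s"
      using abs_inner_G[OF g, of p] pos by (intro mult_right_mono) auto
    finally show "z' g s \<le> norm p * norm y * z g s" .
  qed auto
  then show ?thesis by (simp add: z_def)
qed

lemma kernel_unique: "is_kernel f \<Longrightarrow> is_kernel h \<Longrightarrow> f = h"
  using kernel_le by (meson antisym ext)

subsection \<open>The series\<close>

definition kernel_series where "kernel_series x = (\<Sum>n. hom_part n x)"
definition kernel_series_deriv where "kernel_series_deriv x h = (\<Sum>n. hom_part_deriv n x h)"
definition majorant :: "real \<Rightarrow> nat \<Rightarrow> real"
  where "majorant r n = (case n of 0 \<Rightarrow> 0 | Suc m \<Rightarrow> norm y * ((r * norm y) ^ m / fact m))"

lemma exp_terms_summable: "summable (\<lambda>n. (t::real) ^ n / fact n)"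
  using summable_exp[of t] by (simp add: divide_inverse mult.commute)

lemma majorant_summable: "summable (majorant r)"
  by (subst summable_Suc_iff[symmetric]) (simp only: majorant_def nat.case, intro summable_mult exp_terms_summable)

lemma hom_part_deriv_majorized: "norm x \<le> r \<Longrightarrow> \<bar>hom_part_deriv n x h\<bar> \<le> norm h * majorant r n"
proof (cases n)
  case (Suc m)
  assume r: "norm x \<le> r"
  have "\<bar>hom_part_deriv (Suc m) x h\<bar> \<le> norm h * norm y * ((norm x * norm y) ^ m / fact m)" by (rule hom_part_deriv_bound)
  also have "\<dots> \<le> norm h * norm y * ((r * norm y) ^ m / fact m)"
    using r by (intro mult_left_mono divide_right_mono power_mono mult_right_mono) auto
  finally show ?thesis by (simp add: Suc majorant_def mult_ac del: hom_part_deriv.simps)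
qed (simp add: majorant_def)

lemma hom_part_sums: "(\<lambda>n. hom_part n x) sums kernel_series x"
proof -
  have "summable (\<lambda>n. hom_part n x)"
    by (rule summable_comparison_test'[OF exp_terms_summable[of "norm x * norm y"], of 0]) (use hom_part_bound in auto)
  then show ?thesis by (simp add: kernel_series_def sums_iff)
qed

lemma hom_part_deriv_summable: "summable (\<lambda>n. hom_part_deriv n x h)"
  by (rule summable_comparison_test'[OF summable_mult[OF majorant_summable[of "norm x"], of "norm h"], of 0]) (use hom_part_deriv_majorized in auto)

lemma hom_part_deriv_sums: "(\<lambda>n. hom_part_deriv n x h) sums kernel_series_deriv x h"
  using hom_part_deriv_summable by (simp add: kernel_series_deriv_def sums_iff)

lemma kernel_series_deriv: "(kernel_series has_derivative kernel_series_deriv x) (at x)"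
proof -
  define S where "S = ball (0 :: real^'n) (norm x + 1)"
  have xS: "x \<in> S" by (simp add: S_def)
  have "\<exists>g. \<forall>x\<in>S. (\<lambda>n. hom_part n x) sums g x \<and> (g has_derivative kernel_series_deriv x) (at x within S)"
  proof (rule has_derivative_series[of S hom_part hom_part_deriv kernel_series_deriv x "kernel_series x"])
    show "convex S" by (simp add: S_def)
    show "(hom_part n has_derivative hom_part_deriv n z) (at z within S)" for n z
      using hom_part_deriv has_derivative_at_withinI by blast
    show "\<forall>\<^sub>F n in sequentially. \<forall>z\<in>S. \<forall>h. norm (sum (\<lambda>i. hom_part_deriv i z h) {..<n} - kernel_series_deriv z h) \<le> e * norm h" if e: "e > 0" for e
    proof -
      define r where "r = norm x + 1"
      obtain N where N: "\<And>n. n \<ge> N \<Longrightarrow> norm (\<Sum>i. majorant r (i + n)) < e"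
        using suminf_exist_split[OF e majorant_summable] by blast
      have "norm (sum (\<lambda>i. hom_part_deriv i z h) {..<n} - kernel_series_deriv z h) \<le> e * norm h" if n: "n \<ge> N" and z: "z \<in> S" for n z h
      proof -
        have zr: "norm z \<le> r" using z by (simp add: S_def r_def)
        have sh: "summable (\<lambda>i. norm h * majorant r (i + n))"
          by (intro summable_mult summable_ignore_initial_segment majorant_summable)
        have "kernel_series_deriv z h - sum (\<lambda>i. hom_part_deriv i z h) {..<n} = (\<Sum>i. hom_part_deriv (i + n) z h)"
          unfolding kernel_series_deriv_def using suminf_minus_initial_segment[OF hom_part_deriv_summable] by simp
        then have "norm (sum (\<lambda>i. hom_part_deriv i z h) {..<n} - kernel_series_deriv z h) = norm (\<Sum>i. hom_part_deriv (i + n) z h)"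
          by (metis norm_minus_commute)
        also have "\<dots> \<le> (\<Sum>i. norm h * majorant r (i + n))"
          by (rule norm_suminf_le[OF _ sh]) (use hom_part_deriv_majorized[OF zr] in auto)
        also have "\<dots> = norm h * (\<Sum>i. majorant r (i + n))"
          by (intro suminf_mult summable_ignore_initial_segment majorant_summable)
        also have "\<dots> \<le> norm h * e" using N[OF n] by (intro mult_left_mono) auto
        finally show ?thesis by (simp add: mult.commute)
      qed
      then show ?thesis by (auto simp: eventually_sequentially)
    qed
  qed (use xS hom_part_sums in auto)
  then obtain g where g: "\<And>x. x \<in> S \<Longrightarrow> (\<lambda>n. hom_part n x) sums g x" "\<And>x. x \<in> S \<Longrightarrow> (g has_derivative kernel_series_deriv x) (at x within S)"
    by blast
  have "g z = kernel_series z" if "z \<in> S" for z using g(1)[OF that] hom_part_sums sums_unique2 by blast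
  then have "(kernel_series has_derivative kernel_series_deriv x) (at x within S)"
    using has_derivative_transform[OF xS _ g(2)[OF xS]] by simp
  then show ?thesis using at_within_open[OF xS] by (simp add: S_def)
qed

lemma kernel_series_deriv_isCont: "isCont (\<lambda>z. kernel_series_deriv z h) x"
proof -
  define S where "S = ball (0 :: real^'n) (norm x + 1)"
  have xS: "x \<in> S" "open S" by (auto simp: S_def)
  have "continuous_on S (\<lambda>z. suminf (\<lambda>i. hom_part_deriv i z h))"
  proof (rule uniform_limit_theorem)
    show "uniform_limit S (\<lambda>n z. \<Sum>i<n. hom_part_deriv i z h) (\<lambda>z. suminf (\<lambda>i. hom_part_deriv i z h)) sequentially"
      by (rule Weierstrass_m_test[where M = "\<lambda>n. norm h * majorant (norm x + 1) n"])
        (use hom_part_deriv_majorized in \<open>auto simp: S_def intro!: summable_mult majorant_summable\<close>)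
    show "\<forall>\<^sub>F n in sequentially. continuous_on S (\<lambda>z. \<Sum>i<n. hom_part_deriv i z h)"
    proof (intro always_eventually allI continuous_on_sum)
      fix i
      obtain F'' where F: "\<And>x h. ((\<lambda>z. hom_part_deriv i z h) has_derivative (\<lambda>j. F'' x j h)) (at x)" using hom_part_deriv_deriv[of i] by metis
      show "continuous_on S (\<lambda>z. hom_part_deriv i z h)"
        by (intro continuous_at_imp_continuous_on ballI has_derivative_continuous[OF F])
    qed
  qed auto
  then show ?thesis using xS by (simp add: kernel_series_deriv_def continuous_on_eq_continuous_at)
qed

lemma kernel_series_isCont: "isCont kernel_series x"
  using kernel_series_deriv has_derivative_continuous by blast

lemma kernel_series_eigen:
  assumes x: "regular x"
  shows "dunkl_op kernel_series_deriv kernel_series v x = (v \<bullet> y) * kernel_series x"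
proof -
  have "(\<lambda>n. dunkl_op (hom_part_deriv n) (hom_part n) v x) sums dunkl_op kernel_series_deriv kernel_series v x"
    unfolding dunkl_op_def refl_quot_def
    by (intro sums_add sums_sum sums_mult sums_divide sums_diff hom_part_deriv_sums hom_part_sums)
  moreover have "(\<lambda>n. dunkl_op (hom_part_deriv (Suc n)) (hom_part (Suc n)) v x) sums ((v \<bullet> y) * kernel_series x)"
    unfolding hom_part_eigen[OF x] by (intro sums_mult hom_part_sums)
  then have "(\<lambda>n. dunkl_op (hom_part_deriv n) (hom_part n) v x) sums ((v \<bullet> y) * kernel_series x + dunkl_op (hom_part_deriv 0) (hom_part 0) v x)"
    by (rule sums_Suc)
  moreover have "dunkl_op (hom_part_deriv 0) (hom_part 0) v x = 0" by (simp add: dunkl_op_def refl_quot_def)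
  ultimately show ?thesis using sums_unique2 by fastforce
qed

text \<open>The mean value theorem on the segment from z to its reflection, whose direction is a. It
  expresses the difference quotient as a derivative at a nearby point, and so gives its limit on the
  hyperplane.\<close>

lemma kernel_series_mvt:
  assumes a: "a \<in> R"
  shows "\<exists>t\<in>{0..1}. kernel_series z - kernel_series (root_reflection a z) = (a \<bullet> z) * kernel_series_deriv (z - (t * (a \<bullet> z)) *\<^sub>R a) a"
proof -
  define c where "c = a \<bullet> z"
  define f where "f = (\<lambda>t. kernel_series (z - (t * c) *\<^sub>R a))"
  have "(f has_real_derivative - c * kernel_series_deriv (z - (t * c) *\<^sub>R a) a) (at t)" for t
  proof -
    have "((\<lambda>t. z - (t * c) *\<^sub>R a) has_derivative (\<lambda>s. - ((s * c) *\<^sub>R a))) (at t)"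
      by (auto intro!: derivative_eq_intros)
    from has_derivative_compose[OF this kernel_series_deriv]
    have "(f has_derivative (\<lambda>s. kernel_series_deriv (z - (t * c) *\<^sub>R a) (- ((s * c) *\<^sub>R a)))) (at t)" by (simp add: f_def)
    also have "(\<lambda>s. kernel_series_deriv (z - (t * c) *\<^sub>R a) (- ((s * c) *\<^sub>R a))) = (\<lambda>s. s * (- c * kernel_series_deriv (z - (t * c) *\<^sub>R a) a))"
      using has_derivative_linear[OF kernel_series_deriv[of "z - (t * c) *\<^sub>R a"]] by (simp add: linear_neg linear_scale mult.assoc)
    finally show ?thesis by (simp only: has_field_derivative_def mult_commute_abs)
  qed
  then obtain t where t: "t > 0" "t < 1" "f 1 - f 0 = (1 - 0) * (- c * kernel_series_deriv (z - (t * c) *\<^sub>R a) a)"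
    using MVT2[of 0 1 f "\<lambda>t. - c * kernel_series_deriv (z - (t * c) *\<^sub>R a) a"] by auto
  have "f 1 = kernel_series (root_reflection a z)" "f 0 = kernel_series z" using a by (simp_all add: f_def c_def refl_eq inner_commute)
  then show ?thesis using t by (intro bexI[of _ t]) (auto simp: c_def)
qed

definition quot_limit where "quot_limit a x = (if a \<bullet> x \<noteq> 0 then refl_quot a kernel_series x else kernel_series_deriv x a)"

lemma refl_quot_tendsto:
  assumes a: "a \<in> R"
  shows "(refl_quot a kernel_series \<longlongrightarrow> quot_limit a x) (at x within {z. a \<bullet> z \<noteq> 0})"
proof (cases "a \<bullet> x = 0")
  case True
  obtain t where t: "\<And>z. t z \<in> {0..1}" "\<And>z. kernel_series z - kernel_series (root_reflection a z) = (a \<bullet> z) * kernel_series_deriv (z - (t z * (a \<bullet> z)) *\<^sub>R a) a"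
    using kernel_series_mvt[OF a] by metis
  have "((\<lambda>z. t z * (a \<bullet> z)) \<longlongrightarrow> 0) (at x within {z. a \<bullet> z \<noteq> 0})"
  proof (rule Lim_null_comparison)
    show "\<forall>\<^sub>F z in at x within {z. a \<bullet> z \<noteq> 0}. norm (t z * (a \<bullet> z)) \<le> \<bar>a \<bullet> z\<bar>"
      using t(1) by (intro always_eventually allI) (auto simp: abs_mult intro!: mult_left_le_one_le)
    have "((\<lambda>z. \<bar>a \<bullet> z\<bar>) \<longlongrightarrow> \<bar>a \<bullet> x\<bar>) (at x within {z. a \<bullet> z \<noteq> 0})" by (intro tendsto_intros)
    then show "((\<lambda>z. \<bar>a \<bullet> z\<bar>) \<longlongrightarrow> 0) (at x within {z. a \<bullet> z \<noteq> 0})" using True by simp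
  qed
  then have "((\<lambda>z. z - (t z * (a \<bullet> z)) *\<^sub>R a) \<longlongrightarrow> x - 0 *\<^sub>R a) (at x within {z. a \<bullet> z \<noteq> 0})"
    by (intro tendsto_intros)
  then have "((\<lambda>z. kernel_series_deriv (z - (t z * (a \<bullet> z)) *\<^sub>R a) a) \<longlongrightarrow> kernel_series_deriv x a) (at x within {z. a \<bullet> z \<noteq> 0})"
    using isCont_tendsto_compose[OF kernel_series_deriv_isCont] by simp
  moreover have "\<forall>\<^sub>F z in at x within {z. a \<bullet> z \<noteq> 0}. kernel_series_deriv (z - (t z * (a \<bullet> z)) *\<^sub>R a) a = refl_quot a kernel_series z"
    by (simp add: eventually_at_filter refl_quot_def t(2))
  ultimately show ?thesis using True by (simp add: quot_limit_def tendsto_cong)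
next
  case False
  have lin: "isCont (root_reflection a) x" using linear_refl[of a] by (simp add: linear_continuous_at linear_conv_bounded_linear)
  have "isCont (refl_quot a kernel_series) x" unfolding refl_quot_def[abs_def]
    by (intro continuous_intros kernel_series_isCont isCont_o2[OF lin kernel_series_isCont] False)
  then have "(refl_quot a kernel_series \<longlongrightarrow> refl_quot a kernel_series x) (at x within {z. a \<bullet> z \<noteq> 0})"
    unfolding isCont_def by (rule Lim_at_imp_Lim_at_within)
  then show ?thesis using False by (simp add: quot_limit_def)
qed

text \<open>Regular points are dense, so a limit along them is unique; this is how identities reach
  the root hyperplanes.\<close>

lemma at_within_regular: "at x within {z. regular z} \<noteq> bot"
proof -
  have "x islimpt {z. regular z}"
  proof (rule islimptI)
    fix T :: "(real^'n) set" assume T: "x \<in> T" "open T"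
    have "T \<noteq> {x}"
    proof
      assume "T = {x}"
      then show False using T(2) not_open_singleton[of x] by simp
    qed
    then obtain v where "v \<in> T - {x}" using T(1) by blast
    moreover have "open (T - {x})" using T by auto
    moreover have "0 \<notin> R" using root_nonzero by blast
    ultimately obtain w where "w \<in> T - {x}" "\<And>f. f \<in> R \<Longrightarrow> w \<bullet> f \<noteq> 0"
      using generic_point[OF finR, of "T - {x}" v] by metis
    then show "\<exists>y\<in>{z. regular z}. y \<in> T \<and> y \<noteq> x" by (auto simp: regular_def)
  qed
  then show ?thesis by (simp add: trivial_limit_within)
qed

lemma regular_sub: "a \<in> R \<Longrightarrow> {z. regular z} \<subseteq> {z. a \<bullet> z \<noteq> 0}"
  by (auto simp: regular_def inner_commute)

lemma reflection_quotient_kernel_series: "a \<in> R \<Longrightarrow> reflection_quotient a kernel_series x = quot_limit a x"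
proof (cases "a \<bullet> x = 0")
  case True
  assume a: "a \<in> R"
  have "at x within {z. a \<bullet> z \<noteq> 0} \<noteq> bot"
    using at_within_regular at_le[OF regular_sub[OF a], of x] by (metis bot.extremum_uniqueI)
  then have "Lim (at x within {z. a \<bullet> z \<noteq> 0}) (\<lambda>z. (kernel_series z - kernel_series (root_reflection a z)) / (a \<bullet> z)) = quot_limit a x"
    using tendsto_Lim[OF _ refl_quot_tendsto[OF a, of x]] by (simp add: refl_quot_def[abs_def])
  then show ?thesis using True by (simp add: reflection_quotient_def)
qed (simp add: reflection_quotient_def quot_limit_def refl_quot_def)

text \<open>At regular points this is the termwise eigenvalue equation. The derivative and the
  extended quotients are limits along regular points, so the equation passes to every point.\<close>

lemma dunkl_operator_kernel_series: "dunkl_operator R k v kernel_series x = (v \<bullet> y) * kernel_series x"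
proof -
  have "((\<lambda>s. x + s *\<^sub>R v) has_derivative (\<lambda>s. s *\<^sub>R v)) (at 0)" by (auto intro!: derivative_eq_intros)
  from has_derivative_compose[OF this kernel_series_deriv]
  have "((\<lambda>s. kernel_series (x + s *\<^sub>R v)) has_derivative (\<lambda>s. kernel_series_deriv x (s *\<^sub>R v))) (at 0)" by simp
  then have "((\<lambda>s. kernel_series (x + s *\<^sub>R v)) has_real_derivative kernel_series_deriv x v) (at 0)"
    using has_derivative_linear[OF kernel_series_deriv[of x]] by (simp add: has_field_derivative_def mult_commute_abs linear_scale)
  then have "deriv (\<lambda>s. kernel_series (x + s *\<^sub>R v)) 0 = kernel_series_deriv x v" by (rule DERIV_imp_deriv)
  then have op: "dunkl_operator R k v kernel_series x = kernel_series_deriv x v + (\<Sum>a\<in>R. kap a * ((a \<bullet> v) * quot_limit a x))"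
    by (simp add: dunkl_operator_def reflection_quotient_kernel_series kap_def mult_ac)
  have "((\<lambda>z. dunkl_op kernel_series_deriv kernel_series v z - (v \<bullet> y) * kernel_series z) \<longlongrightarrow>
      (kernel_series_deriv x v + (\<Sum>a\<in>R. kap a * ((a \<bullet> v) * quot_limit a x))) - (v \<bullet> y) * kernel_series x) (at x within {z. regular z})"
    unfolding dunkl_op_def
  proof (intro tendsto_intros)
    show "((\<lambda>z. kernel_series_deriv z v) \<longlongrightarrow> kernel_series_deriv x v) (at x within {z. regular z})"
      using kernel_series_deriv_isCont unfolding isCont_def by (rule Lim_at_imp_Lim_at_within)
    show "(kernel_series \<longlongrightarrow> kernel_series x) (at x within {z. regular z})"
      using kernel_series_isCont unfolding isCont_def by (rule Lim_at_imp_Lim_at_within)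
    show "(refl_quot a kernel_series \<longlongrightarrow> quot_limit a x) (at x within {z. regular z})" if "a \<in> R" for a
      using tendsto_within_subset[OF refl_quot_tendsto[OF that] regular_sub[OF that]] .
  qed
  moreover have "((\<lambda>z. dunkl_op kernel_series_deriv kernel_series v z - (v \<bullet> y) * kernel_series z) \<longlongrightarrow> 0) (at x within {z. regular z})"
    by (rule tendsto_eventually) (simp add: eventually_at_filter kernel_series_eigen)
  ultimately have "(kernel_series_deriv x v + (\<Sum>a\<in>R. kap a * ((a \<bullet> v) * quot_limit a x))) - (v \<bullet> y) * kernel_series x = 0"
    using tendsto_unique[OF at_within_regular] by blast
  then show ?thesis using op by simp
qed

text \<open>The recursion is expanded around an arbitrary centre a. Each linear factor is affine in
  z with slope of norm |y|, as G acts by isometries; so every degree multiplies the bound by the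
  same constant and divides it by the degree.\<close>

lemma hom_part_bounded_pser:
  assumes r: "r \<ge> 0"
  shows "g \<in> G \<Longrightarrow> bounded_pser r ((norm a * norm y + real CARD('n) * r * norm y) ^ n / fact n) (\<lambda>z. hom_part n (g (a + z)))"
proof (induction n arbitrary: g)
  case 0
  then show ?case using bounded_pser_const[of r 1] by simp
next
  case (Suc n)
  define C where "C = norm a * norm y + real CARD('n) * r * norm y"
  have C: "C \<ge> 0" using r by (simp add: C_def)
  have "bounded_pser r (\<Sum>h\<in>G. \<bar>neumann_coeff (Suc n) h\<bar> * (C * (C ^ n / fact n)))
    (\<lambda>z. \<Sum>h\<in>G. neumann_coeff (Suc n) h * ((h (g (a + z)) \<bullet> y) * hom_part n (h (g (a + z)))))"
  proof (intro bounded_pser_sum bounded_pser_cmult finite_G r)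
    fix h assume h: "h \<in> G"
    have hg: "h \<circ> g \<in> G" using h Suc.prems by auto
    define w where "w = ginv (h \<circ> g) y"
    have nw: "norm w = norm y" using hg by (simp add: w_def G_norm[OF inv_in_G[OF hg]])
    have inner: "h (g (a + z)) \<bullet> y = (h \<circ> g) a \<bullet> y + z \<bullet> w" for z
    proof -
      have "(h \<circ> g) z \<bullet> y = z \<bullet> w" using G_inner_inv[OF hg, of y z] by (simp add: w_def inner_commute)
      then show ?thesis using linear_add[OF G_linear[OF hg], of a z] by (simp add: inner_add_left)
    qed
    have "bounded_pser r ((\<bar>(h \<circ> g) a \<bullet> y\<bar> + real CARD('n) * r * norm w) * (C ^ n / fact n))
       (\<lambda>z. ((h \<circ> g) a \<bullet> y + z \<bullet> w) * hom_part n ((h \<circ> g) (a + z)))"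
      using Suc.IH[OF hg] C r by (intro bounded_pser_affine) (auto simp: C_def)
    then have "bounded_pser r (C * (C ^ n / fact n)) (\<lambda>z. ((h \<circ> g) a \<bullet> y + z \<bullet> w) * hom_part n ((h \<circ> g) (a + z)))"
    proof (rule bounded_pser_mono)
      show "(\<bar>(h \<circ> g) a \<bullet> y\<bar> + real CARD('n) * r * norm w) * (C ^ n / fact n) \<le> C * (C ^ n / fact n)"
        using abs_inner_G[OF hg, of a] C by (intro mult_right_mono) (auto simp: C_def nw)
    qed
    then show "bounded_pser r (C * (C ^ n / fact n)) (\<lambda>z. (h (g (a + z)) \<bullet> y) * hom_part n (h (g (a + z))))"
      unfolding inner by simp
  qed
  moreover have "(\<Sum>h\<in>G. \<bar>neumann_coeff (Suc n) h\<bar> * (C * (C ^ n / fact n))) = C ^ Suc n / fact (Suc n)"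
  proof -
    have "(\<Sum>h\<in>G. \<bar>neumann_coeff (Suc n) h\<bar> * (C * (C ^ n / fact n))) = (\<Sum>h\<in>G. neumann_coeff (Suc n) h) * (C * (C ^ n / fact n))"
      unfolding sum_distrib_right using neumann_coeff_nonneg by (intro sum.cong) auto
    then show ?thesis by (simp add: neumann_coeff_sum)
  qed
  ultimately show ?case by (simp add: C_def)
qed

lemma kernel_series_real_analytic: "real_analytic kernel_series"
  unfolding real_analytic_def
proof
  fix a :: "real ^ 'n"
  define C where "C = norm a * norm y + real CARD('n) * 1 * norm y"
  have "\<exists>c. \<forall>z\<in>ball 0 1. ((\<lambda>m. c m * mon m z) has_sum kernel_series (a + z)) UNIV"
  proof (rule bounded_pser_suminf[where M = "\<lambda>n. C ^ n / fact n" and f = "\<lambda>n z. hom_part n (a + z)"])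
    show "bounded_pser 1 (C ^ n / fact n) (\<lambda>z. hom_part n (a + z))" for n
      using hom_part_bounded_pser[of 1 id a n] by (simp add: C_def)
  qed (use exp_terms_summable hom_part_sums in auto)
  then obtain c where c: "\<And>z. z \<in> ball 0 1 \<Longrightarrow> ((\<lambda>m. c m * mon m z) has_sum kernel_series (a + z)) UNIV" by blast
  have "((\<lambda>m. c m * (\<Prod>i\<in>UNIV. (x $ i - a $ i) ^ m i)) has_sum kernel_series x) UNIV" if "x \<in> ball a 1" for x
    using c[of "x - a"] that by (simp add: mon_def dist_norm norm_minus_commute)
  then show "\<exists>r>0. \<exists>c. \<forall>x\<in>ball a r. ((\<lambda>m. c m * (\<Prod>i\<in>UNIV. (x $ i - a $ i) ^ m i)) has_sum kernel_series x) UNIV"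
    by (intro exI[of _ 1] conjI exI[of _ c]) auto
qed

lemma kernel_series_0: "kernel_series 0 = 1"
proof -
  have "hom_part n 0 = (if n = 0 then 1 else 0)" for n
    using hom_part_homogeneous[of n 0 0] by (cases n) (simp_all del: hom_part.simps(2))
  then have "(\<lambda>n. if n = 0 then 1 else 0) sums kernel_series 0" using hom_part_sums[of 0] by simp
  then show ?thesis using sums_single[of 0 "\<lambda>_. 1::real"] sums_unique2 by fastforce
qed

lemma is_kernel_kernel_series: "is_kernel kernel_series"
  using kernel_series_real_analytic dunkl_operator_kernel_series kernel_series_0 by (simp add: is_kernel_def)

lemma dunkl_kernel_is_kernel: "is_kernel (\<lambda>x. dunkl_kernel R k x y)"
proof -
  have "is_kernel (THE f. is_kernel f)"
    using is_kernel_kernel_series kernel_unique by (intro theI[of is_kernel kernel_series]) auto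
  then show ?thesis by (simp add: dunkl_kernel_def is_kernel_def[abs_def])
qed

end

section \<open>The Dunkl measure of balls\<close>

context root_system
begin

text \<open>The direction depends only on the signs of the \<open>\<langle>x, \<alpha>\<rangle>\<close>, and there are finitely many sign patterns.\<close>

lemma uniform_direction:
  "\<exists>c>0. c \<le> 1 \<and> (\<forall>x. \<exists>v. norm v \<le> 1 / 2 \<and> (\<forall>s>0. \<forall>a\<in>R. \<bar>(x + s *\<^sub>R v) \<bullet> a\<bar> \<ge> \<bar>x \<bullet> a\<bar> + s * c))"
proof -
  define good where "good = (\<lambda>P c. \<exists>v. norm v \<le> 1 / 2 \<and> (\<forall>a\<in>R. (a \<in> P \<longrightarrow> v \<bullet> a \<ge> c) \<and> (a \<notin> P \<longrightarrow> v \<bullet> a \<le> - c)))"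
  have ex: "\<exists>c>0. \<forall>w. regular w \<longrightarrow> pos w = P \<longrightarrow> good P c" for P
  proof (cases "\<exists>w. regular w \<and> pos w = P")
    case True
    then obtain w where w: "regular w" "pos w = P" by blast
    define v where "v = (1 / (2 * (norm w + 1))) *\<^sub>R w"
    define c where "c = Min (insert 1 ((\<lambda>a. \<bar>v \<bullet> a\<bar>) ` R))"
    have nw: "2 * (norm w + 1) > 0" by (simp add: add_nonneg_pos)
    have va: "v \<bullet> a = (w \<bullet> a) / (2 * (norm w + 1))" for a by (simp add: v_def)
    have vr: "v \<bullet> a \<noteq> 0" if "a \<in> R" for a using w that nw by (simp add: va regular_def)
    have "c > 0" unfolding c_def using vr by (subst Min_gr_iff) auto
    moreover have "norm v \<le> 1 / 2" using nw by (simp add: v_def divide_simps)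
    moreover have "c \<le> \<bar>v \<bullet> a\<bar>" if "a \<in> R" for a unfolding c_def using that by (intro Min_le) auto
    moreover have "v \<bullet> a > 0" if "a \<in> R" "a \<in> P" for a using that w nw by (auto simp: va pos_def)
    moreover have "v \<bullet> a \<le> 0" if "a \<in> R" "a \<notin> P" for a
    proof -
      have "w \<bullet> a \<le> 0" using that w by (auto simp: pos_def)
      then show ?thesis using nw by (simp add: va divide_nonpos_pos)
    qed
    ultimately have v: "norm v \<le> 1 / 2" "\<And>a. a \<in> R \<Longrightarrow> c \<le> \<bar>v \<bullet> a\<bar>" "c > 0"
      "\<And>a. a \<in> R \<Longrightarrow> a \<in> P \<Longrightarrow> v \<bullet> a > 0" "\<And>a. a \<in> R \<Longrightarrow> a \<notin> P \<Longrightarrow> v \<bullet> a \<le> 0" by blast+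
    have "good P c" unfolding good_def
    proof (intro exI[of _ v] conjI ballI impI v(1))
      fix a assume a: "a \<in> R"
      show "a \<in> P \<Longrightarrow> v \<bullet> a \<ge> c" using v(2)[OF a] v(4)[OF a] by simp
      show "a \<notin> P \<Longrightarrow> v \<bullet> a \<le> - c" using v(2)[OF a] v(5)[OF a] by simp
    qed
    then have "\<forall>w. regular w \<longrightarrow> pos w = P \<longrightarrow> good P c" by blast
    with v(3) show ?thesis by blast
  next
    case False
    then have "\<forall>w. regular w \<longrightarrow> pos w = P \<longrightarrow> good P 1" by blast
    with zero_less_one show ?thesis by blast
  qed
  have "\<forall>P. \<exists>c. c > 0 \<and> (\<forall>w. regular w \<longrightarrow> pos w = P \<longrightarrow> good P c)" using ex by simp
  from choice[OF this] obtain C where C: "\<forall>P. C P > 0 \<and> (\<forall>w. regular w \<longrightarrow> pos w = P \<longrightarrow> good P (C P))" ..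
  define c where "c = Min (insert 1 (C ` Pow R))"
  have c: "c > 0" unfolding c_def using C by (subst Min_gr_iff) auto
  have c1: "c \<le> 1" unfolding c_def by (intro Min_le) auto
  have "\<exists>v. norm v \<le> 1 / 2 \<and> (\<forall>s>0. \<forall>a\<in>R. \<bar>(x + s *\<^sub>R v) \<bullet> a\<bar> \<ge> \<bar>x \<bullet> a\<bar> + s * c)" for x
  proof -
    define P' where "P' = {a\<in>R. x \<bullet> a > 0}"
    have "finite P'" by (simp add: P'_def)
    obtain w where w: "\<And>a. a \<in> P' \<Longrightarrow> w \<bullet> a > 0" "\<And>a. a \<in> R \<Longrightarrow> w \<bullet> a \<noteq> 0"
      by (rule generic_point[OF finR _ open_positive_side[OF \<open>finite P'\<close>], of x])
        (use root_nonzero in \<open>auto simp: P'_def\<close>)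
    have "regular w" using w by (simp add: regular_def)
    then have "good (pos w) (C (pos w))" using C by blast
    then obtain v where v: "norm v \<le> 1 / 2" "\<And>a. a \<in> R \<Longrightarrow> a \<in> pos w \<Longrightarrow> v \<bullet> a \<ge> C (pos w)"
      "\<And>a. a \<in> R \<Longrightarrow> a \<notin> pos w \<Longrightarrow> v \<bullet> a \<le> - C (pos w)" unfolding good_def by blast
    have cC: "c \<le> C (pos w)" unfolding c_def by (intro Min_le) (auto simp: pos_def)
    have "\<bar>(x + s *\<^sub>R v) \<bullet> a\<bar> \<ge> \<bar>x \<bullet> a\<bar> + s * c" if s: "s > 0" and a: "a \<in> R" for s a
    proof (cases "a \<in> pos w")
      case True
      have "x \<bullet> a \<ge> 0"
      proof (rule ccontr)
        assume "\<not> x \<bullet> a \<ge> 0"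
        then have "- a \<in> P'" using a by (auto simp: P'_def)
        then show False using w(1)[of "- a"] True by (simp add: pos_def)
      qed
      moreover have "s * c \<le> s * (v \<bullet> a)" using v(2)[OF a True] cC s by (intro mult_left_mono) auto
      ultimately show ?thesis by (simp add: inner_add_left)
    next
      case False
      have "x \<bullet> a \<le> 0"
      proof (rule ccontr)
        assume "\<not> x \<bullet> a \<le> 0"
        then have "a \<in> P'" using a by (auto simp: P'_def)
        then show False using w(1)[of a] False a by (simp add: pos_def)
      qed
      moreover have "s * c \<le> s * (- (v \<bullet> a))" using v(3)[OF a False] cC s by (intro mult_left_mono) auto
      ultimately show ?thesis by (simp add: inner_add_left)
    qed
    then show ?thesis using v(1) by blast
  qed
  then show ?thesis using c c1 by blast
qed

end

context dunkl
begin

lemma k_pos: "a \<in> R \<Longrightarrow> k a > 0"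
  using kap_pos[of a] by (simp add: kap_def)

lemma sum_k: "(\<Sum>a\<in>R. k a) = 2 * K"
  by (simp add: K_def kap_def sum_divide_distrib[symmetric])

lemma weight_measurable [measurable]: "dunkl_weight R k \<in> borel_measurable borel"
  unfolding dunkl_weight_def[abs_def] by measurable

lemma abs_inner_root_le: "a \<in> R \<Longrightarrow> \<bar>v \<bullet> a\<bar> \<le> 2 * norm v"
proof -
  assume a: "a \<in> R"
  have "\<bar>v \<bullet> a\<bar> \<le> norm v * sqrt 2" using Cauchy_Schwarz_ineq2[of v a] a by (simp add: norm_root)
  also have "\<dots> \<le> norm v * 2" by (intro mult_left_mono real_le_lsqrt) auto
  finally show ?thesis by simp
qed

text \<open>An explicit model for the volume of the ball, comparable to it up to constants: within
  distance s of x the factor of the root a is at most of order s + |x \<bullet> a|, and it reaches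
  that order on a fixed portion of the ball.\<close>

definition ball_weight :: "real ^ 'n \<Rightarrow> real \<Rightarrow> real"
  where "ball_weight x s = s ^ CARD('n) * (\<Prod>a\<in>R. (s + \<bar>x \<bullet> a\<bar>) powr k a)"

lemma prod_powr_scale:
  assumes "c > 0" "\<And>a. a \<in> R \<Longrightarrow> f a \<ge> 0"
  shows "(\<Prod>a\<in>R. (c * f a) powr k a) = c powr (2 * K) * (\<Prod>a\<in>R. f a powr k a)"
proof -
  have "(\<Prod>a\<in>R. (c * f a) powr k a) = (\<Prod>a\<in>R. c powr k a * f a powr k a)"
    using assms by (intro prod.cong) (simp_all add: powr_mult)
  also have "\<dots> = c powr (\<Sum>a\<in>R. k a) * (\<Prod>a\<in>R. f a powr k a)"
    using assms by (simp add: prod.distrib powr_sum)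
  finally show ?thesis by (simp add: sum_k)
qed

lemma emeasure_ball_upper:
  assumes s: "s > 0"
  shows "emeasure (dunkl_measure R k) (cball x s) \<le> ennreal (unit_ball_vol (real CARD('n)) * 2 powr (2 * K) * ball_weight x s)"
proof -
  define C where "C = 2 powr (2 * K) * (\<Prod>a\<in>R. (s + \<bar>x \<bullet> a\<bar>) powr k a)"
  have C: "C \<ge> 0" by (simp add: C_def prod_nonneg)
  have w: "dunkl_weight R k z \<le> C" if z: "z \<in> cball x s" for z
  proof -
    have "dunkl_weight R k z \<le> (\<Prod>a\<in>R. (2 * (s + \<bar>x \<bullet> a\<bar>)) powr k a)"
      unfolding dunkl_weight_def
    proof (intro prod_mono conjI powr_mono2)
      fix a assume a: "a \<in> R"
      have "\<bar>(z - x) \<bullet> a\<bar> \<le> 2 * norm (z - x)" by (rule abs_inner_root_le[OF a])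
      also have "\<dots> \<le> 2 * s" using z by (simp add: dist_norm norm_minus_commute)
      finally show "\<bar>z \<bullet> a\<bar> \<le> 2 * (s + \<bar>x \<bullet> a\<bar>)" by (simp add: inner_diff_left)
      show "0 \<le> k a" using k_pos[OF a] by simp
    qed auto
    also have "\<dots> = C" unfolding C_def using s by (intro prod_powr_scale) auto
    finally show ?thesis .
  qed
  have "emeasure (dunkl_measure R k) (cball x s) = (\<integral>\<^sup>+ z. ennreal (dunkl_weight R k z) * indicator (cball x s) z \<partial>lborel)"
    unfolding dunkl_measure_def by (rule emeasure_density) auto
  also have "\<dots> \<le> (\<integral>\<^sup>+ z. ennreal C * indicator (cball x s) z \<partial>lborel)"
    using w by (intro nn_integral_mono) (auto simp: indicator_def intro: ennreal_leI)
  also have "\<dots> = ennreal C * ennreal (unit_ball_vol (real CARD('n)) * s ^ CARD('n))"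
    using s by (subst nn_integral_cmult_indicator) (auto simp: emeasure_cball)
  also have "\<dots> = ennreal (unit_ball_vol (real CARD('n)) * 2 powr (2 * K) * ball_weight x s)"
    using C s by (simp add: ennreal_mult[symmetric] C_def ball_weight_def mult_ac)
  finally show ?thesis .
qed

lemma ball_weight_nonneg: "s \<ge> 0 \<Longrightarrow> ball_weight x s \<ge> 0"
  unfolding ball_weight_def by (intro mult_nonneg_nonneg prod_nonneg) auto

lemma emeasure_ball_finite: "s > 0 \<Longrightarrow> emeasure (dunkl_measure R k) (cball x s) < \<infinity>"
  using emeasure_ball_upper[of s x] by (simp add: order_le_less_trans)

lemma measure_ball_upper:
  "s > 0 \<Longrightarrow> measure (dunkl_measure R k) (cball x s) \<le> unit_ball_vol (real CARD('n)) * 2 powr (2 * K) * ball_weight x s"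
  unfolding measure_def using emeasure_ball_upper[of s x] ball_weight_nonneg[of s x]
  by (intro enn2real_leI) auto

lemma measure_ball_lower:
  "\<exists>c>0. \<forall>x s. s > 0 \<longrightarrow> c * ball_weight x s \<le> measure (dunkl_measure R k) (cball x s)"
proof -
  obtain c where c: "c > 0" "c \<le> 1" and
    dir: "\<And>x. \<exists>v. norm v \<le> 1 / 2 \<and> (\<forall>s>0. \<forall>a\<in>R. \<bar>(x + s *\<^sub>R v) \<bullet> a\<bar> \<ge> \<bar>x \<bullet> a\<bar> + s * c)"
    using uniform_direction by auto
  \<comment> \<open>On a ball of radius e s a root coordinate varies by at most c s / 2, half of
    what moving the centre by s v has gained.\<close>
  define e where "e = c / 4"
  have e: "e > 0" "e \<le> 1 / 2" using c by (auto simp: e_def)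
  define D where "D = unit_ball_vol (real CARD('n)) * e ^ CARD('n) * (c / 2) powr (2 * K)"
  have "D * ball_weight x s \<le> measure (dunkl_measure R k) (cball x s)" if s: "s > 0" for x s
  proof -
    obtain v where v: "norm v \<le> 1 / 2" "\<And>a. a \<in> R \<Longrightarrow> \<bar>(x + s *\<^sub>R v) \<bullet> a\<bar> \<ge> \<bar>x \<bullet> a\<bar> + s * c"
      using dir[of x] s by blast
    define x' where "x' = x + s *\<^sub>R v"
    define C where "C = (c / 2) powr (2 * K) * (\<Prod>a\<in>R. (s + \<bar>x \<bullet> a\<bar>) powr k a)"
    have C: "C \<ge> 0" by (simp add: C_def prod_nonneg)
    have sub: "cball x' (e * s) \<subseteq> cball x s"
    proof -
      have "norm (s *\<^sub>R v) \<le> s * (1 / 2)" using v(1) s by (simp add: mult_left_mono)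
      moreover have "e * s \<le> 1 / 2 * s" using e s by (intro mult_right_mono) auto
      ultimately have "dist x' x + e * s \<le> s" by (simp add: x'_def dist_norm)
      then show ?thesis by (simp add: cball_subset_cball_iff)
    qed
    have w: "C \<le> dunkl_weight R k z" if z: "z \<in> cball x' (e * s)" for z
    proof -
      have "C = (\<Prod>a\<in>R. (c / 2 * (s + \<bar>x \<bullet> a\<bar>)) powr k a)"
        unfolding C_def using c s by (intro prod_powr_scale[symmetric]) auto
      also have "\<dots> \<le> dunkl_weight R k z"
        unfolding dunkl_weight_def
      proof (intro prod_mono conjI powr_mono2)
        fix a assume a: "a \<in> R"
        have "\<bar>(z - x') \<bullet> a\<bar> \<le> 2 * norm (z - x')" by (rule abs_inner_root_le[OF a])
        also have "\<dots> \<le> 2 * (e * s)" using z by (simp add: dist_norm norm_minus_commute)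
        finally have 1: "\<bar>z \<bullet> a - x' \<bullet> a\<bar> \<le> c / 2 * s" by (simp add: inner_diff_left e_def)
        have 2: "\<bar>x' \<bullet> a\<bar> \<ge> \<bar>x \<bullet> a\<bar> + s * c" using v(2)[OF a] by (simp add: x'_def)
        have "c / 2 * \<bar>x \<bullet> a\<bar> \<le> 1 * \<bar>x \<bullet> a\<bar>" using c by (intro mult_right_mono) auto
        moreover have "\<bar>x' \<bullet> a\<bar> - \<bar>z \<bullet> a\<bar> \<le> \<bar>z \<bullet> a - x' \<bullet> a\<bar>"
          using abs_triangle_ineq2[of "x' \<bullet> a" "z \<bullet> a"] by (simp add: abs_minus_commute)
        ultimately show "c / 2 * (s + \<bar>x \<bullet> a\<bar>) \<le> \<bar>z \<bullet> a\<bar>" using 1 2 by (simp add: algebra_simps)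
        show "0 \<le> k a" using k_pos[OF a] by simp
        show "0 \<le> c / 2 * (s + \<bar>x \<bullet> a\<bar>)" using c s by simp
      qed auto
      finally show ?thesis .
    qed
    have "ennreal (D * ball_weight x s) = ennreal C * ennreal (unit_ball_vol (real CARD('n)) * (e * s) ^ CARD('n))"
      using C s e by (simp add: ennreal_mult[symmetric] C_def D_def ball_weight_def power_mult_distrib mult_ac)
    also have "\<dots> = (\<integral>\<^sup>+ z. ennreal C * indicator (cball x' (e * s)) z \<partial>lborel)"
      using s e by (subst nn_integral_cmult_indicator) (auto simp: emeasure_cball)
    also have "\<dots> \<le> (\<integral>\<^sup>+ z. ennreal (dunkl_weight R k z) * indicator (cball x s) z \<partial>lborel)"
      using w sub by (intro nn_integral_mono) (auto simp: indicator_def intro: ennreal_leI)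
    also have "\<dots> = emeasure (dunkl_measure R k) (cball x s)"
      unfolding dunkl_measure_def by (rule emeasure_density[symmetric]) auto
    also have "\<dots> = ennreal (measure (dunkl_measure R k) (cball x s))"
      using emeasure_ball_finite[OF s, of x] by (intro emeasure_eq_ennreal_measure) auto
    finally show ?thesis by (simp add: ennreal_le_iff)
  qed
  moreover have "D > 0" using e c by (simp add: D_def)
  ultimately show ?thesis by blast
qed

lemma ball_weight_pos: "s > 0 \<Longrightarrow> ball_weight x s > 0"
  unfolding ball_weight_def by (intro mult_pos_pos prod_pos) (auto simp: add_pos_nonneg)

lemma measure_ball_pos: "s > 0 \<Longrightarrow> measure (dunkl_measure R k) (cball x s) > 0"
  using measure_ball_lower ball_weight_pos[of s x] by (metis mult_pos_pos order_less_le_trans)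

section \<open>The Gaussian normalisation\<close>

lemma pow_le_exp: "(t::real) \<ge> 0 \<Longrightarrow> t ^ n \<le> fact n * exp t"
proof -
  assume t: "t \<ge> 0"
  have s: "summable (\<lambda>n. inverse (fact n) * t ^ n)" by (rule summable_exp)
  have "(\<Sum>i\<in>{n}. inverse (fact i) * t ^ i) \<le> (\<Sum>i. inverse (fact i) * t ^ i)"
    using t by (intro sum_le_suminf s) auto
  then have "inverse (fact n) * t ^ n \<le> exp t" by (simp add: exp_def scaleR_conv_of_real)
  then show ?thesis by (simp add: field_simps)
qed

text \<open>The Bochner integral of a non-integrable function is 0 by convention, so positivity of
  \<open>gauss_const\<close> depends on this. Space is covered by balls of integer radius, whose
  volume grows polynomially while the Gaussian outside them decays.\<close>

lemma gauss_integrable: "integrable (dunkl_measure R k) (\<lambda>x. exp (- (norm x)\<^sup>2 / 2))"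
proof (rule integrableI_nonneg)
  let ?M = "dunkl_measure R k"
  have sets [simp]: "sets ?M = sets borel" by (simp add: dunkl_measure_def)
  show "(\<lambda>x. exp (- (norm x)\<^sup>2 / 2)) \<in> borel_measurable ?M"
    by (simp add: measurable_cong_sets[OF sets refl])
  define V where "V = unit_ball_vol (real CARD('n)) * 2 powr (2 * K)"
  have V: "V \<ge> 0" by (simp add: V_def)
  define p where "p = CARD('n) + nat \<lceil>2 * K\<rceil>"
  define f where "f = (\<lambda>n. exp (- (real n)\<^sup>2 / 2) * (V * (real n + 1) ^ p))"
  have meas: "emeasure ?M (cball 0 (real n + 1)) \<le> ennreal (V * (real n + 1) ^ p)" for n
  proof -
    have "ball_weight 0 (real n + 1) = (real n + 1) ^ CARD('n) * (real n + 1) powr (2 * K)"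
      by (simp add: ball_weight_def powr_sum flip: sum_k)
    also have "(real n + 1) powr (2 * K) \<le> (real n + 1) powr real (nat \<lceil>2 * K\<rceil>)"
      by (intro powr_mono) linarith+
    also have "\<dots> = (real n + 1) ^ nat \<lceil>2 * K\<rceil>" by (intro powr_realpow) auto
    finally have "ball_weight 0 (real n + 1) \<le> (real n + 1) ^ p" by (simp add: p_def power_add mult_left_mono)
    then have "V * ball_weight 0 (real n + 1) \<le> V * (real n + 1) ^ p" using V by (intro mult_left_mono)
    then show ?thesis using emeasure_ball_upper[of "real n + 1" 0]
      by (auto simp: V_def intro: order_trans ennreal_leI)
  qed
  have "summable f"
  proof (rule summable_comparison_test')
    show "summable (\<lambda>n. (exp 3 * V * fact p) * exp (- 1) ^ n)"
      by (intro summable_mult summable_geometric) simp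
    fix n
    have "(real n + 1) ^ p \<le> fact p * exp (real n + 1)" by (rule pow_le_exp) simp
    moreover have "exp (- (real n)\<^sup>2 / 2) \<le> exp (2 - 2 * real n)"
      using zero_le_power2[of "real n - 2"] by (simp add: power2_diff)
    ultimately have "f n \<le> exp (2 - 2 * real n) * (V * (fact p * exp (real n + 1)))"
      unfolding f_def using V by (intro mult_mono mult_left_mono) auto
    also have "\<dots> = (exp 3 * V * fact p) * exp (- real n)"
    proof -
      have "exp (2 - 2 * real n) * exp (real n + 1) = exp 3 * exp (- real n)" by (simp flip: exp_add)
      then have "V * fact p * (exp (2 - 2 * real n) * exp (real n + 1)) = V * fact p * (exp 3 * exp (- real n))"
        by (simp only:)
      then show ?thesis by (simp only: mult_ac)
    qed
    also have "exp (- real n) = exp (- 1) ^ n" by (simp add: exp_of_nat_mult[symmetric])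
    finally show "norm (f n) \<le> (exp 3 * V * fact p) * exp (- 1) ^ n" using V by (simp add: f_def)
  qed
  have "(\<integral>\<^sup>+ x. ennreal (exp (- (norm x)\<^sup>2 / 2)) \<partial>?M) \<le>
    (\<integral>\<^sup>+ x. (\<Sum>n. ennreal (exp (- (real n)\<^sup>2 / 2)) * indicator (cball 0 (real n + 1)) x) \<partial>?M)"
  proof (intro nn_integral_mono)
    fix x :: "real ^ 'n"
    define n where "n = nat \<lfloor>norm x\<rfloor>"
    have n: "real n \<le> norm x" "norm x \<le> real n + 1" by (auto simp: n_def)
    have "(real n)\<^sup>2 \<le> (norm x)\<^sup>2" using n by (intro power_mono) auto
    then have "ennreal (exp (- (norm x)\<^sup>2 / 2)) \<le> ennreal (exp (- (real n)\<^sup>2 / 2)) * indicator (cball 0 (real n + 1)) x"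
      using n by (auto simp: indicator_def intro!: ennreal_leI)
    also have "\<dots> = (\<Sum>n\<in>{n}. ennreal (exp (- (real n)\<^sup>2 / 2)) * indicator (cball 0 (real n + 1)) x)"
      by (simp only: sum.insert finite.emptyI empty_iff not_False_eq_True sum.empty add_0_right)
    also have "\<dots> \<le> (\<Sum>n. ennreal (exp (- (real n)\<^sup>2 / 2)) * indicator (cball 0 (real n + 1)) x)"
      by (intro sum_le_suminf) auto
    finally show "ennreal (exp (- (norm x)\<^sup>2 / 2)) \<le> (\<Sum>n. ennreal (exp (- (real n)\<^sup>2 / 2)) * indicator (cball 0 (real n + 1)) x)" .
  qed
  also have "\<dots> = (\<Sum>n. ennreal (exp (- (real n)\<^sup>2 / 2)) * emeasure ?M (cball 0 (real n + 1)))"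
    by (subst nn_integral_suminf)
      (auto simp: nn_integral_cmult_indicator intro!: borel_measurable_times_ennreal borel_measurable_indicator)
  also have "\<dots> \<le> (\<Sum>n. ennreal (f n))"
  proof (intro suminf_le allI)
    fix n
    have "ennreal (exp (- (real n)\<^sup>2 / 2)) * emeasure ?M (cball 0 (real n + 1)) \<le>
      ennreal (exp (- (real n)\<^sup>2 / 2)) * ennreal (V * (real n + 1) ^ p)" by (intro mult_left_mono meas) auto
    also have "\<dots> = ennreal (f n)" using V by (simp add: f_def ennreal_mult)
    finally show "ennreal (exp (- (real n)\<^sup>2 / 2)) * emeasure ?M (cball 0 (real n + 1)) \<le> ennreal (f n)" .
  qed auto
  also have "\<dots> < \<infinity>"
  proof -
    have "f n \<ge> 0" for n using V by (simp add: f_def)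
    then have "(\<Sum>n. ennreal (f n)) \<noteq> \<infinity>"
      unfolding infinity_ennreal_def by (rule ennreal_suminf_neq_top[OF \<open>summable f\<close>])
    then show ?thesis unfolding infinity_ennreal_def less_top[symmetric] .
  qed
  finally show "(\<integral>\<^sup>+ x. ennreal (exp (- (norm x)\<^sup>2 / 2)) \<partial>?M) < \<infinity>" .
qed auto

lemma gauss_const_pos: "gauss_const R k > 0"
proof -
  let ?M = "dunkl_measure R k"
  have fin: "emeasure ?M (cball 0 1) < \<infinity>" by (rule emeasure_ball_finite) simp
  have "0 < exp (- 1 / 2) * measure ?M (cball 0 1)" using measure_ball_pos[of 1 0] by simp
  also have "\<dots> = (\<integral>x. exp (- 1 / 2) * indicator (cball 0 1) x \<partial>?M)"
    using fin by simp (simp add: dunkl_measure_def)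
  also have "\<dots> \<le> gauss_const R k"
    unfolding gauss_const_def
  proof (rule integral_mono[OF _ gauss_integrable])
    have "cball 0 1 \<in> sets ?M" by (simp add: dunkl_measure_def)
    then show "integrable ?M (\<lambda>x. exp (- 1 / 2) * indicator (cball 0 1) x :: real)"
      using fin by (intro integrable_mult_right integrable_real_indicator)
    fix x :: "real ^ 'n"
    show "exp (- 1 / 2) * indicator (cball 0 1) x \<le> exp (- (norm x)\<^sup>2 / 2)"
      by (auto simp: indicator_def abs_square_le_1)
  qed
  finally show ?thesis .
qed

end

section \<open>The heat kernel bounds\<close>

context path_system
begin

text \<open>Here x and y are already divided by sqrt (2 t). The factor sqrt 2 converts their
  distances back to the original ones divided by sqrt t, so this is the weight of the
  theorem.\<close>

definition dist_weight :: "(real ^ 'n) list \<Rightarrow> real"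
  where "dist_weight as = (\<Prod>j<length as. inverse ((1 + sqrt 2 * norm (x - seq_reflection (take j as) y))\<^sup>2))"

lemma path_weight_prod: "path_weight r as h = (\<Prod>j<length as. 1 / (1 + r * b (seq_reflection (take j as) \<circ> h)))"
  by (induction as arbitrary: h) (simp_all add: prod.lessThan_Suc_shift comp_assoc del: comp_apply prod.lessThan_Suc)

text \<open>Since |x - h y|^2 = d^2 + 2 b h, the square of 1 + sqrt 2 |x - h y| lies between 1 + b h
  and 8 (1 + d)^2 (1 + b h). This relates the exponent -2 of the theorem to the decay rates of the
  system.\<close>

lemma step_weights:
  assumes h: "h \<in> G"
  shows "inverse ((1 + sqrt 2 * norm (x - h y))\<^sup>2) \<le> 1 / (1 + 1 * b h)"
    and "1 / (1 + 1 * b h) \<le> (8 * (1 + d)\<^sup>2) * inverse ((1 + sqrt 2 * norm (x - h y))\<^sup>2)"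
proof -
  define r where "r = norm (x - h y)"
  have r: "r \<ge> 0" "r\<^sup>2 = d\<^sup>2 + 2 * b h" using dist_square[OF h] by (auto simp: r_def)
  have bn: "b h \<ge> 0" by (rule b_nonneg[OF h])
  have e: "(1 + sqrt 2 * r)\<^sup>2 = 1 + 2 * (sqrt 2 * r) + 2 * r\<^sup>2" by (simp add: power2_sum power_mult_distrib)
  have q: "2 * (sqrt 2 * r) \<le> 1 + 2 * r\<^sup>2"
    using zero_le_power2[of "1 - sqrt 2 * r"] by (simp add: power2_diff power_mult_distrib)
  have pos: "(1 + sqrt 2 * r)\<^sup>2 > 0" using r(1) by (intro zero_less_power add_pos_nonneg) auto
  have "1 + b h \<le> (1 + sqrt 2 * r)\<^sup>2" unfolding e r(2) using r(1) bn by simp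
  then show "inverse ((1 + sqrt 2 * norm (x - h y))\<^sup>2) \<le> 1 / (1 + 1 * b h)"
    unfolding r_def[symmetric] using bn by (simp add: inverse_eq_divide frac_le)
  have "(1 + sqrt 2 * r)\<^sup>2 \<le> 2 + 4 * d\<^sup>2 + 8 * b h" using q unfolding e r(2) distrib_left by simp
  also have "\<dots> \<le> 8 * (1 + d)\<^sup>2 * (1 + b h)"
  proof -
    have "8 * (1 + d\<^sup>2) * (1 + b h) \<le> 8 * (1 + d)\<^sup>2 * (1 + b h)"
      using d_nonneg bn by (intro mult_right_mono) (auto simp: power2_sum)
    moreover have "8 * (1 + d\<^sup>2) * (1 + b h) = 8 + 8 * d\<^sup>2 + 8 * b h + 8 * (d\<^sup>2 * b h)" by (simp add: algebra_simps)
    moreover have "d\<^sup>2 * b h \<ge> 0" "d\<^sup>2 \<ge> 0" using bn by auto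
    ultimately show ?thesis using bn by linarith
  qed
  finally have "(1 + sqrt 2 * r)\<^sup>2 \<le> 8 * (1 + d)\<^sup>2 * (1 + b h)" .
  then show "1 / (1 + 1 * b h) \<le> (8 * (1 + d)\<^sup>2) * inverse ((1 + sqrt 2 * norm (x - h y))\<^sup>2)"
    unfolding r_def[symmetric] using bn pos by (simp add: divide_simps)
qed

lemma dist_weight_le_path_weight:
  assumes "as \<in> Admissible id" shows "dist_weight as \<le> path_weight 1 as id"
  unfolding dist_weight_def path_weight_prod
proof (intro prod_mono conjI)
  fix j
  have "seq_reflection (take j as) \<in> G" using AdmissibleD[OF assms] Rp_sub set_take_subset[of j as] by (intro seq_in_G) auto
  then show "inverse ((1 + sqrt 2 * norm (x - seq_reflection (take j as) y))\<^sup>2) \<le> 1 / (1 + 1 * b (seq_reflection (take j as) \<circ> id))"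
    using step_weights(1) by simp
qed auto

lemma dist_weight_nonneg: "dist_weight as \<ge> 0"
  unfolding dist_weight_def by (intro prod_nonneg) auto

lemma path_weight_le_dist_weight:
  assumes "as \<in> Admissible id" shows "path_weight 1 as id \<le> (8 * (1 + d)\<^sup>2) ^ (2 * card G) * dist_weight as"
proof -
  have "path_weight 1 as id \<le> (\<Prod>j<length as. (8 * (1 + d)\<^sup>2) * inverse ((1 + sqrt 2 * norm (x - seq_reflection (take j as) y))\<^sup>2))"
    unfolding path_weight_prod
  proof (intro prod_mono conjI)
    fix j
    have g: "seq_reflection (take j as) \<in> G" using AdmissibleD[OF assms] Rp_sub set_take_subset[of j as] by (intro seq_in_G) auto
    then show "1 / (1 + 1 * b (seq_reflection (take j as) \<circ> id)) \<le> 8 * (1 + d)\<^sup>2 * inverse ((1 + sqrt 2 * norm (x - seq_reflection (take j as) y))\<^sup>2)"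
      using step_weights(2) by simp
    show "0 \<le> 1 / (1 + 1 * b (seq_reflection (take j as) \<circ> id))" using b_nonneg[OF g] by simp
  qed
  also have "\<dots> = (8 * (1 + d)\<^sup>2) ^ length as * dist_weight as" by (simp add: prod.distrib dist_weight_def power_mult_distrib)
  also have "\<dots> \<le> (8 * (1 + d)\<^sup>2) ^ (2 * card G) * dist_weight as"
  proof (intro mult_right_mono power_increasing dist_weight_nonneg)
    have "1 \<le> (1 + d)\<^sup>2" using d_nonneg by (simp add: one_le_power)
    then show "1 \<le> 8 * (1 + d)\<^sup>2" by simp
  qed (use AdmissibleD[OF assms] in auto)
  finally show ?thesis .
qed

definition log_weight :: real where "log_weight = (\<Sum>a\<in>R. k a * ln (1 + xi a))"
definition dist_sum :: real where "dist_sum = (\<Sum>as\<in>Admissible id. dist_weight as)"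

lemma dist_sum_nonneg: "dist_sum \<ge> 0" unfolding dist_sum_def by (intro sum_nonneg dist_weight_nonneg)

lemma width_le: "width \<le> 6 * (K + 1) * (1 + d)"
proof -
  have "24 * (K + 1) + 32 * d\<^sup>2 \<le> 36 * ((K + 1)\<^sup>2 * (1 + d\<^sup>2))"
  proof -
    have "(K + 1) * 1 \<le> (K + 1)\<^sup>2" "1 * d\<^sup>2 \<le> (K + 1)\<^sup>2 * d\<^sup>2"
      unfolding power2_eq_square using K_nonneg by (intro mult_left_mono mult_right_mono; simp add: algebra_simps)+
    moreover have "24 * (K + 1) + 32 * D \<le> 36 * (A + B)"
      if "(K + 1) * 1 \<le> A" "1 * D \<le> B" "0 \<le> D" for A B D :: real
    proof -
      have "24 * (K + 1) \<le> 36 * A" using that(1) K_nonneg by simp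
      moreover have "32 * D \<le> 36 * B" using that(2,3) by simp
      ultimately show ?thesis by simp
    qed
    moreover have "0 \<le> d\<^sup>2" by simp
    ultimately show ?thesis unfolding distrib_left[of "(K + 1)\<^sup>2"] mult_1_right by blast
  qed
  also have "\<dots> \<le> 36 * ((K + 1)\<^sup>2 * (1 + d)\<^sup>2)"
    using d_nonneg by (intro mult_left_mono zero_le_power2) (simp_all add: power2_sum)
  also have "\<dots> = (6 * (K + 1) * (1 + d))\<^sup>2" unfolding power_mult_distrib by simp
  finally have "24 * (K + 1) + 32 * d\<^sup>2 \<le> (6 * (K + 1) * (1 + d))\<^sup>2" .
  then show ?thesis unfolding width_def using K_nonneg d_nonneg by (intro real_le_lsqrt) auto
qed

lemma u_final_upper:
  "u id 1 \<le> exp (K + 2 * K * ln (24 * (K + 1))) * Cpath * (1 / t0) ^ (2 * card G) * 8 ^ (2 * card G)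
     * exp ((2 * K + 4 * real (card G)) * ln (1 + d)) * exp (- log_weight) * dist_sum"
proof -
  define U0 where "U0 = exp (K + 2 * K * ln (24 * (K + 1)) + 2 * K * ln (1 + d) - log_weight)"
  have U0: "u h s \<le> U0" if h: "h \<in> G" and s: "1 / 2 \<le> s" "s \<le> 1" for h s
  proof -
    have sq: "sqrt s \<ge> 1 / 2" using s by (intro real_le_rsqrt) (simp add: power2_eq_square)
    have a: "width > 0" using width_ge_1 by simp
    have "2 * width / sqrt s \<le> 2 * width / (1 / 2)" using sq a s(1) by (intro divide_left_mono mult_pos_pos) auto
    also have "\<dots> \<le> 24 * (K + 1) * (1 + d)" using width_le by (simp add: algebra_simps)
    finally have "ln (2 * width / sqrt s) \<le> ln (24 * (K + 1) * (1 + d))" using a s K_nonneg d_nonneg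
      by (intro ln_mono divide_pos_pos mult_pos_pos add_nonneg_pos) auto
    also have "\<dots> = ln (24 * (K + 1)) + ln (1 + d)" using K_nonneg d_nonneg by (intro ln_mult_pos) auto
    finally have "2 * K * ln (2 * width / sqrt s) \<le> 2 * K * (ln (24 * (K + 1)) + ln (1 + d))"
      using K_nonneg by (intro mult_left_mono) auto
    moreover have "K * s \<le> K" using s K_nonneg by (simp add: mult_left_le)
    ultimately have "K * s + log_profile s \<le> K + 2 * K * ln (24 * (K + 1)) + 2 * K * ln (1 + d) - log_weight"
      using log_profile_upper[of s] s by (simp add: log_weight_def distrib_left)
    then have "exp (K * s + log_profile s) \<le> U0" by (simp add: U0_def)
    then show ?thesis using u_upper[OF h, of s] s by simp
  qed
  have nn: "U0 * Cpath \<ge> 0" by (simp add: U0_def Cpath_def)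
  have nn2: "U0 * Cpath * (1 / t0) ^ (2 * card G) \<ge> 0" using nn t0_bounds by simp
  have "u id 1 \<le> U0 * Cpath * path_sum t0 id" using U0 by (intro u_path_upper) auto
  also have "\<dots> \<le> U0 * Cpath * ((1 / t0) ^ (2 * card G) * path_sum 1 id)"
    using path_sum_rescale[of id] nn by (intro mult_left_mono) auto
  also have "\<dots> = U0 * Cpath * (1 / t0) ^ (2 * card G) * path_sum 1 id" by simp
  also have "\<dots> \<le> U0 * Cpath * (1 / t0) ^ (2 * card G) * (8 ^ (2 * card G) * exp (4 * real (card G) * ln (1 + d)) * dist_sum)"
  proof (intro mult_left_mono nn2)
    have "exp (4 * real (card G) * ln (1 + d)) = exp (real (4 * card G) * ln (1 + d))" by simp
    also have "\<dots> = (1 + d) ^ (4 * card G)" unfolding exp_of_nat_mult using d_nonneg by simp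
    finally have "(8 * (1 + d)\<^sup>2) ^ (2 * card G) = 8 ^ (2 * card G) * exp (4 * real (card G) * ln (1 + d))"
      by (simp add: power_mult_distrib flip: power_mult)
    moreover have "path_sum 1 id \<le> (8 * (1 + d)\<^sup>2) ^ (2 * card G) * dist_sum"
      unfolding path_sum_def dist_sum_def sum_distrib_left by (intro sum_mono path_weight_le_dist_weight)
    ultimately show "path_sum 1 id \<le> 8 ^ (2 * card G) * exp (4 * real (card G) * ln (1 + d)) * dist_sum" by (simp only:)
  qed
  also have "\<dots> = (U0 * exp (4 * real (card G) * ln (1 + d))) * (Cpath * (1 / t0) ^ (2 * card G) * 8 ^ (2 * card G) * dist_sum)"
    by (simp only: mult_ac)
  also have "U0 * exp (4 * real (card G) * ln (1 + d)) =
    exp (K + 2 * K * ln (24 * (K + 1))) * exp ((2 * K + 4 * real (card G)) * ln (1 + d)) * exp (- log_weight)"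
    unfolding U0_def exp_add[symmetric] by (simp add: algebra_simps)
  finally show ?thesis by (simp only: mult_ac)
qed

lemma u_final_lower:
  assumes c0: "c0 > 0" "c0 \<le> 1" "\<And>a. a \<in> R \<Longrightarrow> c0 \<le> kap a / (2 * (1 + K))"
  shows "c0 ^ (2 * card G) / real (card short_seqs)
    * exp (- (2 * K + 1 + 2 * (64 / 3 * K) * ln (4 * (64 / 3 * K + 1)) + 2 * (64 / 3 * K) * ln (11 * (K + 1))))
    * exp (- (2 * (64 / 3 * K)) * ln (1 + d)) * exp (- log_weight) * dist_sum \<le> u id 1"
proof -
  define c2 where "c2 = 2 * (64 / 3 * K)"
  define c1 where "c1 = 2 * K + 1 + c2 * ln (4 * (64 / 3 * K + 1))"
  have c2: "c2 \<ge> 0" using K_nonneg by (simp add: c2_def)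
  define m where "m = exp (- (c1 + c2 * ln (11 * (K + 1)) + c2 * ln (1 + d)) - log_weight)"
  have m: "m > 0" by (simp add: m_def)
  \<comment> \<open>Times down to 2^(-2 |G|) are covered because a path of length up to 2 |G| halves
    the time at every letter.\<close>
  have low: "m \<le> u e t" if e: "e \<in> G" "b e = 0" and t: "(1 / 2) ^ (2 * card G) \<le> t" "t \<le> 1" for e t
  proof -
    have "(1 / 2 :: real) ^ (2 * card G) > 0" by simp
    then have "t > 0" using t(1) by (rule less_le_trans)
    then have t': "t \<in> {0..1}" "t > 0" using t(2) by auto
    define P where "P = width + 2 * drift_const + sqrt 2 * d + 1"
    have "sqrt 2 * d \<le> 2 * d" using d_nonneg by (intro mult_right_mono real_le_lsqrt) auto
    then have "P \<le> 6 * (K + 1) * (1 + d) + (4 * K + 3) + 2 * d" using width_le by (simp add: P_def drift_const_def)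
    also have "\<dots> \<le> 11 * (K + 1) * (1 + d)"
      using K_nonneg d_nonneg mult_nonneg_nonneg[OF K_nonneg d_nonneg] by (simp add: algebra_simps)
    finally have "ln P \<le> ln (11 * (K + 1) * (1 + d))"
      using width_ge_1 K_nonneg d_nonneg by (intro ln_mono) (auto simp: P_def drift_const_def intro!: add_pos_nonneg)
    also have "\<dots> = ln (11 * (K + 1)) + ln (1 + d)" using K_nonneg d_nonneg by (intro ln_mult_pos) auto
    finally have "c2 * ln P \<le> c2 * (ln (11 * (K + 1)) + ln (1 + d))" using c2 by (rule mult_left_mono)
    moreover have "Phi e t \<le> c1 + c2 * ln P"
      using Phi_min_bound[OF e t'(1)] by (simp add: c1_def c2_def P_def)
    moreover have "log_profile t \<ge> - log_weight" using log_profile_lower[of t] t' by (simp add: log_weight_def)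
    moreover have "K * t \<ge> 0" using K_nonneg t' by simp
    ultimately have "- (c1 + c2 * ln (11 * (K + 1)) + c2 * ln (1 + d)) - log_weight \<le> ln (u e t)"
      unfolding Phi_def by (simp add: distrib_left)
    then have "m \<le> exp (ln (u e t))" by (simp add: m_def)
    then show ?thesis using u_pos[OF e(1) t'(1)] by simp
  qed
  have each: "c0 ^ (2 * card G) * m * dist_weight as \<le> u id 1" if as: "as \<in> Admissible id" for as
  proof -
    have len: "length as \<le> 2 * card G" "set as \<subseteq> Rp" "b (seq_reflection as \<circ> id) = 0" using AdmissibleD[OF as] by auto
    have "(2 :: real) ^ length as * (1 / 2) ^ (2 * card G) \<le> 2 ^ (2 * card G) * (1 / 2) ^ (2 * card G)"
      using len by (intro mult_right_mono power_increasing) auto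
    then have s: "(2 :: real) ^ length as * (1 / 2) ^ (2 * card G) \<le> 1" by (simp add: power_one_over)
    have "c0 ^ (2 * card G) * m * dist_weight as \<le> c0 ^ length as * m * path_weight 1 as id"
      using c0 m len dist_weight_le_path_weight[OF as] dist_weight_nonneg
      by (intro mult_mono mult_right_mono power_decreasing) auto
    also have "\<dots> \<le> u id 1"
      by (rule u_path_lower[OF c0(1) c0(3) less_imp_le[OF m] _ low len(2) id_in_G len(3) s]) auto
    finally show ?thesis .
  qed
  have "c0 ^ (2 * card G) * m * dist_sum = (\<Sum>as\<in>Admissible id. c0 ^ (2 * card G) * m * dist_weight as)"
    by (simp add: dist_sum_def sum_distrib_left)
  also have "\<dots> \<le> real (card (Admissible id)) * u id 1" using each by (intro sum_bounded_above)
  also have "\<dots> \<le> real (card short_seqs) * u id 1"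
    using finite_short_seqs u_pos[of id 1] by (intro mult_right_mono of_nat_mono card_mono) (auto simp: Admissible_def)
  finally have le: "c0 ^ (2 * card G) * m * dist_sum \<le> real (card short_seqs) * u id 1" .
  have "[] \<in> short_seqs" by (simp add: short_seqs_def)
  then have "card short_seqs > 0" using finite_short_seqs card_gt_0_iff by blast
  then have "c0 ^ (2 * card G) * m * dist_sum / real (card short_seqs) \<le> u id 1"
    using le by (simp add: divide_le_eq mult.commute)
  moreover have "m = exp (- (c1 + c2 * ln (11 * (K + 1)))) * exp (- c2 * ln (1 + d)) * exp (- log_weight)"
    unfolding m_def exp_add[symmetric] by (simp add: algebra_simps)
  ultimately show ?thesis by (simp add: c1_def c2_def mult_ac)
qed

end

section \<open>From the orbit system back to the heat kernel\<close>

context dunkl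
begin

text \<open>With h inverted, b h is governed by x \<bullet> h y. The inverse of \<sigma>_a h sends x
  to the reflection of the inverse image of x in the inverse image of a; since \<kappa> is
  invariant, reindexing the roots restores the sum over a.\<close>

lemma kernel_orbit_system:
  "orbit_system R k x y (\<lambda>h s. exp (- s * Max ((\<lambda>g. x \<bullet> g y) ` G)) * dunkl_kernel R k (s *\<^sub>R ginv h x) y)"
proof -
  interpret E: dunkl_eigen R k y by unfold_locales
  interpret P: orbit_pair R k x y by unfold_locales
  define M where "M = Max ((\<lambda>g. x \<bullet> g y) ` G)"
  define f where "f = (\<lambda>z. dunkl_kernel R k z y)"
  have f: "E.is_kernel f" unfolding f_def by (rule E.dunkl_kernel_is_kernel)
  have "orbit_system R k x y (\<lambda>h s. exp (- s * M) * f (s *\<^sub>R ginv h x))"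
  proof unfold_locales
    fix h assume h: "h \<in> G"
    show "exp (- 0 * M) * f (0 *\<^sub>R ginv h x) = 1" using f by (simp add: E.is_kernel_def)
    show "continuous_on {0..1} (\<lambda>s. exp (- s * M) * f (s *\<^sub>R ginv h x))"
      by (intro continuous_intros E.kernel_ray_cont f)
    fix s :: real assume s: "0 < s" "s \<le> 1"
    define p where "p = ginv h x"
    have py: "p \<bullet> y = x \<bullet> h y" using G_inner_inv[OF h] by (simp add: p_def)
    have ginv: "ginv (root_reflection a \<circ> h) x = root_reflection (ginv h a) p" if a: "a \<in> R" for a
    proof -
      have "inj (root_reflection a \<circ> h)" using G_bij[of "root_reflection a \<circ> h"] h a by (auto intro: bij_is_inj)
      moreover have "(root_reflection a \<circ> h) (root_reflection (ginv h a) p) = x"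
      proof -
        have "h (root_reflection (ginv h a) p) = root_reflection a (h p)"
          using G_conj[OF h, of "ginv h a"] h a inv_in_G[OF h] by (metis G_inv_simps(2) G_root comp_apply)
        then show ?thesis using a h by (simp add: p_def)
      qed
      ultimately show ?thesis by (rule inv_f_eq)
    qed
    define S where "S = (\<Sum>a\<in>R. kap a * (f (s *\<^sub>R p) - f (s *\<^sub>R root_reflection a p)))"
    have S: "S = (\<Sum>a\<in>R. kap a * (f (s *\<^sub>R p) - f (s *\<^sub>R root_reflection (ginv h a) p)))"
      unfolding S_def by (rule sum_kap_reindex[OF inv_in_G[OF h], symmetric])
    have 1: "((\<lambda>s. f (s *\<^sub>R p)) has_real_derivative ((p \<bullet> y) * f (s *\<^sub>R p) - S / s)) (at s)"
      unfolding S_def using s by (intro E.kernel_ray f) auto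
    have 2: "((\<lambda>s. exp (- s * M)) has_real_derivative exp (- s * M) * (- M)) (at s)"
      by (auto intro!: derivative_eq_intros)
    have "((\<lambda>s. exp (- s * M) * f (s *\<^sub>R p)) has_real_derivative
       exp (- s * M) * (- M) * f (s *\<^sub>R p) + ((p \<bullet> y) * f (s *\<^sub>R p) - S / s) * exp (- s * M)) (at s)"
      by (rule DERIV_mult[OF 2 1])
    moreover have "exp (- s * M) * (- M) * f (s *\<^sub>R p) + ((p \<bullet> y) * f (s *\<^sub>R p) - S / s) * exp (- s * M)
      = - P.b h * (exp (- s * M) * f (s *\<^sub>R p)) - exp (- s * M) * S / s"
      by (simp add: P.b_def py M_def algebra_simps)
    moreover have "exp (- s * M) * S = (\<Sum>a\<in>R. kap a * (exp (- s * M) * f (s *\<^sub>R p)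
        - exp (- s * M) * f (s *\<^sub>R ginv (root_reflection a \<circ> h) x)))"
      unfolding S sum_distrib_left by (intro sum.cong refl) (simp add: ginv algebra_simps del: comp_apply)
    ultimately show "((\<lambda>s. exp (- s * M) * f (s *\<^sub>R ginv h x)) has_real_derivative
       - P.b h * (exp (- s * M) * f (s *\<^sub>R ginv h x)) - (\<Sum>a\<in>R. kap a * (exp (- s * M) * f (s *\<^sub>R ginv h x)
        - exp (- s * M) * f (s *\<^sub>R ginv (root_reflection a \<circ> h) x))) / s) (at s)"
      by (simp add: p_def)
  qed
  then show ?thesis by (simp add: M_def f_def)
qed

lemma orbit_dist_scale: "c > 0 \<Longrightarrow> orbit_dist R (c *\<^sub>R x) (c *\<^sub>R y) = c * orbit_dist R x y"
proof -
  assume c: "c > 0"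
  have "norm (c *\<^sub>R x - g (c *\<^sub>R y)) = c * norm (x - g y)" if "g \<in> G" for g
    using c linear_scale[OF G_linear[OF that]] by (simp flip: scaleR_diff_right)
  then have "(\<lambda>g. norm (c *\<^sub>R x - g (c *\<^sub>R y))) ` G = (*) c ` ((\<lambda>g. norm (x - g y)) ` G)"
    by (auto simp: image_image)
  moreover have "mono ((*) c)" using c by (auto intro!: monoI mult_left_mono)
  moreover have "G \<noteq> {}" using id_in_G by auto
  ultimately show ?thesis unfolding orbit_dist_def
    using mono_Min_commute[of "(*) c" "(\<lambda>g. norm (x - g y)) ` G"] by simp
qed

text \<open>W is the volume model at radius sqrt (2 t), written in the scaled variable of the orbit
  system. Radii sqrt t and sqrt (2 t) differ by less than a factor 2, which costs the stated
  constants.\<close>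

lemma ball_weight_compare:
  fixes x :: "real ^ 'n" and t :: real
  assumes t: "t > 0"
  defines "W \<equiv> (2 * t) powr (homogeneous_dim R k / 2) * exp (\<Sum>a\<in>R. k a * ln (1 + \<bar>(x /\<^sub>R sqrt (2 * t)) \<bullet> a\<bar>))"
  shows "ball_weight x (sqrt t) \<le> W" "W \<le> 2 ^ CARD('n) * 2 powr (2 * K) * ball_weight x (sqrt t)"
proof -
  define s where "s = sqrt (2 * t)"
  have s: "s > 0" "sqrt t \<le> s" "s \<le> 2 * sqrt t" using t by (auto simp: s_def intro!: real_le_lsqrt)
  have "exp (\<Sum>a\<in>R. k a * ln (1 + \<bar>(x /\<^sub>R s) \<bullet> a\<bar>)) = (\<Prod>a\<in>R. (1 + \<bar>(x /\<^sub>R s) \<bullet> a\<bar>) powr k a)"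
    unfolding exp_sum[OF finR] using s by (intro prod.cong refl) (simp add: powr_def)
  moreover have "(2 * t) powr (homogeneous_dim R k / 2) = s ^ CARD('n) * s powr (2 * K)"
  proof -
    have "(2 * t) powr (homogeneous_dim R k / 2) = s powr homogeneous_dim R k"
      using t by (simp add: s_def powr_half_sqrt[symmetric] powr_powr)
    then show ?thesis using s by (simp add: homogeneous_dim_def sum_k powr_add powr_realpow)
  qed
  ultimately have "W = s ^ CARD('n) * (s powr (2 * K) * (\<Prod>a\<in>R. (1 + \<bar>(x /\<^sub>R s) \<bullet> a\<bar>) powr k a))"
    by (simp add: W_def s_def[symmetric])
  also have "s powr (2 * K) * (\<Prod>a\<in>R. (1 + \<bar>(x /\<^sub>R s) \<bullet> a\<bar>) powr k a) = (\<Prod>a\<in>R. (s * (1 + \<bar>(x /\<^sub>R s) \<bullet> a\<bar>)) powr k a)"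
    using s by (intro prod_powr_scale[symmetric]) auto
  also have "\<dots> = (\<Prod>a\<in>R. (s + \<bar>x \<bullet> a\<bar>) powr k a)"
    using s by (intro prod.cong refl) (simp add: distrib_left abs_mult flip: mult.assoc)
  finally have W: "W = s ^ CARD('n) * (\<Prod>a\<in>R. (s + \<bar>x \<bullet> a\<bar>) powr k a)" .
  have kn: "k a \<ge> 0" if "a \<in> R" for a using k_pos[OF that] by simp
  show "ball_weight x (sqrt t) \<le> W" unfolding W ball_weight_def
    using s t kn by (intro mult_mono power_mono prod_mono conjI powr_mono2 prod_nonneg) auto
  have "W \<le> (2 * sqrt t) ^ CARD('n) * (\<Prod>a\<in>R. (2 * (sqrt t + \<bar>x \<bullet> a\<bar>)) powr k a)"
    unfolding W using s t kn by (intro mult_mono power_mono prod_mono conjI powr_mono2 prod_nonneg) auto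
  also have "(\<Prod>a\<in>R. (2 * (sqrt t + \<bar>x \<bullet> a\<bar>)) powr k a) = 2 powr (2 * K) * (\<Prod>a\<in>R. (sqrt t + \<bar>x \<bullet> a\<bar>) powr k a)"
    using t by (intro prod_powr_scale) auto
  finally show "W \<le> 2 ^ CARD('n) * 2 powr (2 * K) * ball_weight x (sqrt t)"
    by (simp add: ball_weight_def power_mult_distrib mult_ac)
qed

text \<open>The maximum of X \<bullet> g Y is half of |X|^2 + |Y|^2 minus the squared orbit
  distance. Factoring out its exponential, as u does, therefore leaves of the Gaussian factors only
  the one in the orbit distance.\<close>

lemma heat_kernel_scaled:
  fixes x y :: "real ^ 'n"
  assumes t: "t > 0" and Rp: "R = Rp \<union> uminus ` Rp"
  defines "X \<equiv> x /\<^sub>R sqrt (2 * t)" and "Y \<equiv> y /\<^sub>R sqrt (2 * t)"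
  obtains u where "path_system R k X Y u Rp"
    "dunkl_heat_kernel R k t x y = inverse (gauss_const R k) * (2 * t) powr (- homogeneous_dim R k / 2)
       * exp (- (orbit_dist R X Y)\<^sup>2 / 2) * u id 1"
    "path_system.dist_sum R X Y Rp = Lambda_sum R Rp x y t"
    "(orbit_dist R X Y)\<^sup>2 = (orbit_dist R x y)\<^sup>2 / (2 * t)"
proof -
  define s where "s = sqrt (2 * t)"
  have s: "s > 0" "s\<^sup>2 = 2 * t" using t by (simp_all add: s_def)
  define u where "u = (\<lambda>h r. exp (- r * Max ((\<lambda>g. X \<bullet> g Y) ` G)) * dunkl_kernel R k (r *\<^sub>R ginv h X) Y)"
  interpret O: orbit_system R k X Y u unfolding u_def by (rule kernel_orbit_system)
  interpret P: path_system R k X Y u Rp by unfold_locales (rule Rp)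
  have XY: "X = inverse s *\<^sub>R x" "Y = inverse s *\<^sub>R y" by (simp_all add: X_def Y_def s_def)
  have is2: "(inverse s)\<^sup>2 = 1 / (2 * t)" unfolding power_inverse s(2) by (rule inverse_eq_divide)
  have dist: "orbit_dist R X Y = inverse s * orbit_dist R x y" unfolding XY using s by (intro orbit_dist_scale) simp
  have d2: "(orbit_dist R X Y)\<^sup>2 = (orbit_dist R x y)\<^sup>2 / (2 * t)"
    unfolding dist power_mult_distrib is2 by simp
  have nXY: "norm (X - g Y) = inverse s * norm (x - g y)" if "g \<in> G" for g
  proof -
    have "X - g Y = inverse s *\<^sub>R (x - g y)" unfolding XY using linear_scale[OF G_linear[OF that]] by (simp add: scaleR_diff_right)
    then show ?thesis using s by simp
  qed
  have sub: "Rp \<subseteq> R" using Rp by auto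
  have Admissible: "P.Admissible id = {as \<in> admissible_seqs R Rp x y. length as \<le> 2 * card G}"
  proof -
    have "O.b (seq_reflection as \<circ> id) = 0 \<longleftrightarrow> norm (x - seq_reflection as y) = orbit_dist R x y" if "set as \<subseteq> Rp" for as
    proof -
      have g: "seq_reflection as \<in> G" using that sub by auto
      have "O.b (seq_reflection as \<circ> id) = 0 \<longleftrightarrow> norm (X - seq_reflection as Y) = orbit_dist R X Y"
        using O.b_eq_0_iff[OF g] by (simp add: O.d_def)
      then show ?thesis unfolding nXY[OF g] dist using s by simp
    qed
    then show ?thesis unfolding P.Admissible_def P.short_seqs_def admissible_seqs_def by auto
  qed
  have dist_weight: "P.dist_weight as = seq_weight as x y t" if "set as \<subseteq> Rp" for as
  proof -
    have "sqrt 2 * norm (X - seq_reflection (take j as) Y) = norm (x - seq_reflection (take j as) y) / sqrt t" for j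
    proof -
      have "seq_reflection (take j as) \<in> G" using that sub set_take_subset[of j as] by auto
      then show ?thesis using t by (simp add: nXY s_def real_sqrt_mult divide_inverse)
    qed
    then show ?thesis unfolding P.dist_weight_def seq_weight_def by simp
  qed
  have dist_sum: "P.dist_sum = Lambda_sum R Rp x y t"
    unfolding P.dist_sum_def Lambda_sum_def Admissible by (intro sum.cong refl dist_weight) (simp add: admissible_seqs_def)
  have "dunkl_kernel R k X Y = exp (Max ((\<lambda>g. X \<bullet> g Y) ` G)) * u id 1"
    by (simp add: u_def exp_minus inv_id[unfolded id_def] id_def)
  moreover have "Max ((\<lambda>g. X \<bullet> g Y) ` G) = ((norm X)\<^sup>2 + (norm Y)\<^sup>2) / 2 - (orbit_dist R X Y)\<^sup>2 / 2"
    using O.d_square by (simp add: O.d_def field_simps)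
  moreover have "- ((norm x)\<^sup>2 + (norm y)\<^sup>2) / (4 * t) = - (((norm X)\<^sup>2 + (norm Y)\<^sup>2) / 2)"
  proof -
    have "(norm X)\<^sup>2 = (norm x)\<^sup>2 / (2 * t)" "(norm Y)\<^sup>2 = (norm y)\<^sup>2 / (2 * t)"
      unfolding XY norm_scaleR power_mult_distrib power2_abs is2 by simp_all
    then show ?thesis by (simp add: add_divide_distrib diff_divide_distrib)
  qed
  ultimately have "dunkl_heat_kernel R k t x y = inverse (gauss_const R k) * (2 * t) powr (- homogeneous_dim R k / 2)
     * (exp (((norm X)\<^sup>2 + (norm Y)\<^sup>2) / 2 - (orbit_dist R X Y)\<^sup>2 / 2) * u id 1) * exp (- (((norm X)\<^sup>2 + (norm Y)\<^sup>2) / 2))"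
    unfolding dunkl_heat_kernel_def X_def[symmetric] Y_def[symmetric] by (simp only:)
  also have "\<dots> = inverse (gauss_const R k) * (2 * t) powr (- homogeneous_dim R k / 2)
     * (exp (((norm X)\<^sup>2 + (norm Y)\<^sup>2) / 2 - (orbit_dist R X Y)\<^sup>2 / 2) * exp (- (((norm X)\<^sup>2 + (norm Y)\<^sup>2) / 2))) * u id 1"
    by (simp add: mult_ac)
  also have "exp (((norm X)\<^sup>2 + (norm Y)\<^sup>2) / 2 - (orbit_dist R X Y)\<^sup>2 / 2) * exp (- (((norm X)\<^sup>2 + (norm Y)\<^sup>2) / 2))
    = exp (- (orbit_dist R X Y)\<^sup>2 / 2)" by (simp flip: exp_add)
  finally show ?thesis using that[OF P.path_system_axioms _ dist_sum d2] by blast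
qed

end

text \<open>Complete the square after ln (1 + D) \<le> D. In this way an arbitrarily small change of
  the Gaussian exponent swallows any power of 1 + D.\<close>

lemma log_absorb:
  fixes p e D :: real
  assumes "p \<ge> 0" "e > 0" "D \<ge> 0"
  shows "p * ln (1 + D) \<le> e * D\<^sup>2 + p\<^sup>2 / (4 * e)"
proof -
  have "p * ln (1 + D) \<le> p * D" using assms by (intro mult_left_mono ln_add_one_self_le_self) auto
  also have "\<dots> \<le> e * D\<^sup>2 + p\<^sup>2 / (4 * e)"
  proof -
    have "0 \<le> (2 * e * D - p)\<^sup>2 / (4 * e)" using assms by simp
    also have "\<dots> = e * D\<^sup>2 + p\<^sup>2 / (4 * e) - p * D" using assms by (simp add: power2_eq_square field_simps)
    finally show ?thesis by simp
  qed
  finally show ?thesis .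
qed

theorem theorem1p1:
  fixes R Rp :: "(real ^ 'n) set" and k :: "real ^ 'n \<Rightarrow> real" and c_u c_l :: real
  assumes "normalized_root_system R"
    and "positive_subsystem R Rp"
    and "multiplicity_function R k"
    and "0 < c_u" and "c_u < 1 / 4" and "c_l > 1 / 4"
  shows "\<exists>C_u>0. \<exists>C_l>0. \<forall>x y :: real ^ 'n. \<forall>t>0.
    C_l * inverse (measure (dunkl_measure R k) (cball x (sqrt t))) *
        exp (- c_l * (orbit_dist R x y)\<^sup>2 / t) * Lambda_sum R Rp x y t
      \<le> dunkl_heat_kernel R k t x y \<and>
    dunkl_heat_kernel R k t x y
      \<le> C_u * inverse (measure (dunkl_measure R k) (cball x (sqrt t))) *
        exp (- c_u * (orbit_dist R x y)\<^sup>2 / t) * Lambda_sum R Rp x y t"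
proof -
  interpret dunkl R k by unfold_locales (use assms in auto)
  have Rp: "R = Rp \<union> uminus ` Rp" using assms(2) by (simp add: positive_subsystem_def)
  define gc where "gc = gauss_const R k"
  have gc: "gc > 0" unfolding gc_def by (rule gauss_const_pos)
  obtain cm where cm: "cm > 0" "\<And>x s. s > 0 \<Longrightarrow> cm * ball_weight x s \<le> measure (dunkl_measure R k) (cball x s)"
    using measure_ball_lower by blast
  define Cm where "Cm = unit_ball_vol (real CARD('n)) * 2 powr (2 * K)"
  have Cm: "Cm > 0" by (simp add: Cm_def)
  define cm' where "cm' = cm / (2 ^ CARD('n) * 2 powr (2 * K))"
  have cm': "cm' > 0" using cm by (simp add: cm'_def)
  define c0 where "c0 = Min (insert 1 ((\<lambda>a. kap a / (2 * (1 + K))) ` R))"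
  have c0: "c0 > 0" "c0 \<le> 1" "\<And>a. a \<in> R \<Longrightarrow> c0 \<le> kap a / (2 * (1 + K))"
  proof -
    show "c0 > 0" unfolding c0_def using kap_pos K_nonneg by (subst Min_gr_iff) (auto intro!: divide_pos_pos)
    show "c0 \<le> 1" unfolding c0_def by (intro Min_le) auto
    show "c0 \<le> kap a / (2 * (1 + K))" if "a \<in> R" for a unfolding c0_def using that by (intro Min_le) auto
  qed
  \<comment> \<open>The constants of the path argument live in a locale that fixes x, y and u. They
    are written out again here because they must be chosen before x, y and t.\<close>
  define nL where "nL = real (card {as. set as \<subseteq> Rp \<and> length as \<le> 2 * card G})"
  define tt where "tt = 1 / (4 * K * nL + 2)"
  define CU where "CU = exp (K + 2 * K * ln (24 * (K + 1))) * (4 * real (card G) + 2) ^ card G * (1 / tt) ^ (2 * card G) * 8 ^ (2 * card G)"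
  define PU where "PU = 2 * K + 4 * real (card G)"
  define CL where "CL = c0 ^ (2 * card G) / nL
    * exp (- (2 * K + 1 + 2 * (64 / 3 * K) * ln (4 * (64 / 3 * K + 1)) + 2 * (64 / 3 * K) * ln (11 * (K + 1))))"
  define PL where "PL = 2 * (64 / 3 * K)"
  have tt: "tt > 0" using K_nonneg by (simp add: tt_def nL_def add_nonneg_pos)
  have CU: "CU > 0" using tt by (simp add: CU_def add_nonneg_pos)
  have P: "PU \<ge> 0" "PL \<ge> 0" using K_nonneg by (auto simp: PU_def PL_def)
  \<comment> \<open>In the scaled distance D the squared orbit distance over t is 2 D^2, so the
    kernel carries exp (- D^2 / 2) and the claim exp (- 2 c_u D^2). The gap of the exponents is what
    \<open>log_absorb\<close> may use; the same holds for c_l with the opposite sign.\<close>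
  define eu where "eu = 1 / 2 - 2 * c_u"
  define el where "el = 2 * c_l - 1 / 2"
  have eu: "eu > 0" and el: "el > 0" using assms by (auto simp: eu_def el_def)
  define Cup where "Cup = inverse gc * CU * exp (PU\<^sup>2 / (4 * eu)) * Cm"
  define Clo where "Clo = inverse gc * CL * exp (- (PL\<^sup>2 / (4 * el))) * cm'"
  have nL: "nL > 0"
  proof -
    have "finite Rp" using Rp finR by (metis finite_Un)
    then have "finite {as. set as \<subseteq> Rp \<and> length as \<le> 2 * card G}" by (rule finite_lists_length_le)
    moreover have "[] \<in> {as. set as \<subseteq> Rp \<and> length as \<le> 2 * card G}" by simp
    ultimately have "card {as. set as \<subseteq> Rp \<and> length as \<le> 2 * card G} > 0" unfolding card_gt_0_iff by blast
    then show ?thesis unfolding nL_def by (rule of_nat_0_less_iff[THEN iffD2])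
  qed
  have CL: "CL > 0" using c0 nL by (simp add: CL_def)
  have pos: "Cup > 0" "Clo > 0" using gc CU CL Cm cm' by (simp_all add: Cup_def Clo_def)
  have main: "Clo * inverse (measure (dunkl_measure R k) (cball x (sqrt t))) *
        exp (- c_l * (orbit_dist R x y)\<^sup>2 / t) * Lambda_sum R Rp x y t \<le> dunkl_heat_kernel R k t x y \<and>
    dunkl_heat_kernel R k t x y \<le> Cup * inverse (measure (dunkl_measure R k) (cball x (sqrt t))) *
        exp (- c_u * (orbit_dist R x y)\<^sup>2 / t) * Lambda_sum R Rp x y t" if t: "t > 0" for x y :: "real ^ 'n" and t
  proof -
    define X where "X = x /\<^sub>R sqrt (2 * t)"
    define Y where "Y = y /\<^sub>R sqrt (2 * t)"
    obtain u where u: "path_system R k X Y u Rp"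
      "dunkl_heat_kernel R k t x y = inverse (gauss_const R k) * (2 * t) powr (- homogeneous_dim R k / 2)
         * exp (- (orbit_dist R X Y)\<^sup>2 / 2) * u id 1"
      "path_system.dist_sum R X Y Rp = Lambda_sum R Rp x y t"
      "(orbit_dist R X Y)\<^sup>2 = (orbit_dist R x y)\<^sup>2 / (2 * t)"
      using heat_kernel_scaled[OF t Rp, of x y] unfolding X_def Y_def by blast
    interpret Q: path_system R k X Y u Rp by (rule u(1))
    define D where "D = orbit_dist R X Y"
    have D: "D \<ge> 0" "D = Q.d" using Q.d_nonneg by (auto simp: D_def Q.d_def)
    define L where "L = Lambda_sum R Rp x y t"
    have L: "L = Q.dist_sum" "L \<ge> 0" using u(3) Q.dist_sum_nonneg by (auto simp: L_def)
    define m where "m = measure (dunkl_measure R k) (cball x (sqrt t))"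
    define T where "T = (2 * t) powr (homogeneous_dim R k / 2)"
    have T: "T > 0" using t by (simp add: T_def)
    have Tm: "(2 * t) powr (- homogeneous_dim R k / 2) = inverse T" by (simp add: T_def powr_minus)
    define W where "W = T * exp Q.log_weight"
    have W: "W > 0" using T by (simp add: W_def)
    have Wc: "ball_weight x (sqrt t) \<le> W" "W \<le> 2 ^ CARD('n) * 2 powr (2 * K) * ball_weight x (sqrt t)"
      unfolding W_def T_def Q.log_weight_def Q.xi_def unfolding X_def by (rule ball_weight_compare[OF t])+
    have st: "sqrt t > 0" using t by simp
    have m0: "m > 0" unfolding m_def by (rule measure_ball_pos[OF st])
    have "m \<le> Cm * ball_weight x (sqrt t)" unfolding m_def Cm_def by (rule measure_ball_upper[OF st])
    also have "\<dots> \<le> Cm * W" using Wc(1) Cm by (intro mult_left_mono) auto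
    finally have mW: "inverse W \<le> Cm * inverse m" using W m0 by (simp add: field_simps)
    have "cm' * W \<le> cm * ball_weight x (sqrt t)"
    proof -
      have "cm' * W \<le> cm' * (2 ^ CARD('n) * 2 powr (2 * K) * ball_weight x (sqrt t))"
        using Wc(2) cm' by (intro mult_left_mono) auto
      then show ?thesis by (simp add: cm'_def)
    qed
    also have "\<dots> \<le> m" unfolding m_def by (rule cm(2)[OF st])
    finally have Wm: "cm' * inverse m \<le> inverse W" using W m0 by (simp add: field_simps)
    have h: "dunkl_heat_kernel R k t x y = inverse gc * inverse T * exp (- D\<^sup>2 / 2) * u id 1"
      unfolding gc_def D_def Tm[symmetric] by (rule u(2))
    have WT: "inverse T * exp (- Q.log_weight) = inverse W" by (simp add: W_def exp_minus)
    have D2: "(orbit_dist R x y)\<^sup>2 / t = 2 * D\<^sup>2" using u(4) t by (simp add: D_def)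
    have upper: "dunkl_heat_kernel R k t x y \<le> Cup * inverse m * exp (- c_u * (orbit_dist R x y)\<^sup>2 / t) * L"
    proof -
      have "u id 1 \<le> CU * exp (PU * ln (1 + D)) * exp (- Q.log_weight) * L"
        using Q.u_final_upper unfolding Q.Cpath_def Q.t0_def Q.short_seqs_def nL_def[symmetric] tt_def[symmetric] CU_def PU_def D(2) L(1)
        by (simp add: mult_ac)
      then have "dunkl_heat_kernel R k t x y \<le> inverse gc * inverse T * exp (- D\<^sup>2 / 2) * (CU * exp (PU * ln (1 + D)) * exp (- Q.log_weight) * L)"
        unfolding h using gc T by (intro mult_left_mono) auto
      also have "\<dots> = inverse gc * CU * L * (exp (- D\<^sup>2 / 2) * exp (PU * ln (1 + D))) * inverse W"
        unfolding WT[symmetric] by (simp add: mult_ac)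
      also have "\<dots> \<le> inverse gc * CU * L * (exp (PU\<^sup>2 / (4 * eu)) * exp (- c_u * (2 * D\<^sup>2))) * (Cm * inverse m)"
      proof (rule mult_mono[OF mult_left_mono mW])
        have "- D\<^sup>2 / 2 + PU * ln (1 + D) \<le> PU\<^sup>2 / (4 * eu) + - c_u * (2 * D\<^sup>2)"
          using log_absorb[OF P(1) eu D(1)] by (simp add: eu_def algebra_simps)
        then show "exp (- D\<^sup>2 / 2) * exp (PU * ln (1 + D)) \<le> exp (PU\<^sup>2 / (4 * eu)) * exp (- c_u * (2 * D\<^sup>2))"
          unfolding exp_add[symmetric] by simp
      qed (use gc CU L W in auto)
      also have "\<dots> = Cup * inverse m * exp (- c_u * (2 * D\<^sup>2)) * L" by (simp add: Cup_def mult_ac)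
      finally show ?thesis by (simp only: D2[symmetric] times_divide_eq_right)
    qed
    have lower: "Clo * inverse m * exp (- c_l * (orbit_dist R x y)\<^sup>2 / t) * L \<le> dunkl_heat_kernel R k t x y"
    proof -
      have "CL * exp (- PL * ln (1 + D)) * exp (- Q.log_weight) * L \<le> u id 1"
        using Q.u_final_lower[OF c0] unfolding Q.short_seqs_def nL_def[symmetric] CL_def PL_def D(2) L(1)
        by (simp add: mult_ac)
      then have le: "inverse gc * inverse T * exp (- D\<^sup>2 / 2) * (CL * exp (- PL * ln (1 + D)) * exp (- Q.log_weight) * L) \<le> dunkl_heat_kernel R k t x y"
        unfolding h using gc T by (intro mult_left_mono) auto
      have "Clo * inverse m * exp (- c_l * (2 * D\<^sup>2)) * L =
        inverse gc * CL * L * (exp (- (PL\<^sup>2 / (4 * el))) * exp (- c_l * (2 * D\<^sup>2))) * (cm' * inverse m)"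
        by (simp add: Clo_def mult_ac)
      also have "\<dots> \<le> inverse gc * CL * L * (exp (- D\<^sup>2 / 2) * exp (- PL * ln (1 + D))) * inverse W"
      proof (rule mult_mono[OF mult_left_mono Wm])
        have "- (PL\<^sup>2 / (4 * el)) + - c_l * (2 * D\<^sup>2) \<le> - D\<^sup>2 / 2 + - PL * ln (1 + D)"
          using log_absorb[OF P(2) el D(1)] by (simp add: el_def algebra_simps)
        then show "exp (- (PL\<^sup>2 / (4 * el))) * exp (- c_l * (2 * D\<^sup>2)) \<le> exp (- D\<^sup>2 / 2) * exp (- PL * ln (1 + D))"
          unfolding exp_add[symmetric] by simp
      qed (use gc CL L W cm' m0 in auto)
      also have "\<dots> = inverse gc * inverse T * exp (- D\<^sup>2 / 2) * (CL * exp (- PL * ln (1 + D)) * exp (- Q.log_weight) * L)"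
        unfolding WT[symmetric] by (simp add: mult_ac)
      also have "\<dots> \<le> dunkl_heat_kernel R k t x y" by (rule le)
      finally show ?thesis by (simp only: D2[symmetric] times_divide_eq_right)
    qed
    show ?thesis using upper lower unfolding m_def L_def by blast
  qed
  show ?thesis using pos main by blast
qed

end
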